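(* Let $d\ge3$ be an integer, $\gamma\in(0,2)$ and $1<p<\frac{d-\gamma}{d-2}$. For any $M>0$, the minimization problem $$\inf\Big\{\tfrac12\,\|\nabla w\|_2^2+\tfrac1{p+1}\,\|w\|_{p+1,\gamma}^{p+1}\,:\,w\in\mathcal H_{p,\gamma}(\mathbb R^d)\,,\ \|w\|_{2p,\gamma}^{2p}=M\Big\}$$ admits at least one solution, i.e., the infimum is attained by some $w_\gamma\in\mathcal H_{p,\gamma}(\mathbb R^d)$ with $\|w_\gamma\|_{2p,\gamma}^{2p}=M$.
   Context: For $q\ge1$, $\gamma\ge0$: $\|w\|_{q,\gamma}:=\left(\int_{\mathbb R^d}|w|^q\,|x|^{-\gamma}\,dx\right)^{1/q}$, $\|w\|_q:=\|w\|_{q,0}$. $\mathcal H_{p,\gamma}(\mathbb R^d)$ is the space of measurable functions $w$ on $\mathbb R^d$, with measurable (weak) gradient $\nabla w$, such that $\|w\|_{\mathcal H_{p,\gamma}(\mathbb R^d)}:=\|w\|_{p+1,\gamma}+\|\nabla w\|_2$ is finite. *)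

theory Defs
  imports "HOL-Analysis.Analysis"
begin

text \<open>Real powers of extended nonnegative numbers, for exponents \<open>a > 0\<close>.\<close>

definition ennreal_powr :: "ennreal \<Rightarrow> real \<Rightarrow> ennreal" where
  "ennreal_powr x a = (if x = \<infinity> then \<infinity> else ennreal (enn2real x powr a))"

text \<open>
  The norm takes values in \<open>[0, \<infinity>]\<close>, so that finiteness is a genuine condition. At the origin
  the weight is \<open>0 powr (-\<gamma>) = 0\<close>, also for \<open>\<gamma> = 0\<close>; this affects only a null set.
\<close>

definition weighted_norm ::
    "real \<Rightarrow> real \<Rightarrow> ('a::euclidean_space \<Rightarrow> 'b::real_normed_vector) \<Rightarrow> ennreal" where
  "weighted_norm q \<gamma> w =
     ennreal_powr (\<integral>\<^sup>+ x. ennreal (norm (w x) powr q * norm x powr (- \<gamma>)) \<partial>lebesgue) (1 / q)"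

abbreviation Lq_norm :: "real \<Rightarrow> ('a::euclidean_space \<Rightarrow> 'b::real_normed_vector) \<Rightarrow> ennreal" where
  "Lq_norm q w \<equiv> weighted_norm q 0 w"

primrec Ck :: "nat \<Rightarrow> ('a::euclidean_space \<Rightarrow> real) \<Rightarrow> bool" where
  "Ck 0 f \<longleftrightarrow> continuous_on UNIV f"
| "Ck (Suc k) f \<longleftrightarrow>
     (\<forall>x. f differentiable (at x)) \<and> (\<forall>v. Ck k (\<lambda>x. frechet_derivative f (at x) v))"

definition test_function :: "('a::euclidean_space \<Rightarrow> real) \<Rightarrow> bool" where
  "test_function \<phi> \<longleftrightarrow> (\<forall>k. Ck k \<phi>) \<and> compact (closure {x. \<phi> x \<noteq> 0})"

definition locally_integrable ::
    "('a::euclidean_space \<Rightarrow> 'b::{banach, second_countable_topology}) \<Rightarrow> bool" where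
  "locally_integrable f \<longleftrightarrow>
     f \<in> borel_measurable lebesgue \<and> (\<forall>K. compact K \<longrightarrow> set_integrable lebesgue K f)"

definition has_weak_gradient :: "('a::euclidean_space \<Rightarrow> real) \<Rightarrow> ('a \<Rightarrow> 'a) \<Rightarrow> bool" where
  "has_weak_gradient w g \<longleftrightarrow>
     locally_integrable w \<and> locally_integrable g \<and>
     (\<forall>\<phi>. test_function \<phi> \<longrightarrow> (\<forall>b\<in>Basis.
        (\<integral>x. w x * frechet_derivative \<phi> (at x) b \<partial>lebesgue) =
        - (\<integral>x. (g x \<bullet> b) * \<phi> x \<partial>lebesgue)))"

text \<open>
  A weak gradient is unique up to null sets, so its norms do not depend on the choice made here.
  The value is meaningful only if a weak gradient exists.
\<close>

definition weak_gradient :: "('a::euclidean_space \<Rightarrow> real) \<Rightarrow> 'a \<Rightarrow> 'a" where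
  "weak_gradient w = (SOME g. has_weak_gradient w g)"

definition H_norm :: "real \<Rightarrow> real \<Rightarrow> ('a::euclidean_space \<Rightarrow> real) \<Rightarrow> ennreal" where
  "H_norm p \<gamma> w = weighted_norm (p + 1) \<gamma> w + Lq_norm 2 (weak_gradient w)"

text \<open>
  Local integrability in \<^const>\<open>has_weak_gradient\<close> is no extra restriction: it follows from the
  finiteness of the two norms, as the weight is bounded
  below by a positive constant on every punctured ball about the origin.
\<close>

definition H_space :: "real \<Rightarrow> real \<Rightarrow> ('a::euclidean_space \<Rightarrow> real) set" where
  "H_space p \<gamma> =
     {w. w \<in> borel_measurable lebesgue \<and> (\<exists>g. has_weak_gradient w g) \<and> H_norm p \<gamma> w < \<infinity>}"

definition energy :: "real \<Rightarrow> real \<Rightarrow> ('a::euclidean_space \<Rightarrow> real) \<Rightarrow> ennreal" where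
  "energy p \<gamma> w =
     ennreal (1 / 2) * ennreal_powr (Lq_norm 2 (weak_gradient w)) 2 +
     ennreal (1 / (p + 1)) * ennreal_powr (weighted_norm (p + 1) \<gamma> w) (p + 1)"

definition admissible :: "real \<Rightarrow> real \<Rightarrow> real \<Rightarrow> ('a::euclidean_space \<Rightarrow> real) set" where
  "admissible p \<gamma> M =
     {w \<in> H_space p \<gamma>. ennreal_powr (weighted_norm (2 * p) \<gamma> w) (2 * p) = ennreal M}"

end

theory Submission
  imports Defs "HOL-Complex_Analysis.Great_Picard"
begin

text \<open>
  Since \<open>\<gamma> > 0\<close> and \<open>2p\<close> is subcritical, sequences of bounded energy are precompact for the
  constraint norm. All that compactness needs of the weak gradient is the translation estimate
  \<open>\<parallel>w(\<cdot> + h) - w\<parallel>\<^sub>2 \<le> |h| \<parallel>\<nabla>w\<parallel>\<^sub>2\<close>. Comparing \<open>w\<close> with its averages \<open>A\<^sub>r w\<close> over cubes of side \<open>r\<close>,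
  it gives \<open>\<parallel>A\<^sub>r w - w\<parallel>\<^sub>2 \<le> C r \<parallel>\<nabla>w\<parallel>\<^sub>2\<close> and, by telescoping over the scales \<open>2\<^sup>k r\<close>,
  \<open>|A\<^sub>r w| \<le> C r\<^bsup>1 - d/2\<^esup> \<parallel>\<nabla>w\<parallel>\<^sub>2\<close>. An \<open>r\<close> chosen according to the level \<open>t\<close> turns this into the
  weak-type Sobolev inequality \<open>|{|w| > t}| \<le> C t\<^bsup>-2d/(d-2)\<^esup>\<close>, which excludes concentration and,
  thanks to the decaying weight, loss of mass at infinity; the equicontinuity of \<open>A\<^sub>r w\<close> gives
  local compactness. Along a minimizing sequence the midpoints are then almost admissible, so by
  scaling and the parallelogram identity the gradients form a Cauchy sequence in \<open>L\<^sup>2\<close>. The limit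
  is a minimizer by Fatou's lemma.
\<close>

subsection \<open>Smooth bump functions\<close>

text \<open>The bound on \<open>p\<close> says that \<open>2 * p\<close> lies below
  \<open>2 * (d - \<gamma>) / (d - 2)\<close>, the critical exponent for the weight. As the
  inequality is strict, no sharp embedding is required: the weak-type bound controls every power
  below \<open>2 * d / (d - 2)\<close> on a superlevel set, and the room that is left is spent on
  the singularity of the weight at the origin. Small values are harmless because
  \<open>2 * p > p + 1\<close>, so the energy itself controls them.

  The constraint set is not convex, so minimality cannot be applied to a midpoint directly. A scalar
  multiple of the midpoint satisfies the constraint, at the cost of a factor that is close to 1 only
  if the midpoint has lost little mass. Convergence of the functions in the constraint norm
  therefore has to precede any convergence of gradients. Strong convergence of the gradients then
  lets the integration by parts identity pass to the limit.

  The analysis is done for pairs of Borel functions \<open>(w, g)\<close>, since translations and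
  Fubini's theorem call for joint measurability; representatives that agree almost everywhere make
  the link with Lebesgue measurable functions and with the chosen
  \<open>weak_gradient\<close>.\<close>

lemma Ck_SucI:
  assumes "\<And>x. (f has_derivative f' x) (at x)" "\<And>v. Ck k (\<lambda>x. f' x v)"
  shows "Ck (Suc k) f"
proof -
  have "frechet_derivative f (at x) = f' x" for x
    using frechet_derivative_at[OF assms(1)] by simp
  moreover have "f differentiable (at x)" for x
    using assms(1) by (rule differentiableI)
  ultimately show ?thesis using assms(2) by simp
qed

lemma Ck_SucD:
  assumes "Ck (Suc k) f"
  shows "(f has_derivative frechet_derivative f (at x)) (at x)"
    "Ck k (\<lambda>x. frechet_derivative f (at x) v)"
  using assms by (simp_all add: frechet_derivative_works)

lemma Ck_Suc_imp_Ck: "Ck (Suc k) f \<Longrightarrow> Ck k f"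
proof (induction k arbitrary: f)
  case 0
  then show ?case
    by (simp add: continuous_at_imp_continuous_on differentiable_imp_continuous_within)
next
  case (Suc k)
  then show ?case by (metis Ck.simps(2))
qed

lemma Ck_const: "Ck k (\<lambda>x. c)"
proof (induction k arbitrary: c)
  case (Suc k)
  show ?case by (rule Ck_SucI[where f' = "\<lambda>x v. 0"]) (auto intro: Suc)
qed simp

lemma Ck_add: "Ck k f \<Longrightarrow> Ck k g \<Longrightarrow> Ck k (\<lambda>x. f x + g x)"
proof (induction k arbitrary: f g)
  case 0
  then show ?case by (simp add: continuous_on_add)
next
  case (Suc k)
  show ?case
    by (rule Ck_SucI[OF has_derivative_add[OF Ck_SucD(1)[OF Suc.prems(1)] Ck_SucD(1)[OF Suc.prems(2)]]])
      (intro Suc.IH Ck_SucD(2) Suc.prems)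
qed

lemma Ck_mult: "Ck k f \<Longrightarrow> Ck k g \<Longrightarrow> Ck k (\<lambda>x. f x * g x)"
proof (induction k arbitrary: f g)
  case 0
  then show ?case by (simp add: continuous_on_mult)
next
  case (Suc k)
  show ?case
    by (rule Ck_SucI[OF has_derivative_mult[OF Ck_SucD(1)[OF Suc.prems(1)] Ck_SucD(1)[OF Suc.prems(2)]]])
      (intro Ck_add Suc.IH Ck_SucD(2) Suc.prems Ck_Suc_imp_Ck[OF Suc.prems(1)] Ck_Suc_imp_Ck[OF Suc.prems(2)])
qed

lemma Ck_prod: "(\<And>i. i \<in> I \<Longrightarrow> Ck k (f i)) \<Longrightarrow> Ck k (\<lambda>x. \<Prod>i\<in>I. f i x)"
  by (induction I rule: infinite_finite_induct) (auto intro: Ck_const Ck_mult)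

text \<open>The classical smooth function \<open>exp (- 1 / t)\<close> with all derivatives zero at
  the origin, together with its quotients by powers of \<open>t\<close>. The index \<open>k\<close>
  makes the family closed under differentiation up to linear combinations, so that smoothness
  follows by induction with \<open>k\<close> arbitrary.\<close>

definition flat :: "nat \<Rightarrow> real \<Rightarrow> real" where
  "flat k t = (if t > 0 then exp (- 1 / t) / t ^ k else 0)"

text \<open>From the right, with \<open>1 / t\<close> as the new variable, the exponential beats
  every power; from the left the function is identically zero.\<close>

lemma flat_tendsto_0: "(flat k \<longlongrightarrow> 0) (at 0)"
proof -
  have "((\<lambda>t. inverse t ^ k / exp (inverse t)) \<longlongrightarrow> (0::real)) (at_right 0)"
    by (rule filterlim_compose[OF tendsto_power_div_exp_0 filterlim_inverse_at_top_right])
  moreover have "eventually (\<lambda>t. inverse t ^ k / exp (inverse t) = flat k t) (at_right 0)"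
    by (auto simp: eventually_at_filter flat_def exp_minus field_simps intro!: always_eventually)
  ultimately have "(flat k \<longlongrightarrow> 0) (at_right 0)"
    by (rule Lim_transform_eventually)
  moreover have "eventually (\<lambda>t. 0 = flat k t) (at_left 0)"
    by (auto simp: eventually_at_filter flat_def intro!: always_eventually)
  then have "(flat k \<longlongrightarrow> 0) (at_left 0)"
    by (rule Lim_transform_eventually[rotated]) simp
  ultimately show ?thesis by (simp add: filterlim_split_at)
qed

lemma flat_has_derivative:
  "(flat k has_field_derivative (flat (k + 2) t - real k * flat (k + 1) t)) (at t)"
proof -
  consider "t > 0" | "t < 0" | "t = 0" by linarith
  then show ?thesis
  proof cases
    case 1
    have "((\<lambda>t. exp (- 1 / t) / t ^ k) has_field_derivative (flat (k + 2) t - real k * flat (k + 1) t)) (at t)"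
      using 1 apply (auto intro!: derivative_eq_intros simp: flat_def)
      apply (cases k)
       apply (auto simp: field_simps power2_eq_square power_add)
      done
    then show ?thesis
      by (rule has_field_derivative_transform_within[where d = t])
        (use 1 in \<open>auto simp: flat_def dist_real_def\<close>)
  next
    case 2
    have "((\<lambda>t. 0) has_field_derivative (flat (k + 2) t - real k * flat (k + 1) t)) (at t)"
      using 2 by (simp add: flat_def)
    then show ?thesis
      by (rule has_field_derivative_transform_within[where d = "-t"])
        (use 2 in \<open>auto simp: flat_def dist_real_def\<close>)
  next
    case 3
    \<comment> \<open>At the origin the difference quotient of \<open>flat k\<close> is itself
      \<open>flat (k + 1)\<close>, whose limit is 0.\<close>
    have "eventually (\<lambda>h. flat (k + 1) h = (flat k h - flat k 0) / (h - 0)) (at 0)"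
      by (auto simp: eventually_at_filter flat_def intro!: always_eventually)
    then have "((\<lambda>h. (flat k h - flat k 0) / (h - 0)) \<longlongrightarrow> 0) (at 0)"
      by (rule Lim_transform_eventually[OF flat_tendsto_0])
    then show ?thesis
      using 3 by (simp add: has_field_derivative_iff flat_def)
  qed
qed

lemma continuous_flat: "continuous_on UNIV (flat k)"
  using flat_has_derivative DERIV_isCont continuous_at_imp_continuous_on by blast

lemma Ck_flat_affine: "Ck m (\<lambda>x. flat k (c * (x \<bullet> i) + e))"
proof (induction m arbitrary: k)
  case 0
  show ?case by (simp, intro continuous_on_compose2[OF continuous_flat] continuous_intros) auto
next
  case (Suc m)
  show ?case
  proof (rule Ck_SucI)
    show "((\<lambda>x. flat k (c * (x \<bullet> i) + e)) has_derivative
        (\<lambda>v. (c * (v \<bullet> i)) * (flat (k + 2) (c * (x \<bullet> i) + e) + (- real k) * flat (k + 1) (c * (x \<bullet> i) + e)))) (at x)" for x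
      by (rule DERIV_compose_FDERIV[OF flat_has_derivative, THEN has_derivative_eq_rhs])
        (auto intro!: derivative_eq_intros simp: fun_eq_iff algebra_simps)
    show "Ck m (\<lambda>x. (c * (v \<bullet> i)) * (flat (k + 2) (c * (x \<bullet> i) + e) + (- real k) * flat (k + 1) (c * (x \<bullet> i) + e)))" for v
      by (intro Ck_mult Ck_add Ck_const Suc)
  qed
qed

text \<open>A product of one-dimensional bumps. The parameter \<open>c\<close> governs the
  steepness: the set where the function is nonzero stays the open box while the values tend to 1 on
  it as \<open>c\<close> grows. The arguments are spelled out in the affine form that
  \<open>Ck_flat_affine\<close> covers.\<close>

definition bump :: "'a::euclidean_space \<Rightarrow> 'a \<Rightarrow> real \<Rightarrow> 'a \<Rightarrow> real" where
  "bump a b c x = (\<Prod>i\<in>Basis. flat 0 (c * (x \<bullet> i) + (- c * (a \<bullet> i))) * flat 0 ((- c) * (x \<bullet> i) + c * (b \<bullet> i)))"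

lemma flat_0_bounds: "0 \<le> flat 0 t" "flat 0 t \<le> 1"
  by (auto simp: flat_def)

lemma bump_bounds: "0 \<le> bump a b c x" "bump a b c x \<le> 1"
  unfolding bump_def
  by (auto intro!: prod_nonneg prod_le_1 mult_nonneg_nonneg mult_le_one simp: flat_0_bounds)

lemma bump_nonzero_iff:
  assumes "c > 0"
  shows "bump a b c x \<noteq> 0 \<longleftrightarrow> x \<in> box a b"
proof -
  have "flat 0 (c * (x \<bullet> i) + (- c * (a \<bullet> i))) \<noteq> 0 \<longleftrightarrow> a \<bullet> i < x \<bullet> i" for i
  proof -
    have "c * (x \<bullet> i) + (- c * (a \<bullet> i)) = c * (x \<bullet> i - a \<bullet> i)" by (simp add: algebra_simps)
    then show ?thesis using assms by (simp add: flat_def zero_less_mult_iff)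
  qed
  moreover have "flat 0 ((- c) * (x \<bullet> i) + c * (b \<bullet> i)) \<noteq> 0 \<longleftrightarrow> x \<bullet> i < b \<bullet> i" for i
  proof -
    have "(- c) * (x \<bullet> i) + c * (b \<bullet> i) = c * (b \<bullet> i - x \<bullet> i)" by (simp add: algebra_simps)
    then show ?thesis using assms by (simp add: flat_def zero_less_mult_iff)
  qed
  ultimately show ?thesis
    by (auto simp: bump_def mem_box)
qed

lemma test_function_bump:
  assumes "c > 0"
  shows "test_function (bump a b c)"
proof -
  have "Ck k (bump a b c)" for k
    unfolding bump_def[abs_def] by (intro Ck_prod Ck_mult Ck_flat_affine)
  moreover have "closure {x. bump a b c x \<noteq> 0} \<subseteq> cbox a b"
    using bump_nonzero_iff[OF assms] box_subset_cbox[of a b]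
    by (intro closure_minimal) auto
  then have "compact (closure {x. bump a b c x \<noteq> 0})"
    by (meson bounded_cbox bounded_subset closed_closure compact_eq_bounded_closed)
  ultimately show ?thesis by (simp add: test_function_def)
qed

text \<open>Translates of bumps are bumps, so a translation can be moved from a function onto the
  test function without leaving this family.\<close>

lemma bump_shift: "bump a b c (x - h) = bump (a + h) (b + h) c x"
  unfolding bump_def by (intro prod.cong) (simp_all add: algebra_simps inner_add_left inner_diff_left)

lemma flat_0_tendsto_1: "t > 0 \<Longrightarrow> (\<lambda>n. flat 0 (real n * t)) \<longlonglongrightarrow> 1"
proof -
  assume t: "t > 0"
  have "(\<lambda>n. (- 1 / t) * (1 / real n)) \<longlonglongrightarrow> (- 1 / t) * 0"
    by (intro tendsto_intros lim_1_over_n)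
  then have "(\<lambda>n. exp ((- 1 / t) * (1 / real n))) \<longlonglongrightarrow> exp 0"
    by (intro tendsto_exp) simp
  moreover have "eventually (\<lambda>n. exp ((- 1 / t) * (1 / real n)) = flat 0 (real n * t)) sequentially"
    using eventually_gt_at_top[of 0] by eventually_elim (use t in \<open>auto simp: flat_def field_simps\<close>)
  ultimately have "(\<lambda>n. flat 0 (real n * t)) \<longlonglongrightarrow> exp 0"
    by (rule Lim_transform_eventually)
  then show ?thesis by simp
qed

text \<open>\<open>Suc\<close> keeps the steepness positive, so that each approximant is a test
  function and vanishes outside the box.\<close>

lemma bump_tendsto_indicator: "(\<lambda>n. bump a b (real (Suc n)) x) \<longlonglongrightarrow> indicator (box a b) x"
proof (cases "x \<in> box a b")
  case True
  have "(\<lambda>n. bump a b (real n) x) \<longlonglongrightarrow> (\<Prod>i\<in>(Basis::'a set). 1 * 1)"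
    unfolding bump_def
  proof (intro tendsto_prod tendsto_mult)
    fix i :: 'a assume "i \<in> Basis"
    with True have *: "x \<bullet> i - a \<bullet> i > 0" "b \<bullet> i - x \<bullet> i > 0" by (auto simp: mem_box)
    show "(\<lambda>n. flat 0 (real n * (x \<bullet> i) + (- real n * (a \<bullet> i)))) \<longlonglongrightarrow> 1"
      using flat_0_tendsto_1[OF *(1)] by (simp add: algebra_simps)
    show "(\<lambda>n. flat 0 ((- real n) * (x \<bullet> i) + real n * (b \<bullet> i))) \<longlonglongrightarrow> 1"
      using flat_0_tendsto_1[OF *(2)] by (simp add: algebra_simps)
  qed
  then show ?thesis using True by (subst filterlim_sequentially_Suc) simp
next
  case False
  then show ?thesis
    using bump_nonzero_iff[of "real (Suc _)" a b x] by auto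
qed

subsection \<open>Local integrability and the fundamental lemma\<close>

lemma nn_integral_lborel_affine:
  fixes f :: "'a::euclidean_space \<Rightarrow> ennreal"
  assumes [measurable]: "f \<in> borel_measurable borel" and "c \<noteq> 0"
  shows "(\<integral>\<^sup>+x. f x \<partial>lborel) = ennreal (\<bar>c\<bar> ^ DIM('a)) * (\<integral>\<^sup>+x. f (t + c *\<^sub>R x) \<partial>lborel)"
  by (subst lborel_affine[OF assms(2), of t]) (simp add: nn_integral_density nn_integral_distr nn_integral_cmult)

lemma nn_integral_lborel_shift:
  fixes f :: "'a::euclidean_space \<Rightarrow> ennreal"
  assumes [measurable]: "f \<in> borel_measurable borel"
  shows "(\<integral>\<^sup>+x. f (x + h) \<partial>lborel) = (\<integral>\<^sup>+x. f x \<partial>lborel)"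
  by (subst (2) lborel_distr_plus[symmetric, of h]) (simp add: nn_integral_distr add.commute)

lemma integrable_lborel_shift:
  fixes f :: "'a::euclidean_space \<Rightarrow> 'b::{banach, second_countable_topology}"
  assumes "integrable lborel f"
  shows "integrable lborel (\<lambda>x. f (x + h))"
proof -
  have "integrable (distr lborel borel ((+) h)) f"
    using assms by (simp add: lborel_distr_plus)
  then show ?thesis
    by (subst (asm) integrable_distr_eq) (use assms in \<open>auto simp: add.commute\<close>)
qed

lemma integral_lborel_shift:
  fixes f :: "'a::euclidean_space \<Rightarrow> 'b::{banach, second_countable_topology}"
  assumes [measurable]: "f \<in> borel_measurable borel"
  shows "(\<integral>x. f (x + h) \<partial>lborel) = (\<integral>x. f x \<partial>lborel)"
  by (subst (2) lborel_distr_plus[symmetric, of h]) (simp add: integral_distr add.commute)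

text \<open>The Borel counterpart of \<open>locally_integrable\<close>. For Borel functions a
  composition such as \<open>w (x + s *\<^sub>R h)\<close> is jointly measurable in \<open>s\<close>
  and \<open>x\<close>, as Fubini's theorem demands.\<close>

definition loc_int :: "('a::euclidean_space \<Rightarrow> 'b::euclidean_space) \<Rightarrow> bool" where
  "loc_int f \<longleftrightarrow> f \<in> borel_measurable borel \<and> (\<forall>K. compact K \<longrightarrow> set_integrable lborel K f)"

lemma loc_int_iff:
  assumes "f \<in> borel_measurable borel"
  shows "loc_int f \<longleftrightarrow> locally_integrable f"
proof -
  have "set_integrable lebesgue K f \<longleftrightarrow> set_integrable lborel K f" if "compact K" for K :: "'a set"
  proof -
    have [measurable]: "K \<in> sets borel" using that by (simp add: borel_compact)
    show ?thesis
      using assms unfolding set_integrable_def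
      by (intro integrable_completion) simp
  qed
  with assms show ?thesis
    by (auto simp: loc_int_def locally_integrable_def measurable_completion)
qed

lemma loc_int_measurable: "loc_int f \<Longrightarrow> f \<in> borel_measurable borel"
  by (simp add: loc_int_def)

lemma loc_int_add:
  assumes "loc_int f" "loc_int g" shows "loc_int (\<lambda>x. f x + g x)"
  using assms by (auto simp: loc_int_def intro: set_integral_add)

lemma loc_int_scaleR:
  assumes "loc_int f" shows "loc_int (\<lambda>x. c *\<^sub>R f x)"
  using assms by (auto simp: loc_int_def set_integrable_def scaleR_left_commute[of _ c] simp del: scaleR_scaleR)

lemma loc_int_inner:
  assumes "loc_int f" shows "loc_int (\<lambda>x. f x \<bullet> b)"
  using assms by (auto simp: loc_int_def set_integrable_def simp flip: inner_scaleR_left)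

lemma loc_int_shift:
  fixes f :: "'a::euclidean_space \<Rightarrow> 'b::euclidean_space"
  assumes "loc_int f" shows "loc_int (\<lambda>x. f (x + h))"
proof -
  have [measurable]: "f \<in> borel_measurable borel" using assms by (simp add: loc_int_def)
  have "set_integrable lborel K (\<lambda>x. f (x + h))" if "compact K" for K
  proof -
    have "compact ((\<lambda>x. x + h) ` K)"
      by (intro compact_continuous_image that continuous_intros)
    then have "integrable lborel (\<lambda>x. indicator ((\<lambda>x. x + h) ` K) x *\<^sub>R f x)"
      using assms by (simp add: loc_int_def set_integrable_def)
    from integrable_lborel_shift[OF this, of h] show ?thesis
      by (simp add: set_integrable_def indicator_def image_iff)
  qed
  then show ?thesis by (simp add: loc_int_def)
qed

lemma integrable_mult_compact_support:
  fixes f :: "'a::euclidean_space \<Rightarrow> 'b::euclidean_space" and \<phi> :: "'a \<Rightarrow> real"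
  assumes f: "loc_int f" and cont: "continuous_on UNIV \<phi>" and K: "compact K"
    and supp: "\<And>x. x \<notin> K \<Longrightarrow> \<phi> x = 0"
  shows "integrable lborel (\<lambda>x. \<phi> x *\<^sub>R f x)"
proof -
  have [measurable]: "f \<in> borel_measurable borel" "\<phi> \<in> borel_measurable borel"
    using f cont by (auto simp: loc_int_def intro: borel_measurable_continuous_onI)
  have "bounded (\<phi> ` K)"
    using K cont by (intro compact_imp_bounded compact_continuous_image) (auto intro: continuous_on_subset)
  then obtain C where C: "\<And>x. x \<in> K \<Longrightarrow> \<bar>\<phi> x\<bar> \<le> C"
    by (auto simp: bounded_iff)
  have "integrable lborel (\<lambda>x. C *\<^sub>R (indicator K x *\<^sub>R f x))"
    using f K by (auto simp: loc_int_def set_integrable_def simp del: scaleR_scaleR intro!: integrable_scaleR_right)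
  then show ?thesis
  proof (rule Bochner_Integration.integrable_bound)
    show "AE x in lborel. norm (\<phi> x *\<^sub>R f x) \<le> norm (C *\<^sub>R (indicator K x *\<^sub>R f x))"
    proof (intro AE_I2)
      fix x show "norm (\<phi> x *\<^sub>R f x) \<le> norm (C *\<^sub>R (indicator K x *\<^sub>R f x))"
        using C[of x] supp[of x] by (cases "x \<in> K") (auto intro!: mult_right_mono)
    qed
  qed simp
qed

text \<open>\<open>K\<close> is the closed support. Its complement is open and \<phi> vanishes
  there, hence so does the derivative.\<close>

lemma test_function_props:
  assumes "test_function \<phi>"
  obtains K where "compact K" "\<And>x. x \<notin> K \<Longrightarrow> \<phi> x = 0"
    "\<And>x v. x \<notin> K \<Longrightarrow> frechet_derivative \<phi> (at x) v = 0"
proof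
  let ?K = "closure {x. \<phi> x \<noteq> 0}"
  show "compact ?K" using assms by (simp add: test_function_def)
  show *: "\<phi> x = 0" if "x \<notin> ?K" for x
    using that closure_subset[of "{x. \<phi> x \<noteq> 0}"] by (metis (mono_tags, lifting) mem_Collect_eq subsetD)
  show "frechet_derivative \<phi> (at x) v = 0" if "x \<notin> ?K" for x v
  proof -
    have "((\<lambda>x. 0) has_derivative (\<lambda>_. 0)) (at x)" by simp
    then have "(\<phi> has_derivative (\<lambda>_. 0)) (at x)"
    proof (rule has_derivative_transform_within_open)
      show "open (- ?K)" by (intro open_Compl closed_closure)
      show "x \<in> - ?K" using that by (simp only: Compl_iff not_False_eq_True)
      show "0 = \<phi> y" if "y \<in> - ?K" for y using *[OF ComplD[OF that]] by (rule sym)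
    qed
    from frechet_derivative_at[OF this, symmetric] show ?thesis by simp
  qed
qed

lemma test_function_continuous:
  assumes "test_function \<phi>"
  shows "continuous_on UNIV \<phi>" "continuous_on UNIV (\<lambda>x. frechet_derivative \<phi> (at x) v)"
    "(\<phi> has_derivative frechet_derivative \<phi> (at x)) (at x)"
proof -
  have "Ck 0 \<phi>" "Ck (Suc 0) \<phi>" using assms by (auto simp only: test_function_def)
  then show "continuous_on UNIV \<phi>" "continuous_on UNIV (\<lambda>x. frechet_derivative \<phi> (at x) v)"
    by simp_all
  show "(\<phi> has_derivative frechet_derivative \<phi> (at x)) (at x)"
    using \<open>Ck (Suc 0) \<phi>\<close> by (rule Ck_SucD)
qed

lemma test_function_FTC:
  fixes \<phi> :: "'a::euclidean_space \<Rightarrow> real"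
  assumes \<phi>: "test_function \<phi>"
  shows "(\<integral>s. indicator {0..1::real} s * frechet_derivative \<phi> (at (x + s *\<^sub>R h)) h \<partial>lborel) = \<phi> (x + h) - \<phi> x"
proof -
  have "(\<integral>s. indicator {0..1::real} s *\<^sub>R frechet_derivative \<phi> (at (x + s *\<^sub>R h)) h \<partial>lborel) = \<phi> (x + 1 *\<^sub>R h) - \<phi> (x + 0 *\<^sub>R h)"
  proof (rule integral_FTC_atLeastAtMost)
    show "continuous_on {0..1} (\<lambda>s. frechet_derivative \<phi> (at (x + s *\<^sub>R h)) h)"
      by (rule continuous_on_compose2[OF test_function_continuous(2)[OF \<phi>]]) (auto intro!: continuous_intros)
    fix s :: real
    interpret bounded_linear "frechet_derivative \<phi> (at (x + s *\<^sub>R h))"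
      using test_function_continuous(3)[OF \<phi>] has_derivative_bounded_linear by blast
    have "((\<lambda>s. \<phi> (x + s *\<^sub>R h)) has_derivative (\<lambda>t. frechet_derivative \<phi> (at (x + s *\<^sub>R h)) (t *\<^sub>R h))) (at s within {0..1})"
      by (rule has_derivative_compose[OF _ test_function_continuous(3)[OF \<phi>], of "\<lambda>s. x + s *\<^sub>R h"])
        (auto intro!: derivative_eq_intros)
    then show "((\<lambda>s. \<phi> (x + s *\<^sub>R h)) has_vector_derivative frechet_derivative \<phi> (at (x + s *\<^sub>R h)) h) (at s within {0..1})"
      by (simp add: has_vector_derivative_def scaleR)
  qed simp
  then show ?thesis by simp
qed

lemma integrable_test_function:
  fixes f :: "'a::euclidean_space \<Rightarrow> 'b::euclidean_space"
  assumes "loc_int f" "test_function \<phi>"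
  shows "integrable lborel (\<lambda>x. \<phi> x *\<^sub>R f x)"
    "integrable lborel (\<lambda>x. frechet_derivative \<phi> (at x) v *\<^sub>R f x)"
proof -
  obtain K where K: "compact K" "\<And>x. x \<notin> K \<Longrightarrow> \<phi> x = 0"
    "\<And>x v. x \<notin> K \<Longrightarrow> frechet_derivative \<phi> (at x) v = 0"
    using test_function_props[OF assms(2)] by blast
  show "integrable lborel (\<lambda>x. \<phi> x *\<^sub>R f x)"
    "integrable lborel (\<lambda>x. frechet_derivative \<phi> (at x) v *\<^sub>R f x)"
    by (auto intro!: integrable_mult_compact_support[OF assms(1) _ K(1)] test_function_continuous[OF assms(2)]
      intro: K)
qed

text \<open>The positive and the negative part of \<open>f\<close> are densities of two measures
  that agree and are finite on boxes. Boxes are stable under intersection and generate the Borel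
  sets, so the measures coincide, and then so do the densities almost everywhere.\<close>

lemma AE_zero_if_integral_boxes_zero:
  fixes f :: "'a::euclidean_space \<Rightarrow> real"
  assumes f: "loc_int f" and zero: "\<And>a b. (\<integral>x. indicator (box a b) x * f x \<partial>lborel) = 0"
  shows "AE x in lborel. f x = 0"
proof -
  have [measurable]: "f \<in> borel_measurable borel" using f by (simp add: loc_int_def)
  have int: "integrable lborel (\<lambda>x. indicator (box a b) x * f x)" for a b
  proof -
    have "set_integrable lborel (cbox a b) f" using f by (simp add: loc_int_def)
    then have "set_integrable lborel (box a b) f"
      by (rule set_integrable_subset) (auto simp: box_subset_cbox)
    then show ?thesis by (simp add: set_integrable_def)
  qed
  \<comment> \<open>\<open>ennreal\<close> sends negative numbers to 0, so these are the positive
    and the negative part.\<close>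
  let ?p = "\<lambda>x. ennreal (f x)" and ?n = "\<lambda>x. ennreal (- f x)"
  have eq: "(\<integral>\<^sup>+x. ?p x * indicator (box a b) x \<partial>lborel) = (\<integral>\<^sup>+x. ?n x * indicator (box a b) x \<partial>lborel)"
    and fin: "(\<integral>\<^sup>+x. ?p x * indicator (box a b) x \<partial>lborel) < \<infinity>" for a b :: 'a
  proof -
    let ?g = "\<lambda>x. indicator (box a b) x * f x"
    have e1: "?p x * indicator (box a b) x = ennreal (?g x)"
      and e2: "?n x * indicator (box a b) x = ennreal (- ?g x)" for x
      by (auto simp: indicator_def)
    have "(\<integral>x. ?g x \<partial>lborel) = enn2real (\<integral>\<^sup>+x. ?g x \<partial>lborel) - enn2real (\<integral>\<^sup>+x. - ?g x \<partial>lborel)"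
      by (rule real_lebesgue_integral_def[OF int])
    then have "enn2real (\<integral>\<^sup>+x. ?g x \<partial>lborel) = enn2real (\<integral>\<^sup>+x. - ?g x \<partial>lborel)"
      using zero[of a b] by simp
    moreover have "(\<integral>\<^sup>+x. ?g x \<partial>lborel) < \<infinity>" "(\<integral>\<^sup>+x. - ?g x \<partial>lborel) < \<infinity>"
      using int[of a b] by (auto simp: real_integrable_def top.not_eq_extremum)
    ultimately show "(\<integral>\<^sup>+x. ?p x * indicator (box a b) x \<partial>lborel) = (\<integral>\<^sup>+x. ?n x * indicator (box a b) x \<partial>lborel)"
      "(\<integral>\<^sup>+x. ?p x * indicator (box a b) x \<partial>lborel) < \<infinity>"
      unfolding e1 e2 by (metis ennreal_enn2real infinity_ennreal_def)+
  qed
  have "density lborel ?p = density lborel ?n"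
  proof (rule measure_eqI_generator_eq)
    let ?E = "range (\<lambda>(a, b). box a b::'a set)"
    show "Int_stable ?E"
      by (auto simp: Int_stable_def box_Int_box)
    show "?E \<subseteq> Pow UNIV" "sets (density lborel ?p) = sigma_sets UNIV ?E" "sets (density lborel ?n) = sigma_sets UNIV ?E"
      by (simp_all add: borel_eq_box)
    let ?A = "\<lambda>n::nat. box (- (real n *\<^sub>R One)) (real n *\<^sub>R One) :: 'a set"
    show "range ?A \<subseteq> ?E" "(\<Union>i. ?A i) = UNIV"
      unfolding UN_box_eq_UNIV by auto
    show "emeasure (density lborel ?p) (?A i) \<noteq> \<infinity>" for i
      using fin[of "- (real i *\<^sub>R One)" "real i *\<^sub>R One"] by (simp add: emeasure_density less_top)
    show "emeasure (density lborel ?p) X = emeasure (density lborel ?n) X" if "X \<in> ?E" for X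
      using that eq by (auto simp: emeasure_density)
  qed
  then have "AE x in lborel. ?p x = ?n x"
    by (intro sigma_finite_measure.density_unique[OF sigma_finite_lborel]) auto
  then show ?thesis
  proof eventually_elim
    case (elim x)
    then show ?case
      by (cases "f x \<ge> 0") (auto simp: ennreal_neg ennreal_eq_0_iff dest: sym)
  qed
qed

text \<open>The fundamental lemma of the calculus of variations: by dominated convergence, bumps of
  growing steepness recover the integrals over boxes.\<close>

lemma AE_zero_if_bump_integrals_zero:
  fixes f :: "'a::euclidean_space \<Rightarrow> real"
  assumes f: "loc_int f"
    and zero: "\<And>a b c. c > 0 \<Longrightarrow> (\<integral>x. bump a b c x * f x \<partial>lborel) = 0"
  shows "AE x in lborel. f x = 0"
proof (rule AE_zero_if_integral_boxes_zero[OF f])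
  fix a b :: 'a
  have [measurable]: "f \<in> borel_measurable borel" using f by (simp add: loc_int_def)
  have [measurable]: "bump a b (real (Suc n)) \<in> borel_measurable borel" for n
    by (intro borel_measurable_continuous_onI test_function_continuous test_function_bump) simp
  have "(\<lambda>n. \<integral>x. bump a b (real (Suc n)) x * f x \<partial>lborel) \<longlonglongrightarrow> (\<integral>x. indicator (box a b) x * f x \<partial>lborel)"
  proof (rule integral_dominated_convergence)
    have "set_integrable lborel (cbox a b) f" using f by (simp add: loc_int_def)
    then show "integrable lborel (\<lambda>x. norm (indicator (cbox a b) x *\<^sub>R f x))"
      unfolding set_integrable_def by (rule integrable_norm)
    show "AE x in lborel. (\<lambda>n. bump a b (real (Suc n)) x * f x) \<longlonglongrightarrow> indicator (box a b) x * f x"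
      by (intro AE_I2 tendsto_mult bump_tendsto_indicator tendsto_const)
    show "AE x in lborel. norm (bump a b (real (Suc n)) x * f x) \<le> norm (indicator (cbox a b) x *\<^sub>R f x)" for n
    proof (intro AE_I2)
      fix x show "norm (bump a b (real (Suc n)) x * f x) \<le> norm (indicator (cbox a b) x *\<^sub>R f x)"
      proof (cases "x \<in> box a b")
        case True
        then show ?thesis
          using bump_bounds[of a b "real (Suc n)" x] subsetD[OF box_subset_cbox True]
          by (auto simp: abs_mult intro!: mult_left_le_one_le)
      next
        case False
        then show ?thesis using bump_nonzero_iff[of "real (Suc n)" a b x] by auto
      qed
    qed
  qed measurable
  then show "(\<integral>x. indicator (box a b) x * f x \<partial>lborel) = 0"
    by (simp add: zero LIMSEQ_const_iff)
qed

subsection \<open>Weak gradients\<close>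

text \<open>The working form of \<open>has_weak_gradient\<close>: Borel functions, integrals over
  \<open>lborel\<close>, and arbitrary directions \<open>v\<close> in place of basis vectors,
  because the translation estimate differentiates along the shift \<open>h\<close>. Derivatives and
  inner products are linear in \<open>v\<close>, so both forms express the same identities.\<close>

definition wgrad :: "('a::euclidean_space \<Rightarrow> real) \<Rightarrow> ('a \<Rightarrow> 'a) \<Rightarrow> bool" where
  "wgrad w g \<longleftrightarrow> loc_int w \<and> loc_int g \<and>
     (\<forall>\<phi>. test_function \<phi> \<longrightarrow> (\<forall>v.
        (\<integral>x. frechet_derivative \<phi> (at x) v * w x \<partial>lborel) = - (\<integral>x. \<phi> x * (g x \<bullet> v) \<partial>lborel)))"

lemma has_weak_gradient_iff_wgrad:
  fixes w :: "'a::euclidean_space \<Rightarrow> real"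
  assumes [measurable]: "w \<in> borel_measurable borel" "g \<in> borel_measurable borel"
  shows "has_weak_gradient w g \<longleftrightarrow> wgrad w g"
proof -
  have I1: "(\<integral>x. w x * frechet_derivative \<phi> (at x) b \<partial>lebesgue) = (\<integral>x. frechet_derivative \<phi> (at x) b * w x \<partial>lborel)"
    and I2: "(\<integral>x. (g x \<bullet> b) * \<phi> x \<partial>lebesgue) = (\<integral>x. \<phi> x * (g x \<bullet> b) \<partial>lborel)"
    if "test_function \<phi>" for \<phi> :: "'a \<Rightarrow> real" and b
  proof -
    have [measurable]: "\<phi> \<in> borel_measurable borel"
      "(\<lambda>x. frechet_derivative \<phi> (at x) b) \<in> borel_measurable borel"
      using test_function_continuous[OF that] by (auto intro: borel_measurable_continuous_onI)
    show "(\<integral>x. w x * frechet_derivative \<phi> (at x) b \<partial>lebesgue) = (\<integral>x. frechet_derivative \<phi> (at x) b * w x \<partial>lborel)"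
      by (subst integral_completion) (simp_all add: mult.commute)
    show "(\<integral>x. (g x \<bullet> b) * \<phi> x \<partial>lebesgue) = (\<integral>x. \<phi> x * (g x \<bullet> b) \<partial>lborel)"
      by (subst integral_completion) (simp_all add: mult.commute)
  qed
  have lin: "(\<integral>x. frechet_derivative \<phi> (at x) v * w x \<partial>lborel) = - (\<integral>x. \<phi> x * (g x \<bullet> v) \<partial>lborel)"
    if *: "loc_int w" "loc_int g" "test_function \<phi>"
      "\<And>b. b \<in> Basis \<Longrightarrow> (\<integral>x. frechet_derivative \<phi> (at x) b * w x \<partial>lborel) = - (\<integral>x. \<phi> x * (g x \<bullet> b) \<partial>lborel)" for \<phi> v
  proof -
    have fd: "frechet_derivative \<phi> (at x) v = (\<Sum>b\<in>Basis. (v \<bullet> b) * frechet_derivative \<phi> (at x) b)" for x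
    proof -
      interpret bounded_linear "frechet_derivative \<phi> (at x)"
        using test_function_continuous(3)[OF *(3)] has_derivative_bounded_linear by blast
      show ?thesis
        by (subst euclidean_representation[symmetric, of v]) (simp only: sum scaleR real_scaleR_def)
    qed
    have "(\<integral>x. frechet_derivative \<phi> (at x) v * w x \<partial>lborel)
        = (\<integral>x. (\<Sum>b\<in>Basis. (v \<bullet> b) * (frechet_derivative \<phi> (at x) b * w x)) \<partial>lborel)"
      by (simp add: fd sum_distrib_right mult.assoc)
    also have "\<dots> = (\<Sum>b\<in>Basis. (v \<bullet> b) * (\<integral>x. frechet_derivative \<phi> (at x) b * w x \<partial>lborel))"
      using integrable_test_function(2)[OF *(1,3)] by (subst Bochner_Integration.integral_sum) auto
    also have "\<dots> = (\<Sum>b\<in>Basis. (v \<bullet> b) * - (\<integral>x. \<phi> x * (g x \<bullet> b) \<partial>lborel))"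
      using *(4) by simp
    also have "\<dots> = - (\<integral>x. (\<Sum>b\<in>Basis. (v \<bullet> b) * (\<phi> x * (g x \<bullet> b))) \<partial>lborel)"
      using integrable_test_function(1)[OF loc_int_inner[OF *(2)] *(3)]
      by (subst Bochner_Integration.integral_sum) (auto simp: sum_negf)
    also have "(\<lambda>x. \<Sum>b\<in>Basis. (v \<bullet> b) * (\<phi> x * (g x \<bullet> b))) = (\<lambda>x. \<phi> x * (g x \<bullet> v))"
      by (auto simp: euclidean_inner[of "g _" v] sum_distrib_left mult_ac)
    finally show ?thesis .
  qed
  show ?thesis
  proof
    assume *: "has_weak_gradient w g"
    then have loc: "loc_int w" "loc_int g"
      by (simp_all add: has_weak_gradient_def loc_int_iff)
    show "wgrad w g"
      unfolding wgrad_def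
    proof (intro conjI loc allI impI)
      fix \<phi> :: "'a \<Rightarrow> real" and v assume \<phi>: "test_function \<phi>"
      show "(\<integral>x. frechet_derivative \<phi> (at x) v * w x \<partial>lborel) = - (\<integral>x. \<phi> x * (g x \<bullet> v) \<partial>lborel)"
      proof (rule lin[OF loc \<phi>])
        fix b :: 'a assume "b \<in> Basis"
        then have "(\<integral>x. w x * frechet_derivative \<phi> (at x) b \<partial>lebesgue) = - (\<integral>x. (g x \<bullet> b) * \<phi> x \<partial>lebesgue)"
          using * \<phi> unfolding has_weak_gradient_def by blast
        then show "(\<integral>x. frechet_derivative \<phi> (at x) b * w x \<partial>lborel) = - (\<integral>x. \<phi> x * (g x \<bullet> b) \<partial>lborel)"
          unfolding I1[OF \<phi>] I2[OF \<phi>] .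
      qed
    qed
  next
    assume *: "wgrad w g"
    show "has_weak_gradient w g"
      unfolding has_weak_gradient_def
    proof (intro conjI allI impI ballI)
      show "locally_integrable w" "locally_integrable g"
        using * by (simp_all add: wgrad_def flip: loc_int_iff)
      fix \<phi> :: "'a \<Rightarrow> real" and b assume \<phi>: "test_function \<phi>"
      show "(\<integral>x. w x * frechet_derivative \<phi> (at x) b \<partial>lebesgue) = - (\<integral>x. (g x \<bullet> b) * \<phi> x \<partial>lebesgue)"
        unfolding I1[OF \<phi>] I2[OF \<phi>] using * \<phi> unfolding wgrad_def by blast
    qed
  qed
qed

lemma wgrad_measurable: "wgrad w g \<Longrightarrow> w \<in> borel_measurable borel" "wgrad w g \<Longrightarrow> g \<in> borel_measurable borel"
  by (simp_all add: wgrad_def loc_int_def)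

lemma wgrad_lincomb:
  assumes "wgrad w g" "wgrad w' g'"
  shows "wgrad (\<lambda>x. s * w x + t * w' x) (\<lambda>x. s *\<^sub>R g x + t *\<^sub>R g' x)"
proof -
  have loc: "loc_int w" "loc_int g" "loc_int w'" "loc_int g'"
    using assms by (auto simp: wgrad_def)
  have 1: "loc_int (\<lambda>x. s * w x + t * w' x)"
    using loc_int_add[OF loc_int_scaleR[OF loc(1), of s] loc_int_scaleR[OF loc(3), of t]] by simp
  have 2: "loc_int (\<lambda>x. s *\<^sub>R g x + t *\<^sub>R g' x)"
    by (rule loc_int_add[OF loc_int_scaleR[OF loc(2), of s] loc_int_scaleR[OF loc(4), of t]])
  have "(\<integral>x. frechet_derivative \<phi> (at x) v * (s * w x + t * w' x) \<partial>lborel)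
      = - (\<integral>x. \<phi> x * ((s *\<^sub>R g x + t *\<^sub>R g' x) \<bullet> v) \<partial>lborel)" if \<phi>: "test_function \<phi>" for \<phi> v
  proof -
    have "(\<integral>x. frechet_derivative \<phi> (at x) v * (s * w x + t * w' x) \<partial>lborel)
        = (\<integral>x. s * (frechet_derivative \<phi> (at x) v * w x) + t * (frechet_derivative \<phi> (at x) v * w' x) \<partial>lborel)"
      by (simp add: algebra_simps)
    also have "\<dots> = s * (\<integral>x. frechet_derivative \<phi> (at x) v * w x \<partial>lborel) + t * (\<integral>x. frechet_derivative \<phi> (at x) v * w' x \<partial>lborel)"
      using integrable_test_function(2)[OF loc(1) \<phi>] integrable_test_function(2)[OF loc(3) \<phi>] by simp
    also have "\<dots> = s * - (\<integral>x. \<phi> x * (g x \<bullet> v) \<partial>lborel) + t * - (\<integral>x. \<phi> x * (g' x \<bullet> v) \<partial>lborel)"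
      using assms \<phi> by (simp add: wgrad_def)
    also have "\<dots> = - (\<integral>x. s * (\<phi> x * (g x \<bullet> v)) + t * (\<phi> x * (g' x \<bullet> v)) \<partial>lborel)"
      using integrable_test_function(1)[OF loc_int_inner[OF loc(2)] \<phi>]
        integrable_test_function(1)[OF loc_int_inner[OF loc(4)] \<phi>] by simp
    also have "\<dots> = - (\<integral>x. \<phi> x * ((s *\<^sub>R g x + t *\<^sub>R g' x) \<bullet> v) \<partial>lborel)"
      by (simp add: algebra_simps inner_add_left)
    finally show ?thesis .
  qed
  with 1 2 show ?thesis by (simp add: wgrad_def)
qed

text \<open>This makes the choice behind \<open>weak_gradient\<close> harmless: the difference of
  two gradients integrates to zero against every bump.\<close>

lemma wgrad_unique:
  fixes w :: "'a::euclidean_space \<Rightarrow> real"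
  assumes "wgrad w g" "wgrad w' g'" and ae: "AE x in lborel. w x = w' x"
  shows "AE x in lborel. g x = g' x"
proof -
  have loc: "loc_int w" "loc_int g" "loc_int w'" "loc_int g'"
    using assms by (auto simp: wgrad_def)
  note [measurable] = loc[THEN loc_int_measurable]
  have "AE x in lborel. (g x + (-1) *\<^sub>R g' x) \<bullet> b = 0" for b
  proof (rule AE_zero_if_bump_integrals_zero)
    show "loc_int (\<lambda>x. (g x + (-1) *\<^sub>R g' x) \<bullet> b)"
      by (intro loc_int_inner loc_int_add loc_int_scaleR loc)
    fix p q :: 'a and c :: real assume "c > 0"
    then have \<phi>: "test_function (bump p q c)" (is "test_function ?\<phi>") by (rule test_function_bump)
    have [measurable]: "(\<lambda>x. frechet_derivative ?\<phi> (at x) b) \<in> borel_measurable borel"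
      using test_function_continuous[OF \<phi>] by (auto intro: borel_measurable_continuous_onI)
    have "(\<integral>x. ?\<phi> x * (g x \<bullet> b) \<partial>lborel) = - (\<integral>x. frechet_derivative ?\<phi> (at x) b * w x \<partial>lborel)"
      using assms(1) \<phi> by (simp add: wgrad_def)
    also have "(\<integral>x. frechet_derivative ?\<phi> (at x) b * w x \<partial>lborel) = (\<integral>x. frechet_derivative ?\<phi> (at x) b * w' x \<partial>lborel)"
      using ae by (intro integral_cong_AE) auto
    also have "- \<dots> = (\<integral>x. ?\<phi> x * (g' x \<bullet> b) \<partial>lborel)"
      using assms(2) \<phi> by (simp add: wgrad_def)
    finally have "(\<integral>x. ?\<phi> x * (g x \<bullet> b) \<partial>lborel) = (\<integral>x. ?\<phi> x * (g' x \<bullet> b) \<partial>lborel)" .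
    moreover have "(\<integral>x. ?\<phi> x * ((g x + (-1) *\<^sub>R g' x) \<bullet> b) \<partial>lborel) = (\<integral>x. ?\<phi> x * (g x \<bullet> b) - ?\<phi> x * (g' x \<bullet> b) \<partial>lborel)"
      by (simp add: algebra_simps inner_diff_left)
    ultimately show "(\<integral>x. ?\<phi> x * ((g x + (-1) *\<^sub>R g' x) \<bullet> b) \<partial>lborel) = 0"
      using integrable_test_function(1)[OF loc_int_inner[OF loc(2)] \<phi>]
        integrable_test_function(1)[OF loc_int_inner[OF loc(4)] \<phi>] by simp
  qed
  then have "AE x in lborel. \<forall>b\<in>Basis. (g x + (-1) *\<^sub>R g' x) \<bullet> b = 0"
    by (intro AE_finite_allI) auto
  then show ?thesis
  proof eventually_elim
    case (elim x)
    then have "g x + (-1) *\<^sub>R g' x = 0" by (simp only: euclidean_all_zero_iff)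
    then show ?case by simp
  qed
qed

section \<open>Square-integrable weak gradients control translations\<close>

text \<open>Jensen's inequality for the square on a set of measure one, obtained from the
  Cauchy-Schwarz inequality against the indicator. If the integrand is not integrable, its Bochner
  integral is 0 by convention and the bound is trivial.\<close>

lemma square_integral_le_nn_integral:
  fixes f :: "'a \<Rightarrow> real"
  assumes [measurable]: "f \<in> borel_measurable M" "A \<in> sets M" and A: "emeasure M A = 1"
  shows "ennreal ((\<integral>x. indicator A x * f x \<partial>M)\<^sup>2) \<le> (\<integral>\<^sup>+x. indicator A x * ennreal ((f x)\<^sup>2) \<partial>M)"
proof (cases "integrable M (\<lambda>x. indicator A x * f x)")
  case True
  have "ennreal \<bar>\<integral>x. indicator A x * f x \<partial>M\<bar> \<le> (\<integral>\<^sup>+x. ennreal (norm (indicator A x * f x)) \<partial>M)"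
    using integral_norm_bound_ennreal[OF True] by simp
  also have "\<dots> = (\<integral>\<^sup>+x. indicator A x * (indicator A x * ennreal \<bar>f x\<bar>) \<partial>M)"
    by (intro nn_integral_cong) (auto simp: indicator_def)
  finally have "ennreal \<bar>\<integral>x. indicator A x * f x \<partial>M\<bar> ^ 2 \<le> (\<integral>\<^sup>+x. indicator A x * (indicator A x * ennreal \<bar>f x\<bar>) \<partial>M) ^ 2"
    by (intro power_mono) auto
  also have "\<dots> \<le> (\<integral>\<^sup>+x. indicator A x ^ 2 \<partial>M) * (\<integral>\<^sup>+x. (indicator A x * ennreal \<bar>f x\<bar>) ^ 2 \<partial>M)"
    by (intro Cauchy_Schwarz_nn_integral) auto
  also have "(\<integral>\<^sup>+x. indicator A x ^ 2 \<partial>M) = (\<integral>\<^sup>+x. indicator A x \<partial>M)"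
    by (intro nn_integral_cong) (auto simp: indicator_def)
  also have "\<dots> = 1" using A by simp
  also have "(\<integral>\<^sup>+x. (indicator A x * ennreal \<bar>f x\<bar>) ^ 2 \<partial>M) = (\<integral>\<^sup>+x. indicator A x * ennreal ((f x)\<^sup>2) \<partial>M)"
    by (intro nn_integral_cong) (auto simp: indicator_def ennreal_power)
  finally show ?thesis by (simp add: ennreal_power)
next
  case False
  then show ?thesis by (simp add: not_integrable_integral_eq)
qed

text \<open>Supplies the hypothesis of Fubini's theorem: by Tonelli, a uniform \<open>L1\<close>
  bound on the slices suffices, since the parameter runs over an interval of length one.\<close>

lemma integrable_pair_if_bounded_slices:
  fixes f :: "real \<Rightarrow> 'a::euclidean_space \<Rightarrow> real"
  assumes [measurable]: "case_prod f \<in> borel_measurable (borel \<Otimes>\<^sub>M borel)"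
    and bd: "\<And>s. s \<in> {0..1} \<Longrightarrow> (\<integral>\<^sup>+x. ennreal \<bar>f s x\<bar> \<partial>lborel) \<le> C" and C: "C < \<infinity>"
    and zero: "\<And>s x. s \<notin> {0..1} \<Longrightarrow> f s x = 0"
  shows "integrable (lborel \<Otimes>\<^sub>M lborel) (case_prod f)"
  unfolding integrable_iff_bounded
proof
  show "case_prod f \<in> borel_measurable (lborel \<Otimes>\<^sub>M lborel)" by measurable
  have "(\<integral>\<^sup>+z. ennreal (norm (case_prod f z)) \<partial>(lborel \<Otimes>\<^sub>M lborel)) = (\<integral>\<^sup>+s. (\<integral>\<^sup>+x. ennreal \<bar>f s x\<bar> \<partial>lborel) \<partial>lborel)"
    by (subst lborel.nn_integral_fst[symmetric]) auto
  also have "\<dots> \<le> (\<integral>\<^sup>+s. C * indicator {0..1::real} s \<partial>lborel)"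
  proof (rule nn_integral_mono)
    fix s :: real
    show "(\<integral>\<^sup>+x. ennreal \<bar>f s x\<bar> \<partial>lborel) \<le> C * indicator {0..1} s"
      using bd[of s] zero[of s] by (cases "s \<in> {0..1}") auto
  qed
  also have "\<dots> = C" by (subst nn_integral_cmult_indicator) auto
  also note C
  finally show "(\<integral>\<^sup>+z. ennreal (norm (case_prod f z)) \<partial>(lborel \<Otimes>\<^sub>M lborel)) < \<infinity>" .
qed

text \<open>\<open>G\<close> stands for a bound on the squared \<open>L2\<close> norm of the
  gradient; with squares on both sides everything stays within nonnegative integrals.\<close>

definition translation_bound :: "real \<Rightarrow> ('a::euclidean_space \<Rightarrow> real) \<Rightarrow> bool" where
  "translation_bound G w \<longleftrightarrow> loc_int w \<and>
     (\<forall>h. (\<integral>\<^sup>+x. ennreal ((w (x + h) - w x)\<^sup>2) \<partial>lborel) \<le> ennreal (G * (norm h)\<^sup>2))"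

text \<open>\<open>V\<close> averages the derivative along \<open>h\<close> over the segment from
  \<open>x\<close> to \<open>x + h\<close>, so the second claim is
  \<open>w (x + h) - w x = V x\<close> in weak form. It follows by moving the shift onto the bump,
  where the fundamental theorem of calculus holds classically, and by applying the weak gradient
  identity to each translated bump along the segment.\<close>

lemma wgrad_translate_bump:
  fixes w :: "'a::euclidean_space \<Rightarrow> real" and g :: "'a \<Rightarrow> 'a" and h a b :: 'a and c :: real
  assumes wg: "wgrad w g" and c: "c > 0"
    and G: "(\<integral>\<^sup>+x. ennreal ((norm (g x))\<^sup>2) \<partial>lborel) < \<infinity>"
  defines "V \<equiv> \<lambda>x. \<integral>s. indicator {0..1::real} s * (g (x + s *\<^sub>R h) \<bullet> h) \<partial>lborel"
  shows "loc_int V"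
    and "(\<integral>x. bump a b c x * w (x + h) \<partial>lborel) - (\<integral>x. bump a b c x * w x \<partial>lborel)
      = (\<integral>x. bump a b c x * V x \<partial>lborel)"
proof -
  have loc: "loc_int w" "loc_int g" using wg by (simp_all add: wgrad_def)
  note [measurable] = loc[THEN loc_int_measurable]
  \<comment> \<open>A general cutoff \<psi> serves two purposes: the indicator of a compact set
    yields local integrability of \<open>V\<close>, and the bump justifies the last exchange of
    integrals.\<close>
  have int2: "integrable (lborel \<Otimes>\<^sub>M lborel)
      (\<lambda>(s, x). indicator {0..1} s * (\<psi> x * (g (x + s *\<^sub>R h) \<bullet> h)))"
    if [measurable]: "\<psi> \<in> borel_measurable borel" and K: "compact K" and \<psi>: "\<And>x. \<bar>\<psi> x\<bar> \<le> indicator K x"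
    for \<psi> :: "'a \<Rightarrow> real" and K
  proof (rule integrable_pair_if_bounded_slices)
    let ?C = "ennreal (norm h) * (emeasure lborel K + (\<integral>\<^sup>+x. ennreal ((norm (g x))\<^sup>2) \<partial>lborel))"
    show "?C < \<infinity>"
      using G emeasure_compact_finite[OF K] by (auto simp: ennreal_mult_less_top)
    have [measurable]: "K \<in> sets borel" using K by (rule borel_compact)
    fix s :: real assume s: "s \<in> {0..1}"
    have "(\<integral>\<^sup>+x. ennreal \<bar>indicator {0..1} s * (\<psi> x * (g (x + s *\<^sub>R h) \<bullet> h))\<bar> \<partial>lborel)
        \<le> (\<integral>\<^sup>+x. ennreal (norm h) * (indicator K x + ennreal ((norm (g (x + s *\<^sub>R h)))\<^sup>2)) \<partial>lborel)"
    proof (rule nn_integral_mono)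
      fix x :: 'a
      let ?y = "g (x + s *\<^sub>R h)"
      \<comment> \<open>Trades the first power for the square: on a compact set, the
        \<open>L1\<close> norm is then controlled by the volume and the squared \<open>L2\<close>
        norm, the two terms of \<open>?C\<close>.\<close>
      have y: "norm ?y \<le> 1 + (norm ?y)\<^sup>2"
      proof -
        have "2 * norm ?y \<le> 1 + (norm ?y)\<^sup>2"
          using zero_le_power2[of "norm ?y - 1"] by (simp add: power2_diff)
        with norm_ge_zero[of ?y] show ?thesis by linarith
      qed
      have "\<bar>\<psi> x\<bar> * \<bar>?y \<bullet> h\<bar> \<le> indicator K x * (norm ?y * norm h)"
        using \<psi>[of x] Cauchy_Schwarz_ineq2[of ?y h] by (intro mult_mono) auto
      also have "\<dots> \<le> norm h * (indicator K x + (norm ?y)\<^sup>2)"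
        using mult_right_mono[OF y, of "norm h"] by (auto simp: indicator_def algebra_simps)
      finally have "\<bar>\<psi> x\<bar> * \<bar>?y \<bullet> h\<bar> \<le> norm h * (indicator K x + (norm ?y)\<^sup>2)" .
      then have "ennreal (\<bar>\<psi> x\<bar> * \<bar>?y \<bullet> h\<bar>) \<le> ennreal (norm h * (indicator K x + (norm ?y)\<^sup>2))"
        by (rule ennreal_leI)
      also have "\<dots> = ennreal (norm h) * (indicator K x + ennreal ((norm ?y)\<^sup>2))"
        by (simp add: ennreal_mult ennreal_plus ennreal_indicator)
      finally show "ennreal \<bar>indicator {0..1} s * (\<psi> x * (?y \<bullet> h))\<bar> \<le> ennreal (norm h) * (indicator K x + ennreal ((norm ?y)\<^sup>2))"
        using s by (simp add: abs_mult)
    qed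
    also have "\<dots> = ennreal (norm h) * (emeasure lborel K + (\<integral>\<^sup>+x. ennreal ((norm (g (x + s *\<^sub>R h)))\<^sup>2) \<partial>lborel))"
      by (simp add: nn_integral_cmult nn_integral_add)
    also have "(\<integral>\<^sup>+x. ennreal ((norm (g (x + s *\<^sub>R h)))\<^sup>2) \<partial>lborel) = (\<integral>\<^sup>+x. ennreal ((norm (g x))\<^sup>2) \<partial>lborel)"
      by (rule nn_integral_lborel_shift) measurable
    finally show "(\<integral>\<^sup>+x. ennreal \<bar>indicator {0..1} s * (\<psi> x * (g (x + s *\<^sub>R h) \<bullet> h))\<bar> \<partial>lborel) \<le> ?C" .
  qed auto
  have V_meas [measurable]: "V \<in> borel_measurable borel"
    unfolding V_def by measurable
  show "loc_int V"
    unfolding loc_int_def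
  proof (intro conjI allI impI)
    fix K :: "'a set" assume K: "compact K"
    then have [measurable]: "K \<in> sets borel" by (rule borel_compact)
    have "integrable lborel (\<lambda>x. \<integral>s. indicator {0..1} s * (indicator K x * (g (x + s *\<^sub>R h) \<bullet> h)) \<partial>lborel)"
      by (rule lborel_pair.integrable_snd[OF int2[OF _ K]]) auto
    also have "(\<lambda>x. \<integral>s. indicator {0..1} s * (indicator K x * (g (x + s *\<^sub>R h) \<bullet> h)) \<partial>lborel) = (\<lambda>x. indicator K x *\<^sub>R V x)"
      unfolding V_def by (auto simp: indicator_def)
    finally show "set_integrable lborel K V" by (simp add: set_integrable_def)
  qed (rule V_meas)

  let ?\<phi> = "bump a b c" and ?I = "indicator {0..1::real} :: real \<Rightarrow> real"
  define D where "D = (\<lambda>x. frechet_derivative ?\<phi> (at x) h)"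
  have \<phi>: "test_function (bump a b c)" for a b :: 'a using c by (rule test_function_bump)
  have [measurable]: "?\<phi> \<in> borel_measurable borel"
    using test_function_continuous[OF \<phi>] by (auto intro: borel_measurable_continuous_onI)
  have contD: "continuous_on UNIV D"
    unfolding D_def by (rule test_function_continuous[OF \<phi>])
  then have [measurable]: "D \<in> borel_measurable borel"
    by (rule borel_measurable_continuous_onI)
  have shift_eq: "?\<phi> (x - s *\<^sub>R h) = bump (a + s *\<^sub>R h) (b + s *\<^sub>R h) c x" for x s
    by (rule bump_shift)
  have shift_deriv: "frechet_derivative (bump (a + s *\<^sub>R h) (b + s *\<^sub>R h) c) (at x) h = D (x - s *\<^sub>R h)" for x s
  proof -
    have "((\<lambda>x. ?\<phi> (x - s *\<^sub>R h)) has_derivative frechet_derivative ?\<phi> (at (x - s *\<^sub>R h))) (at x)"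
      by (rule has_derivative_compose[OF _ test_function_continuous(3)[OF \<phi>], of "\<lambda>x. x - s *\<^sub>R h" "\<lambda>v. v", simplified])
        (auto intro!: derivative_eq_intros)
    from frechet_derivative_at[OF this] show ?thesis
      unfolding shift_eq D_def by simp
  qed
  \<comment> \<open>The shifted bump is \<open>?\<phi> (x - s *\<^sub>R h)\<close>, so the theorem
    is applied in direction \<open>- h\<close>; both signs then cancel.\<close>
  have ftc: "(\<integral>s. ?I s * D (x - s *\<^sub>R h) \<partial>lborel) = ?\<phi> x - ?\<phi> (x - h)" for x
  proof -
    have "frechet_derivative ?\<phi> (at y) (- h) = - D y" for y
    proof -
      interpret bounded_linear "frechet_derivative ?\<phi> (at y)"
        using test_function_continuous(3)[OF \<phi>] has_derivative_bounded_linear by blast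
      show ?thesis by (simp add: neg D_def)
    qed
    then show ?thesis using test_function_FTC[OF \<phi>[of a b], of x "- h"] by simp
  qed
  obtain K where K: "compact K" "\<And>x. x \<notin> K \<Longrightarrow> D x = 0"
    using test_function_props[OF \<phi>[of a b]] unfolding D_def by metis
  have "bounded (D ` K)"
    using K(1) contD by (intro compact_imp_bounded compact_continuous_image) (auto intro: continuous_on_subset)
  then obtain C where "\<And>x. x \<in> K \<Longrightarrow> \<bar>D x\<bar> \<le> C"
    by (auto simp: bounded_iff)
  with K(2) have C: "\<bar>D x\<bar> \<le> \<bar>C\<bar>" for x
    by (cases "x \<in> K") force+
  \<comment> \<open>The region swept by the support of \<open>D\<close> along the segment. It is
    compact and contains the supports of all slices, which gives one bound for every
    \<open>s\<close>.\<close>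
  define K' where "K' = (\<lambda>(s, x). x + s *\<^sub>R h) ` ({0..1::real} \<times> K)"
  have K': "compact K'"
    unfolding K'_def case_prod_beta using K(1)
    by (intro compact_continuous_image continuous_intros compact_Times) auto
  then have [measurable]: "K' \<in> sets borel" by (rule borel_compact)
  have int1: "integrable (lborel \<Otimes>\<^sub>M lborel) (\<lambda>(s, x). ?I s * (D (x - s *\<^sub>R h) * w x))"
  proof (rule integrable_pair_if_bounded_slices)
    let ?C = "(\<integral>\<^sup>+x. ennreal (norm (\<bar>C\<bar> * (indicator K' x *\<^sub>R w x))) \<partial>lborel)"
    have "integrable lborel (\<lambda>x. \<bar>C\<bar> * (indicator K' x *\<^sub>R w x))"
      using loc(1) K' by (intro integrable_mult_right) (simp add: loc_int_def set_integrable_def)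
    then show "?C < \<infinity>" by (simp only: integrable_iff_bounded)
    fix s :: real assume s: "s \<in> {0..1}"
    show "(\<integral>\<^sup>+x. ennreal \<bar>?I s * (D (x - s *\<^sub>R h) * w x)\<bar> \<partial>lborel) \<le> ?C"
    proof (intro nn_integral_mono ennreal_leI)
      fix x
      have "x - s *\<^sub>R h \<in> K \<Longrightarrow> x \<in> K'"
        unfolding K'_def using s by (force intro!: image_eqI[where x = "(s, x - s *\<^sub>R h)"])
      then have "\<bar>D (x - s *\<^sub>R h)\<bar> \<le> \<bar>C\<bar> * indicator K' x"
        using C[of "x - s *\<^sub>R h"] K(2)[of "x - s *\<^sub>R h"] by (cases "x \<in> K'") auto
      from mult_right_mono[OF this, of "\<bar>w x\<bar>"]
      show "\<bar>?I s * (D (x - s *\<^sub>R h) * w x)\<bar> \<le> norm (\<bar>C\<bar> * (indicator K' x *\<^sub>R w x))"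
        using s by (simp add: abs_mult mult.assoc)
    qed
  qed auto
  have \<phi>w: "integrable lborel (\<lambda>x. ?\<phi> x * w x)" "integrable lborel (\<lambda>x. ?\<phi> (x - h) * w x)"
    using integrable_test_function(1)[OF loc(1) \<phi>] bump_shift[of a b c _ h] by simp_all
  have "(\<integral>x. ?\<phi> x * w (x + h) \<partial>lborel) = (\<integral>x. ?\<phi> (x - h) * w x \<partial>lborel)"
    using integral_lborel_shift[of "\<lambda>x. ?\<phi> (x - h) * w x" h] by simp
  then have "(\<integral>x. ?\<phi> x * w (x + h) \<partial>lborel) - (\<integral>x. ?\<phi> x * w x \<partial>lborel) = - (\<integral>x. (?\<phi> x - ?\<phi> (x - h)) * w x \<partial>lborel)"
    using \<phi>w by (simp add: left_diff_distrib)
  also have "\<dots> = - (\<integral>x. (\<integral>s. ?I s * (D (x - s *\<^sub>R h) * w x) \<partial>lborel) \<partial>lborel)"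
    unfolding ftc[symmetric] by (simp flip: mult.assoc)
  also have "\<dots> = - (\<integral>s. (\<integral>x. ?I s * (D (x - s *\<^sub>R h) * w x) \<partial>lborel) \<partial>lborel)"
    using lborel_pair.Fubini_integral[OF int1] by simp
  \<comment> \<open>Here the weak gradient enters: for each fixed \<open>s\<close>, the function
    \<open>D\<close> shifted by \<open>s *\<^sub>R h\<close> is the derivative along
    \<open>h\<close> of a translated bump, hence of a test function.\<close>
  also have "\<dots> = (\<integral>s. ?I s * (\<integral>x. ?\<phi> (x - s *\<^sub>R h) * (g x \<bullet> h) \<partial>lborel) \<partial>lborel)"
  proof -
    have "(\<integral>x. D (x - s *\<^sub>R h) * w x \<partial>lborel) = - (\<integral>x. ?\<phi> (x - s *\<^sub>R h) * (g x \<bullet> h) \<partial>lborel)" for s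
      using wg \<phi>[of "a + s *\<^sub>R h" "b + s *\<^sub>R h"] unfolding wgrad_def shift_deriv[symmetric] shift_eq by blast
    then show ?thesis by simp
  qed
  also have "\<dots> = (\<integral>s. (\<integral>x. ?I s * (?\<phi> x * (g (x + s *\<^sub>R h) \<bullet> h)) \<partial>lborel) \<partial>lborel)"
  proof (intro Bochner_Integration.integral_cong refl)
    fix s :: real
    show "?I s * (\<integral>x. ?\<phi> (x - s *\<^sub>R h) * (g x \<bullet> h) \<partial>lborel) = (\<integral>x. ?I s * (?\<phi> x * (g (x + s *\<^sub>R h) \<bullet> h)) \<partial>lborel)"
      using integral_lborel_shift[of "\<lambda>x. ?\<phi> (x - s *\<^sub>R h) * (g x \<bullet> h)" "s *\<^sub>R h"] by simp
  qed
  also have "\<dots> = (\<integral>x. (\<integral>s. ?I s * (?\<phi> x * (g (x + s *\<^sub>R h) \<bullet> h)) \<partial>lborel) \<partial>lborel)"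
  proof (rule lborel_pair.Fubini_integral[OF int2, symmetric])
    show "\<bar>?\<phi> x\<bar> \<le> indicator (cbox a b) x" for x
      using bump_bounds[of a b c x] bump_nonzero_iff[OF c, of a b x] box_subset_cbox[of a b]
      by (cases "x \<in> box a b") auto
  qed auto
  also have "\<dots> = (\<integral>x. ?\<phi> x * V x \<partial>lborel)"
    unfolding V_def by (simp add: mult.left_commute[of _ "?\<phi> _"])
  finally show "(\<integral>x. ?\<phi> x * w (x + h) \<partial>lborel) - (\<integral>x. ?\<phi> x * w x \<partial>lborel) = (\<integral>x. ?\<phi> x * V x \<partial>lborel)" .
qed

text \<open>By the fundamental lemma the increment equals the averaged derivative \<open>V\<close>
  almost everywhere. Jensen in \<open>s\<close>, Tonelli, Cauchy-Schwarz and translation invariance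
  bound its square.\<close>

lemma wgrad_imp_translation_bound:
  fixes w :: "'a::euclidean_space \<Rightarrow> real"
  assumes wg: "wgrad w g"
    and G: "(\<integral>\<^sup>+x. ennreal ((norm (g x))\<^sup>2) \<partial>lborel) \<le> ennreal G"
  shows "translation_bound G w"
  unfolding translation_bound_def
proof (intro conjI allI)
  show loc: "loc_int w" using wg by (simp add: wgrad_def)
  have [measurable]: "w \<in> borel_measurable borel" "g \<in> borel_measurable borel"
    using wg by (auto dest: wgrad_measurable)
  fix h :: 'a
  let ?I = "indicator {0..1::real} :: real \<Rightarrow> real"
  define V where "V = (\<lambda>x. \<integral>s. ?I s * (g (x + s *\<^sub>R h) \<bullet> h) \<partial>lborel)"
  have fin: "(\<integral>\<^sup>+x. ennreal ((norm (g x))\<^sup>2) \<partial>lborel) < \<infinity>"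
    using G by (simp add: le_less_trans)
  note T = wgrad_translate_bump[OF wg _ fin, where h = h, folded V_def]
  have locV: "loc_int V" using T(1)[of 1] by simp
  have "AE x in lborel. w (x + h) + ((-1) *\<^sub>R w x + (-1) *\<^sub>R V x) = 0"
  proof (rule AE_zero_if_bump_integrals_zero)
    show "loc_int (\<lambda>x. w (x + h) + ((-1) *\<^sub>R w x + (-1) *\<^sub>R V x))"
      by (intro loc_int_add loc_int_scaleR loc_int_shift loc locV)
    fix a b :: 'a and c :: real assume c: "c > 0"
    note \<phi> = test_function_bump[OF c, of a b]
    have int: "integrable lborel (\<lambda>x. bump a b c x * w (x + h))" "integrable lborel (\<lambda>x. bump a b c x * w x)"
      "integrable lborel (\<lambda>x. bump a b c x * V x)"
      using integrable_test_function(1)[OF loc_int_shift[OF loc] \<phi>]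
        integrable_test_function(1)[OF loc \<phi>] integrable_test_function(1)[OF locV \<phi>] by simp_all
    have "(\<integral>x. bump a b c x * (w (x + h) + ((-1) *\<^sub>R w x + (-1) *\<^sub>R V x)) \<partial>lborel)
        = (\<integral>x. (bump a b c x * w (x + h) - bump a b c x * w x) - bump a b c x * V x \<partial>lborel)"
      by (simp add: algebra_simps)
    also have "\<dots> = 0" using int T(2)[OF c, of a b] by (simp add: V_def)
    finally show "(\<integral>x. bump a b c x * (w (x + h) + ((-1) *\<^sub>R w x + (-1) *\<^sub>R V x)) \<partial>lborel) = 0" .
  qed
  then have ae: "AE x in lborel. w (x + h) - w x = V x"
    by eventually_elim simp
  have "(\<integral>\<^sup>+x. ennreal ((w (x + h) - w x)\<^sup>2) \<partial>lborel) = (\<integral>\<^sup>+x. ennreal ((V x)\<^sup>2) \<partial>lborel)"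
    by (rule nn_integral_cong_AE) (use ae in eventually_elim, simp)
  also have "\<dots> \<le> (\<integral>\<^sup>+x. (\<integral>\<^sup>+s. indicator {0..1::real} s * ennreal ((g (x + s *\<^sub>R h) \<bullet> h)\<^sup>2) \<partial>lborel) \<partial>lborel)"
    unfolding V_def by (intro nn_integral_mono square_integral_le_nn_integral) auto
  also have "\<dots> = (\<integral>\<^sup>+s. (\<integral>\<^sup>+x. indicator {0..1::real} s * ennreal ((g (x + s *\<^sub>R h) \<bullet> h)\<^sup>2) \<partial>lborel) \<partial>lborel)"
    by (rule lborel_pair.Fubini') measurable
  also have "\<dots> \<le> (\<integral>\<^sup>+s. ennreal (G * (norm h)\<^sup>2) * indicator {0..1::real} s \<partial>lborel)"
  proof (rule nn_integral_mono)
    fix s :: real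
    have "(\<integral>\<^sup>+x. ennreal ((g (x + s *\<^sub>R h) \<bullet> h)\<^sup>2) \<partial>lborel) \<le> (\<integral>\<^sup>+x. ennreal ((norm h)\<^sup>2) * ennreal ((norm (g (x + s *\<^sub>R h)))\<^sup>2) \<partial>lborel)"
    proof (rule nn_integral_mono)
      fix x
      have "(g (x + s *\<^sub>R h) \<bullet> h)\<^sup>2 \<le> (norm h)\<^sup>2 * (norm (g (x + s *\<^sub>R h)))\<^sup>2"
        using Cauchy_Schwarz_ineq[of "g (x + s *\<^sub>R h)" h] by (simp add: power2_norm_eq_inner mult.commute)
      then show "ennreal ((g (x + s *\<^sub>R h) \<bullet> h)\<^sup>2) \<le> ennreal ((norm h)\<^sup>2) * ennreal ((norm (g (x + s *\<^sub>R h)))\<^sup>2)"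
        by (simp add: ennreal_leI flip: ennreal_mult)
    qed
    also have "\<dots> = ennreal ((norm h)\<^sup>2) * (\<integral>\<^sup>+x. ennreal ((norm (g (x + s *\<^sub>R h)))\<^sup>2) \<partial>lborel)"
      by (rule nn_integral_cmult) measurable
    also have "(\<integral>\<^sup>+x. ennreal ((norm (g (x + s *\<^sub>R h)))\<^sup>2) \<partial>lborel) = (\<integral>\<^sup>+x. ennreal ((norm (g x))\<^sup>2) \<partial>lborel)"
      by (rule nn_integral_lborel_shift) measurable
    also have "ennreal ((norm h)\<^sup>2) * \<dots> \<le> ennreal ((norm h)\<^sup>2) * ennreal G"
      by (intro mult_left_mono G) simp
    also have "\<dots> = ennreal (G * (norm h)\<^sup>2)"
      by (metis ennreal_mult'' mult.commute zero_le_power2)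
    finally show "(\<integral>\<^sup>+x. indicator {0..1::real} s * ennreal ((g (x + s *\<^sub>R h) \<bullet> h)\<^sup>2) \<partial>lborel) \<le> ennreal (G * (norm h)\<^sup>2) * indicator {0..1} s"
      by (cases "s \<in> {0..1}") auto
  qed
  also have "\<dots> = ennreal (G * (norm h)\<^sup>2)"
    by (subst nn_integral_cmult_indicator) auto
  finally show "(\<integral>\<^sup>+x. ennreal ((w (x + h) - w x)\<^sup>2) \<partial>lborel) \<le> ennreal (G * (norm h)\<^sup>2)" .
qed

subsection \<open>Averages over cubes\<close>

lemma integrable_lborel_affine:
  fixes f :: "'a::euclidean_space \<Rightarrow> 'b::{banach, second_countable_topology}"
  assumes f: "integrable lborel f" and c: "c \<noteq> 0"
  shows "integrable lborel (\<lambda>x. f (t + c *\<^sub>R x))"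
proof -
  have [measurable]: "f \<in> borel_measurable borel" using f by (auto dest: borel_measurable_integrable)
  have "ennreal (\<bar>c\<bar> ^ DIM('a)) * (\<integral>\<^sup>+x. ennreal (norm (f (t + c *\<^sub>R x))) \<partial>lborel) < \<infinity>"
    using f nn_integral_lborel_affine[OF _ c, of "\<lambda>x. ennreal (norm (f x))" t]
    by (simp add: integrable_iff_bounded)
  then have "(\<integral>\<^sup>+x. ennreal (norm (f (t + c *\<^sub>R x))) \<partial>lborel) < \<infinity>"
    using c by (auto simp: ennreal_mult_less_top)
  then show ?thesis by (simp add: integrable_iff_bounded)
qed

lemma integrable_affine_indicator:
  fixes w :: "'a::euclidean_space \<Rightarrow> 'b::euclidean_space"
  assumes w: "loc_int w" and K: "compact K" and r: "r \<noteq> 0"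
  shows "integrable lborel (\<lambda>y. indicator K y *\<^sub>R w (x + r *\<^sub>R y))"
proof -
  have "compact ((\<lambda>y. x + r *\<^sub>R y) ` K)"
    by (intro compact_continuous_image K continuous_intros)
  then have "integrable lborel (\<lambda>z. indicator ((\<lambda>y. x + r *\<^sub>R y) ` K) z *\<^sub>R w z)"
    using w by (simp add: loc_int_def set_integrable_def)
  from integrable_lborel_affine[OF this r, of x]
  have "integrable lborel (\<lambda>y. indicator ((\<lambda>y. x + r *\<^sub>R y) ` K) (x + r *\<^sub>R y) *\<^sub>R w (x + r *\<^sub>R y))" .
  also have "(\<lambda>y. indicator ((\<lambda>y. x + r *\<^sub>R y) ` K) (x + r *\<^sub>R y) :: real) = indicator K"
    using r by (auto simp: indicator_def image_iff)
  finally show ?thesis .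
qed

abbreviation unit_cube :: "'a::euclidean_space set" where
  "unit_cube \<equiv> cbox 0 One"

lemma emeasure_unit_cube: "emeasure lborel (unit_cube :: 'a::euclidean_space set) = 1"
  by simp

lemma norm_unit_cube_le:
  fixes y :: "'a::euclidean_space"
  assumes "y \<in> unit_cube" shows "norm y \<le> DIM('a)"
proof -
  have "norm y \<le> (\<Sum>b\<in>Basis. \<bar>y \<bullet> b\<bar>)" by (rule norm_le_l1)
  also have "\<dots> \<le> (\<Sum>b\<in>(Basis::'a set). 1)"
    using assms by (intro sum_mono) (auto simp: mem_box)
  finally show ?thesis by simp
qed

text \<open>The mean over the cube with corner \<open>x\<close> and side \<open>r\<close>, pulled
  back to the unit cube. As that cube has measure one, Jensen applies without a normalising factor,
  and the scale appears only in the argument of \<open>w\<close>.\<close>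

definition cube_average :: "real \<Rightarrow> ('a::euclidean_space \<Rightarrow> real) \<Rightarrow> 'a \<Rightarrow> real" where
  "cube_average r w x = (\<integral>y. indicator unit_cube y * w (x + r *\<^sub>R y) \<partial>lborel)"

lemma integrable_cube_average:
  fixes w :: "'a::euclidean_space \<Rightarrow> real"
  assumes "loc_int w" "r > 0"
  shows "integrable lborel (\<lambda>y. indicator unit_cube y * w (x + r *\<^sub>R y))"
  using integrable_affine_indicator[OF assms(1) compact_cbox[of 0 One], of r x] assms(2) by simp

lemma integrable_unit_cube: "integrable lborel (\<lambda>y::'a::euclidean_space. indicator unit_cube y * (c::real))"
  by (intro integrable_mult_left integrable_real_indicator) auto

lemma integral_unit_cube: "(\<integral>y. indicator unit_cube y * c \<partial>(lborel :: 'a::euclidean_space measure)) = (c::real)"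
  by (simp add: measure_def emeasure_unit_cube)

lemma cube_average_measurable [measurable]:
  assumes [measurable]: "w \<in> borel_measurable borel"
  shows "cube_average r w \<in> borel_measurable borel"
  unfolding cube_average_def[abs_def] by measurable

lemma translation_bound_loc_int: "translation_bound G w \<Longrightarrow> loc_int w"
  by (simp add: translation_bound_def)

lemma abs_le_sqrt_if_ennreal:
  assumes "ennreal (a\<^sup>2) \<le> ennreal b" "b \<ge> 0" shows "\<bar>a\<bar> \<le> sqrt b"
  using assms by (simp add: ennreal_le_iff real_le_rsqrt)

text \<open>Jensen on the unit cube reduces the increment to the translation estimate; the change of
  variables back to the cube of side \<open>r\<close> contributes the factor
  \<open>1 / r ^ DIM('a)\<close>. The Lipschitz constant depends on \<open>w\<close> only through
  \<open>G\<close>.\<close>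

lemma cube_average_shift_le:
  fixes w :: "'a::euclidean_space \<Rightarrow> real"
  assumes w: "translation_bound G w" and r: "r > 0" and G: "G \<ge> 0"
  shows "\<bar>cube_average r w (x + h) - cube_average r w x\<bar> \<le> sqrt (G / r ^ DIM('a)) * norm h"
proof -
  have loc: "loc_int w" using w by (rule translation_bound_loc_int)
  note [measurable] = loc_int_measurable[OF loc]
  have "cube_average r w (x + h) - cube_average r w x = (\<integral>y. indicator unit_cube y * (w (x + h + r *\<^sub>R y) - w (x + r *\<^sub>R y)) \<partial>lborel)"
    using integrable_cube_average[OF loc r] by (simp add: cube_average_def right_diff_distrib)
  then have "ennreal ((cube_average r w (x + h) - cube_average r w x)\<^sup>2)
      \<le> (\<integral>\<^sup>+y. indicator unit_cube y * ennreal ((w (x + h + r *\<^sub>R y) - w (x + r *\<^sub>R y))\<^sup>2) \<partial>lborel)"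
    using square_integral_le_nn_integral[of "\<lambda>y. w (x + h + r *\<^sub>R y) - w (x + r *\<^sub>R y)" lborel unit_cube] by simp
  also have "\<dots> \<le> (\<integral>\<^sup>+y. ennreal ((w (x + r *\<^sub>R y + h) - w (x + r *\<^sub>R y))\<^sup>2) \<partial>lborel)"
    by (intro nn_integral_mono) (auto simp: indicator_def add_ac)
  also have "\<dots> = ennreal (1 / r ^ DIM('a)) * (\<integral>\<^sup>+z. ennreal ((w (z + h) - w z)\<^sup>2) \<partial>lborel)"
    using r by (subst nn_integral_lborel_affine[of _ r x]) (auto simp flip: mult.assoc ennreal_mult)
  also have "\<dots> \<le> ennreal (1 / r ^ DIM('a)) * ennreal (G * (norm h)\<^sup>2)"
    using w by (intro mult_left_mono) (auto simp: translation_bound_def)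
  also have "\<dots> = ennreal (G / r ^ DIM('a) * (norm h)\<^sup>2)"
    using r by (simp flip: ennreal_mult')
  finally have "\<bar>cube_average r w (x + h) - cube_average r w x\<bar> \<le> sqrt (G / r ^ DIM('a) * (norm h)\<^sup>2)"
    using r G by (intro abs_le_sqrt_if_ennreal) auto
  then show ?thesis by (simp only: real_sqrt_mult real_sqrt_abs abs_norm_cancel)
qed

text \<open>The deviation from the mean is itself a mean of increments by
  \<open>r *\<^sub>R y\<close> with \<open>y\<close> in the unit cube. The factor
  \<open>DIM('a)\<close> is the crude bound on the norm of such a \<open>y\<close>.\<close>

lemma nn_integral_cube_average_diff_le:
  fixes w :: "'a::euclidean_space \<Rightarrow> real"
  assumes w: "translation_bound G w" and r: "r > 0" and G: "G \<ge> 0"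
  shows "(\<integral>\<^sup>+x. ennreal ((cube_average r w x - w x)\<^sup>2) \<partial>lborel) \<le> ennreal (G * (r * DIM('a))\<^sup>2)"
proof -
  have loc: "loc_int w" using w by (rule translation_bound_loc_int)
  note [measurable] = loc_int_measurable[OF loc]
  have "(\<integral>\<^sup>+x. ennreal ((cube_average r w x - w x)\<^sup>2) \<partial>lborel)
      \<le> (\<integral>\<^sup>+x. (\<integral>\<^sup>+y. indicator unit_cube y * ennreal ((w (x + r *\<^sub>R y) - w x)\<^sup>2) \<partial>lborel) \<partial>lborel)"
  proof (rule nn_integral_mono)
    fix x :: 'a
    have "cube_average r w x - w x = (\<integral>y. indicator unit_cube y * (w (x + r *\<^sub>R y) - w x) \<partial>lborel)"
      using integrable_cube_average[OF loc r, of x] integrable_unit_cube[of "w x"] integral_unit_cube[of "w x"]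
      by (simp add: cube_average_def right_diff_distrib)
    then show "ennreal ((cube_average r w x - w x)\<^sup>2) \<le> (\<integral>\<^sup>+y. indicator unit_cube y * ennreal ((w (x + r *\<^sub>R y) - w x)\<^sup>2) \<partial>lborel)"
      using square_integral_le_nn_integral[of "\<lambda>y. w (x + r *\<^sub>R y) - w x" lborel unit_cube] by simp
  qed
  also have "\<dots> = (\<integral>\<^sup>+y. (\<integral>\<^sup>+x. indicator unit_cube y * ennreal ((w (x + r *\<^sub>R y) - w x)\<^sup>2) \<partial>lborel) \<partial>lborel)"
    by (rule lborel_pair.Fubini') measurable
  also have "\<dots> \<le> (\<integral>\<^sup>+y. ennreal (G * (r * DIM('a))\<^sup>2) * indicator unit_cube (y::'a) \<partial>lborel)"
  proof (rule nn_integral_mono)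
    fix y :: 'a
    have "(\<integral>\<^sup>+x. ennreal ((w (x + r *\<^sub>R y) - w x)\<^sup>2) \<partial>lborel) \<le> ennreal (G * (norm (r *\<^sub>R y))\<^sup>2)"
      using w unfolding translation_bound_def by blast
    also have "\<dots> \<le> ennreal (G * (r * DIM('a))\<^sup>2)" if "y \<in> unit_cube"
      using r G norm_unit_cube_le[OF that] by (intro ennreal_leI mult_left_mono power_mono) auto
    finally show "(\<integral>\<^sup>+x. indicator unit_cube y * ennreal ((w (x + r *\<^sub>R y) - w x)\<^sup>2) \<partial>lborel)
        \<le> ennreal (G * (r * DIM('a))\<^sup>2) * indicator unit_cube y"
      by (cases "y \<in> unit_cube") auto
  qed
  also have "\<dots> = ennreal (G * (r * DIM('a))\<^sup>2)"
    by (subst nn_integral_cmult_indicator) (auto simp: emeasure_unit_cube)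
  finally show ?thesis .
qed

lemma cube_average_Lipschitz_diff_le:
  fixes u :: "'a::euclidean_space \<Rightarrow> real"
  assumes L: "\<And>x h. \<bar>u (x + h) - u x\<bar> \<le> L * norm h" and L0: "L \<ge> 0" and s: "s > 0"
    and [measurable]: "u \<in> borel_measurable borel"
  shows "\<bar>cube_average s u x - u x\<bar> \<le> L * (s * DIM('a))"
proof -
  have bd: "norm (indicator unit_cube y * (u (x + s *\<^sub>R y) - u x)) \<le> indicator unit_cube y * (L * (s * DIM('a)))" for y
  proof (cases "y \<in> unit_cube")
    case True
    have "\<bar>u (x + s *\<^sub>R y) - u x\<bar> \<le> L * norm (s *\<^sub>R y)" by (rule L)
    also have "\<dots> \<le> L * (s * DIM('a))"
      using norm_unit_cube_le[OF True] s L0 by (auto intro!: mult_left_mono)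
    finally show ?thesis using True by simp
  qed simp
  have int: "integrable lborel (\<lambda>y. indicator unit_cube y * (u (x + s *\<^sub>R y) - u x))"
    by (rule Bochner_Integration.integrable_bound[OF integrable_unit_cube[of "L * (s * DIM('a))"]])
      (use bd in \<open>auto intro!: AE_I2 intro: order_trans abs_ge_self\<close>)
  have "integrable lborel (\<lambda>y. indicator unit_cube y * (u (x + s *\<^sub>R y) - u x) + indicator unit_cube y * u x)"
    by (intro Bochner_Integration.integrable_add int integrable_unit_cube)
  then have int': "integrable lborel (\<lambda>y. indicator unit_cube y * u (x + s *\<^sub>R y))"
    by (simp add: algebra_simps)
  have "cube_average s u x - u x = (\<integral>y. indicator unit_cube y * (u (x + s *\<^sub>R y) - u x) \<partial>lborel)"
    using int' integrable_unit_cube[of "u x"] integral_unit_cube[of "u x"]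
    by (simp add: cube_average_def right_diff_distrib)
  then have "\<bar>cube_average s u x - u x\<bar> \<le> (\<integral>y. norm (indicator unit_cube y * (u (x + s *\<^sub>R y) - u x)) \<partial>lborel)"
    by (metis integral_norm_bound real_norm_def)
  also have "\<dots> \<le> (\<integral>y. indicator unit_cube y * (L * (s * DIM('a))) \<partial>(lborel :: 'a measure))"
    by (intro integral_mono integrable_norm int integrable_unit_cube bd)
  also have "\<dots> = L * (s * DIM('a))" by (rule integral_unit_cube)
  finally show ?thesis .
qed

text \<open>Fubini's theorem; the work lies in showing that the double integrand is
  integrable.\<close>

lemma cube_average_cube_average_commute:
  fixes w :: "'a::euclidean_space \<Rightarrow> real"
  assumes loc: "loc_int w" and r: "r > 0"
  shows "cube_average (2 * r) (cube_average r w) x = cube_average r (cube_average (2 * r) w) x"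
proof -
  note [measurable] = loc_int_measurable[OF loc]
  let ?I = "indicator unit_cube :: 'a \<Rightarrow> real"
  have "integrable (lborel \<Otimes>\<^sub>M lborel) (\<lambda>(z, y). ?I z * (?I y * w (x + (2 * r) *\<^sub>R z + r *\<^sub>R y)))"
    unfolding integrable_iff_bounded
  proof
    \<comment> \<open>A step of size \<open>2 * r\<close> along \<open>z\<close> followed by one of
      size \<open>r\<close> along \<open>y\<close> is a step of size \<open>r\<close> along
      \<open>y + 2 *\<^sub>R z\<close>, which lies in the cube of side 3.\<close>
    let ?Q3 = "cbox 0 (3 *\<^sub>R One) :: 'a set"
    let ?C = "\<integral>\<^sup>+y. ennreal (norm (indicator ?Q3 y *\<^sub>R w (x + r *\<^sub>R y))) \<partial>lborel"
    have "integrable lborel (\<lambda>y. indicator ?Q3 y *\<^sub>R w (x + r *\<^sub>R y))"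
      using integrable_affine_indicator[OF loc compact_cbox] r by simp
    then have C: "?C < \<infinity>" by (simp only: integrable_iff_bounded)
    show "(\<lambda>(z, y). ?I z * (?I y * w (x + (2 * r) *\<^sub>R z + r *\<^sub>R y))) \<in> borel_measurable (lborel \<Otimes>\<^sub>M lborel)"
      by measurable
    have "(\<integral>\<^sup>+p. ennreal (norm (case p of (z, y) \<Rightarrow> ?I z * (?I y * w (x + (2 * r) *\<^sub>R z + r *\<^sub>R y)))) \<partial>(lborel \<Otimes>\<^sub>M lborel))
        = (\<integral>\<^sup>+z. (\<integral>\<^sup>+y. ennreal (norm (?I z * (?I y * w (x + (2 * r) *\<^sub>R z + r *\<^sub>R y)))) \<partial>lborel) \<partial>lborel)"
      by (subst lborel.nn_integral_fst[symmetric]) auto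
    also have "\<dots> \<le> (\<integral>\<^sup>+z. ?C * indicator (unit_cube :: 'a set) z \<partial>lborel)"
    proof (rule nn_integral_mono)
      fix z :: 'a
      have "(\<integral>\<^sup>+y. ennreal (norm (?I y * w (x + (2 * r) *\<^sub>R z + r *\<^sub>R y))) \<partial>lborel)
          \<le> (\<integral>\<^sup>+y. ennreal (norm (indicator ?Q3 (y + 2 *\<^sub>R z) *\<^sub>R w (x + r *\<^sub>R (y + 2 *\<^sub>R z)))) \<partial>lborel)" if z: "z \<in> unit_cube"
      proof (intro nn_integral_mono ennreal_leI)
        fix y :: 'a
        have "y + 2 *\<^sub>R z \<in> ?Q3" if "y \<in> unit_cube"
          using z that by (fastforce simp: mem_box inner_add_left)
        moreover have e: "x + (2 * r) *\<^sub>R z + r *\<^sub>R y = x + r *\<^sub>R (y + 2 *\<^sub>R z)"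
          by (simp add: scaleR_add_right mult.commute)
        ultimately show "norm (?I y * w (x + (2 * r) *\<^sub>R z + r *\<^sub>R y)) \<le> norm (indicator ?Q3 (y + 2 *\<^sub>R z) *\<^sub>R w (x + r *\<^sub>R (y + 2 *\<^sub>R z)))"
          unfolding e by (cases "y \<in> unit_cube") auto
      qed
      also have "(\<integral>\<^sup>+y. ennreal (norm (indicator ?Q3 (y + 2 *\<^sub>R z) *\<^sub>R w (x + r *\<^sub>R (y + 2 *\<^sub>R z)))) \<partial>lborel) = ?C"
        by (rule nn_integral_lborel_shift[of "\<lambda>y. ennreal (norm (indicator ?Q3 y *\<^sub>R w (x + r *\<^sub>R y)))"]) measurable
      finally show "(\<integral>\<^sup>+y. ennreal (norm (?I z * (?I y * w (x + (2 * r) *\<^sub>R z + r *\<^sub>R y)))) \<partial>lborel) \<le> ?C * indicator unit_cube z"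
        by (cases "z \<in> unit_cube") auto
    qed
    also have "\<dots> = ?C" by (subst nn_integral_cmult_indicator) (auto simp: emeasure_unit_cube)
    also note C
    finally show "(\<integral>\<^sup>+p. ennreal (norm (case p of (z, y) \<Rightarrow> ?I z * (?I y * w (x + (2 * r) *\<^sub>R z + r *\<^sub>R y)))) \<partial>(lborel \<Otimes>\<^sub>M lborel)) < \<infinity>" .
  qed
  from lborel_pair.Fubini_integral[OF this]
  have "(\<integral>y. (\<integral>z. ?I z * (?I y * w (x + (2 * r) *\<^sub>R z + r *\<^sub>R y)) \<partial>lborel) \<partial>lborel)
      = (\<integral>z. (\<integral>y. ?I z * (?I y * w (x + (2 * r) *\<^sub>R z + r *\<^sub>R y)) \<partial>lborel) \<partial>lborel)" .
  moreover have "(\<integral>z. ?I z * (?I y * w (x + (2 * r) *\<^sub>R z + r *\<^sub>R y)) \<partial>lborel) = ?I y * cube_average (2 * r) w (x + r *\<^sub>R y)" for y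
  proof -
    have "?I y * cube_average (2 * r) w (x + r *\<^sub>R y) = (\<integral>z. ?I y * (?I z * w (x + r *\<^sub>R y + (2 * r) *\<^sub>R z)) \<partial>lborel)"
      by (simp add: cube_average_def)
    then show ?thesis by (simp add: ac_simps)
  qed
  moreover have "(\<integral>y. ?I z * (?I y * w (x + (2 * r) *\<^sub>R z + r *\<^sub>R y)) \<partial>lborel) = ?I z * cube_average r w (x + (2 * r) *\<^sub>R z)" for z
    by (simp add: cube_average_def)
  ultimately have "(\<integral>y. ?I y * cube_average (2 * r) w (x + r *\<^sub>R y) \<partial>lborel) = (\<integral>z. ?I z * cube_average r w (x + (2 * r) *\<^sub>R z) \<partial>lborel)"
    by (simp only:)
  then show ?thesis
    unfolding cube_average_def[of r "cube_average (2 * r) w"] cube_average_def[of "2 * r" "cube_average r w"] by simp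
qed

text \<open>Averaging at the two scales commutes, so both averages are close to the iterated one.\<close>

lemma cube_average_double_le:
  fixes w :: "'a::euclidean_space \<Rightarrow> real"
  assumes w: "translation_bound G w" and r: "r > 0" and G: "G \<ge> 0"
  shows "\<bar>cube_average r w x - cube_average (2 * r) w x\<bar> \<le> 3 * r * DIM('a) * sqrt (G / r ^ DIM('a))"
proof -
  have loc: "loc_int w" using w by (rule translation_bound_loc_int)
  note [measurable] = loc_int_measurable[OF loc]
  have "\<bar>cube_average (2 * r) (cube_average r w) x - cube_average r w x\<bar> \<le> sqrt (G / r ^ DIM('a)) * (2 * r * DIM('a))"
    using r G by (intro cube_average_Lipschitz_diff_le cube_average_shift_le[OF w]) auto
  moreover have "\<bar>cube_average r (cube_average (2 * r) w) x - cube_average (2 * r) w x\<bar> \<le> sqrt (G / (2 * r) ^ DIM('a)) * (r * DIM('a))"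
    using r G by (intro cube_average_Lipschitz_diff_le cube_average_shift_le[OF w]) auto
  \<comment> \<open>The coarser average has the smaller Lipschitz constant. Replacing it by the one
    at scale \<open>r\<close> makes the two displacements \<open>2 * r\<close> and \<open>r\<close>
    add up to the factor 3.\<close>
  moreover have "sqrt (G / (2 * r) ^ DIM('a)) * (r * DIM('a)) \<le> sqrt (G / r ^ DIM('a)) * (r * DIM('a))"
    using r G by (intro mult_right_mono real_sqrt_le_mono divide_left_mono power_mono) auto
  ultimately show ?thesis
    unfolding cube_average_cube_average_commute[OF loc r] by (simp add: algebra_simps abs_le_iff)
qed

text \<open>The increments between successive dyadic scales are dominated by a geometric series, and
  the average at the largest scale disappears in the limit. The constant 12 is the 3 of
  \<open>cube_average_double_le\<close> times the sum 4 of the powers of 3/4.\<close>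

lemma cube_average_le_if_tendsto_0:
  fixes w :: "'a::euclidean_space \<Rightarrow> real"
  assumes w: "translation_bound G w" and r: "r > 0" and G: "G \<ge> 0" and d: "DIM('a) \<ge> 3"
    and lim: "(\<lambda>k. cube_average (2 ^ k * r) w x) \<longlonglongrightarrow> 0"
  shows "\<bar>cube_average r w x\<bar> \<le> 12 * r * DIM('a) * sqrt (G / r ^ DIM('a))"
proof -
  let ?B = "3 * r * DIM('a) * sqrt (G / r ^ DIM('a))"
  have B0: "?B \<ge> 0" using r G by simp
  \<comment> \<open>The true ratio of successive bounds is \<open>2 powr (1 - d / 2)\<close>, at
    most \<open>1 / sqrt 2\<close> since the dimension is at least 3. The rational majorant 3/4 is
    verified after squaring, where it amounts to \<open>4 * 16 \<le> 9 * 8\<close>.\<close>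
  have step: "\<bar>cube_average (2 ^ k * r) w x - cube_average (2 ^ Suc k * r) w x\<bar> \<le> ?B * (3/4) ^ k" for k
  proof -
    have p4: "((2::real) ^ k)\<^sup>2 = 4 ^ k" and p34: "((3/4::real) ^ k)\<^sup>2 = 9 ^ k / 16 ^ k"
      by (simp_all add: power2_eq_square power_divide flip: power_mult_distrib)
    have "(2::real) ^ k * sqrt (G / (2 ^ k * r) ^ DIM('a)) \<le> (3/4) ^ k * sqrt (G / r ^ DIM('a))"
    proof -
      have "(4::real) ^ k * 16 ^ k \<le> (9 ^ k * 8 ^ k)"
        by (simp only: power_mult_distrib[symmetric]) (intro power_mono, auto)
      also have "(9::real) ^ k * 8 ^ k \<le> 9 ^ k * (2 ^ k) ^ DIM('a)"
      proof -
        have "(8::real) ^ k = (2 ^ 3) ^ k" by simp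
        also have "\<dots> = (2 ^ k) ^ 3" by (simp only: power_mult[symmetric] mult.commute)
        also have "\<dots> \<le> (2 ^ k) ^ DIM('a)" using d by (intro power_increasing) auto
        finally show ?thesis by simp
      qed
      finally have "(4::real) ^ k / (2 ^ k) ^ DIM('a) \<le> 9 ^ k / 16 ^ k"
        by (simp add: field_simps)
      then have "(4::real) ^ k / (2 ^ k) ^ DIM('a) * (G / r ^ DIM('a)) \<le> 9 ^ k / 16 ^ k * (G / r ^ DIM('a))"
        using r G by (intro mult_right_mono) auto
      moreover have "(2 ^ k * sqrt (G / (2 ^ k * r) ^ DIM('a)))\<^sup>2 = (4::real) ^ k / (2 ^ k) ^ DIM('a) * (G / r ^ DIM('a))"
        using r G by (simp add: power_mult_distrib p4)
      moreover have "((3/4) ^ k * sqrt (G / r ^ DIM('a)))\<^sup>2 = 9 ^ k / 16 ^ k * (G / r ^ DIM('a))"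
        using r G by (subst power_mult_distrib) (simp add: p34)
      ultimately have "(2 ^ k * sqrt (G / (2 ^ k * r) ^ DIM('a)))\<^sup>2 \<le> ((3/4) ^ k * sqrt (G / r ^ DIM('a)))\<^sup>2"
        by (simp only:)
      then show ?thesis
        by (rule power2_le_imp_le) (use r G in simp)
    qed
    then have "3 * r * DIM('a) * (2 ^ k * sqrt (G / (2 ^ k * r) ^ DIM('a))) \<le> 3 * r * DIM('a) * ((3/4) ^ k * sqrt (G / r ^ DIM('a)))"
      using r by (intro mult_left_mono) auto
    moreover have "\<bar>cube_average (2 ^ k * r) w x - cube_average (2 ^ Suc k * r) w x\<bar> \<le> 3 * r * DIM('a) * (2 ^ k * sqrt (G / (2 ^ k * r) ^ DIM('a)))"
      using cube_average_double_le[OF w _ G, of "2 ^ k * r" x] r by (simp only: power_Suc mult_ac) simp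
    ultimately show ?thesis by (simp only: mult.assoc mult.commute[of "sqrt _"])
  qed
  have "\<bar>cube_average r w x\<bar> \<le> ?B * (\<Sum>k<n. (3/4) ^ k) + \<bar>cube_average (2 ^ n * r) w x\<bar>" for n
  proof (induction n)
    case (Suc n)
    have "\<bar>cube_average r w x\<bar> \<le> ?B * (\<Sum>k<n. (3/4) ^ k) + (?B * (3/4) ^ n + \<bar>cube_average (2 ^ Suc n * r) w x\<bar>)"
      using Suc step[of n] by linarith
    then show ?case by (simp add: distrib_left)
  qed simp
  moreover have "?B * (\<Sum>k<n. (3/4) ^ k) \<le> ?B * 4" for n
  proof (rule mult_left_mono[OF _ B0])
    show "(\<Sum>k<n. (3/4) ^ k) \<le> (4::real)"
      by (subst geometric_sum) (auto simp: field_simps)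
  qed
  ultimately have "\<bar>cube_average r w x\<bar> \<le> ?B * 4 + \<bar>cube_average (2 ^ n * r) w x\<bar>" for n
    by (meson add_mono order_trans order_refl)
  moreover have "(\<lambda>n. ?B * 4 + \<bar>cube_average (2 ^ n * r) w x\<bar>) \<longlonglongrightarrow> ?B * 4 + \<bar>0\<bar>"
    by (intro tendsto_intros lim)
  ultimately have "\<bar>cube_average r w x\<bar> \<le> ?B * 4 + \<bar>0\<bar>"
    by (intro LIMSEQ_le_const) auto
  then show ?thesis by simp
qed

subsection \<open>Weak-type Sobolev inequality\<close>

text \<open>The \<open>q\<close>-th power of \<open>weighted_norm\<close>, over
  \<open>lborel\<close>. Energy and constraint contain only such powers, so no roots need to be
  carried along.\<close>

definition weighted_integral :: "real \<Rightarrow> real \<Rightarrow> ('a::euclidean_space \<Rightarrow> real) \<Rightarrow> ennreal" where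
  "weighted_integral q \<gamma> w = (\<integral>\<^sup>+x. ennreal (\<bar>w x\<bar> powr q * norm x powr (- \<gamma>)) \<partial>lborel)"

lemma nn_integral_cball_powr_le_weighted_integral:
  fixes w :: "'a::euclidean_space \<Rightarrow> real"
  assumes [measurable]: "w \<in> borel_measurable borel" and \<gamma>: "\<gamma> \<ge> 0"
  shows "(\<integral>\<^sup>+x. indicator (cball 0 R) x * ennreal (\<bar>w x\<bar> powr q) \<partial>lborel) \<le> ennreal (R powr \<gamma>) * weighted_integral q \<gamma> w"
proof -
  have "(\<integral>\<^sup>+x. indicator (cball 0 R) x * ennreal (\<bar>w x\<bar> powr q) \<partial>lborel)
      \<le> (\<integral>\<^sup>+x. ennreal (R powr \<gamma>) * ennreal (\<bar>w x\<bar> powr q * norm x powr (- \<gamma>)) \<partial>lborel)"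
  proof (rule nn_integral_mono_AE)
    \<comment> \<open>The origin is excluded because the weight takes the value 0 there; everywhere
      else in the ball it is at least \<open>R powr (- \<gamma>)\<close>.\<close>
    show "AE x in lborel. indicator (cball 0 R) x * ennreal (\<bar>w x\<bar> powr q)
        \<le> ennreal (R powr \<gamma>) * ennreal (\<bar>w x\<bar> powr q * norm x powr (- \<gamma>))"
      using AE_lborel_singleton[of 0]
    proof eventually_elim
      case (elim x)
      show ?case
      proof (cases "x \<in> cball 0 R")
        case True
        then have "norm x powr \<gamma> \<le> R powr \<gamma>" using \<gamma> by (intro powr_mono2) auto
        then have "1 \<le> R powr \<gamma> * norm x powr (- \<gamma>)"
          using elim by (simp add: powr_minus field_simps)
        from mult_left_mono[OF this, of "\<bar>w x\<bar> powr q"]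
        have "\<bar>w x\<bar> powr q \<le> R powr \<gamma> * (\<bar>w x\<bar> powr q * norm x powr (- \<gamma>))" by (simp add: mult_ac)
        then show ?thesis using True by (simp add: ennreal_leI flip: ennreal_mult)
      qed simp
    qed
  qed
  also have "\<dots> = ennreal (R powr \<gamma>) * weighted_integral q \<gamma> w"
    unfolding weighted_integral_def by (rule nn_integral_cmult) measurable
  finally show ?thesis .
qed

text \<open>Plays the part of Hoelder's inequality on sets of finite measure: integrated, it bounds
  the \<open>L1\<close> norm by the integral of a higher power, with a threshold \<open>e\<close> at
  one's disposal. Above the threshold, \<open>t powr (1 - q)\<close> is at most
  \<open>e powr (1 - q)\<close>.\<close>

lemma le_add_powr:
  fixes t e q :: real
  assumes "t \<ge> 0" "e > 0" "q > 1"
  shows "t \<le> e + e powr (1 - q) * t powr q"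
proof (cases "t \<le> e")
  case False
  then have "t powr (1 - q) \<le> e powr (1 - q)"
    using assms by (intro powr_mono2') auto
  then have "t powr (1 - q) * t powr q \<le> e powr (1 - q) * t powr q"
    by (intro mult_right_mono) auto
  then show ?thesis using assms False by (simp flip: powr_add)
qed (use assms in \<open>auto intro: add_increasing2\<close>)

text \<open>The threshold \<open>e\<close> stays free: \<open>e = 1\<close> gives a bound uniform in
  \<open>w\<close>, as needed to extract subsequences, while a small \<open>e\<close> gives decay at
  large scales. The ball of radius \<open>norm x + r * DIM('a)\<close> contains the cube.\<close>

lemma abs_cube_average_le_weighted_integral:
  fixes w :: "'a::euclidean_space \<Rightarrow> real"
  assumes w: "loc_int w" and r: "r > 0" and e: "e > 0" and q: "q > 1" and \<gamma>: "\<gamma> \<ge> 0"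
    and C: "weighted_integral q \<gamma> w \<le> ennreal C" "C \<ge> 0"
  shows "\<bar>cube_average r w x\<bar> \<le> e + e powr (1 - q) * (1 / r ^ DIM('a) * ((norm x + r * DIM('a)) powr \<gamma> * C))"
proof -
  note [measurable] = loc_int_measurable[OF w]
  let ?R = "norm x + r * DIM('a)"
  define P where "P z = indicator (cball 0 ?R) z * ennreal (\<bar>w z\<bar> powr q)" for z
  have [measurable]: "cball (0::'a) ?R \<in> sets borel" by simp
  have [measurable]: "P \<in> borel_measurable borel" unfolding P_def[abs_def] by measurable
  have "ennreal \<bar>cube_average r w x\<bar> \<le> (\<integral>\<^sup>+y. ennreal (norm (indicator unit_cube y * w (x + r *\<^sub>R y))) \<partial>lborel)"
    using integral_norm_bound_ennreal[OF integrable_cube_average[OF w r]] by (simp add: cube_average_def)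
  also have "\<dots> \<le> (\<integral>\<^sup>+y. ennreal e * indicator unit_cube y + ennreal (e powr (1 - q)) * P (x + r *\<^sub>R y) \<partial>lborel)"
  proof (rule nn_integral_mono)
    fix y :: 'a
    show "ennreal (norm (indicator unit_cube y * w (x + r *\<^sub>R y))) \<le> ennreal e * indicator unit_cube y + ennreal (e powr (1 - q)) * P (x + r *\<^sub>R y)"
    proof (cases "y \<in> unit_cube")
      case True
      have "norm (x + r *\<^sub>R y) \<le> norm x + r * norm y"
        using norm_triangle_ineq[of x "r *\<^sub>R y"] r by simp
      also have "\<dots> \<le> ?R" using norm_unit_cube_le[OF True] r by simp
      finally have 1: "x + r *\<^sub>R y \<in> cball 0 ?R" by simp
      have "ennreal \<bar>w (x + r *\<^sub>R y)\<bar> \<le> ennreal (e + e powr (1 - q) * \<bar>w (x + r *\<^sub>R y)\<bar> powr q)"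
        by (intro ennreal_leI le_add_powr e q) simp
      then show ?thesis using True 1 e by (simp add: P_def ennreal_mult)
    qed simp
  qed
  also have "\<dots> = ennreal e + ennreal (e powr (1 - q)) * (\<integral>\<^sup>+y. P (x + r *\<^sub>R y) \<partial>lborel)"
    by (simp add: nn_integral_add nn_integral_cmult nn_integral_cmult_indicator)
  also have "(\<integral>\<^sup>+y. P (x + r *\<^sub>R y) \<partial>lborel) = ennreal (1 / r ^ DIM('a)) * (\<integral>\<^sup>+z. P z \<partial>lborel)"
    using r by (subst nn_integral_lborel_affine[of _ r x]) (auto simp flip: mult.assoc ennreal_mult)
  also have "ennreal e + ennreal (e powr (1 - q)) * \<dots>
      \<le> ennreal e + ennreal (e powr (1 - q)) * (ennreal (1 / r ^ DIM('a)) * (ennreal (?R powr \<gamma>) * ennreal C))"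
    unfolding P_def
    by (intro add_mono order_refl mult_left_mono order_trans[OF nn_integral_cball_powr_le_weighted_integral[OF _ \<gamma>]] C(1)) auto
  also have "\<dots> = ennreal (e + e powr (1 - q) * (1 / r ^ DIM('a) * (?R powr \<gamma> * C)))"
    using C e r by (simp flip: ennreal_mult ennreal_plus)
  finally show ?thesis
    using C e r by (subst (asm) ennreal_le_iff) auto
qed

text \<open>Removes the boundary term of the telescoping sum. Up to the threshold, the average over
  a cube of side \<open>s\<close> is of order \<open>s powr (\<gamma> - d)\<close>, and \<gamma> is
  smaller than the dimension.\<close>

lemma cube_average_tendsto_0:
  fixes w :: "'a::euclidean_space \<Rightarrow> real" and \<gamma> :: real
  assumes w: "loc_int w" and r: "r > 0" and q: "q > 1" and \<gamma>: "\<gamma> \<ge> 0" "\<gamma> < DIM('a)"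
    and fin: "weighted_integral q \<gamma> w < \<infinity>"
  shows "(\<lambda>k. cube_average (2 ^ k * r) w x) \<longlonglongrightarrow> 0"
proof (rule tendstoI)
  fix e :: real assume e: "e > 0"
  let ?d = "real DIM('a)"
  obtain C where C: "weighted_integral q \<gamma> w \<le> ennreal C" "C \<ge> 0"
    using fin by (metis enn2real_nonneg ennreal_enn2real infinity_ennreal_def order_refl)
  have "((\<lambda>s. s powr (\<gamma> - ?d)) \<longlongrightarrow> 0) at_top"
    using \<gamma> by (intro tendsto_neg_powr filterlim_ident) auto
  then have "((\<lambda>s. (e/2) powr (1 - q) * ((1 + ?d) powr \<gamma> * s powr (\<gamma> - ?d) * C)) \<longlongrightarrow> (e/2) powr (1 - q) * ((1 + ?d) powr \<gamma> * 0 * C)) at_top"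
    by (intro tendsto_intros)
  then have "eventually (\<lambda>s. (e/2) powr (1 - q) * ((1 + ?d) powr \<gamma> * s powr (\<gamma> - ?d) * C) < e / 2) at_top"
    using e by (intro order_tendstoD(2)) auto
  \<comment> \<open>Makes \<open>norm x + s * ?d\<close> at most \<open>(1 + ?d) * s\<close>, so
    that a pure power of \<open>s\<close> remains.\<close>
  moreover have "eventually (\<lambda>s. s > norm x) at_top" by (rule eventually_gt_at_top)
  ultimately have ev: "eventually (\<lambda>s. dist (cube_average s w x) 0 < e) at_top"
  proof eventually_elim
    case (elim s)
    then have s: "s > 0" "norm x \<le> s" by (auto intro: le_less_trans[OF norm_ge_zero])
    have "(norm x + s * ?d) powr \<gamma> \<le> ((1 + ?d) * s) powr \<gamma>"
      using s \<gamma> by (intro powr_mono2) (auto simp: algebra_simps)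
    also have "\<dots> = (1 + ?d) powr \<gamma> * s powr \<gamma>" using s by (simp add: powr_mult)
    finally have "1 / s ^ DIM('a) * (norm x + s * ?d) powr \<gamma> \<le> 1 / s ^ DIM('a) * ((1 + ?d) powr \<gamma> * s powr \<gamma>)"
      using s by (intro mult_left_mono) auto
    also have "\<dots> = (1 + ?d) powr \<gamma> * s powr (\<gamma> - ?d)"
      using s by (simp add: powr_diff powr_realpow)
    finally have "1 / s ^ DIM('a) * ((norm x + s * ?d) powr \<gamma> * C) \<le> (1 + ?d) powr \<gamma> * s powr (\<gamma> - ?d) * C"
      using C(2) mult_right_mono by (fastforce simp: mult.assoc)
    then have "(e/2) powr (1 - q) * (1 / s ^ DIM('a) * ((norm x + s * ?d) powr \<gamma> * C)) \<le> (e/2) powr (1 - q) * ((1 + ?d) powr \<gamma> * s powr (\<gamma> - ?d) * C)"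
      by (intro mult_left_mono) auto
    with abs_cube_average_le_weighted_integral[OF w s(1) _ q \<gamma>(1) C, of "e/2" x] e elim(1) show ?case by simp
  qed
  have "filterlim (\<lambda>k. 2 ^ k * r) at_top sequentially"
    using r by (intro filterlim_at_top_mult_tendsto_pos[OF tendsto_const]
      filterlim_at_infinity_imp_filterlim_at_top filterlim_realpow_sequentially_gt1) auto
  from eventually_compose_filterlim[OF ev this]
  show "eventually (\<lambda>k. dist (cube_average (2 ^ k * r) w x) 0 < e) sequentially" .
qed

text \<open>\<open>K\<close> depends only on \<open>G\<close> and the dimension. The finite weighted
  integral enters qualitatively, to make the averages decay at large scales, and so the estimate is
  uniform over all \<open>w\<close> with the same translation bound.\<close>

lemma weak_Sobolev:
  assumes d: "DIM('a::euclidean_space) \<ge> 3" and G: "G > 0"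
  obtains K where "K \<ge> 0"
    "\<And>(w :: 'a \<Rightarrow> real) (q::real) (\<gamma>::real) (t::real). translation_bound G w \<Longrightarrow> q > 1 \<Longrightarrow> 0 \<le> \<gamma> \<Longrightarrow> \<gamma> < DIM('a) \<Longrightarrow> weighted_integral q \<gamma> w < \<infinity> \<Longrightarrow> t > 0 \<Longrightarrow>
      emeasure lborel {x. \<bar>w x\<bar> > t} \<le> ennreal (K * t powr (- (2 * real DIM('a) / (real DIM('a) - 2))))"
proof
  let ?d = "real DIM('a)"
  define m where "m = ?d - 2"
  have m: "m > 0" using d by (simp add: m_def)
  have dm: "?d = m + 2" by (simp add: m_def)
  \<comment> \<open>144 is the square of 12: with \<open>r powr m = A / s\<^sup>2\<close> the
    pointwise bound on the averages at scale \<open>r\<close> is exactly \<open>s\<close>, half the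
    level.\<close>
  define A where "A = 144 * ?d\<^sup>2 * G"
  have A: "A > 0" using G by (simp add: A_def)
  define a where "a = 2 * ?d / (?d - 2)"
  \<comment> \<open>The two summands are the powers of \<open>s\<close> that arise below: 2 from
    Chebyshev's inequality and \<open>4 / m\<close> from \<open>r\<^sup>2\<close>.\<close>
  have a: "a = 2 + 4 / m" using m by (simp add: a_def dm field_simps)
  define K where "K = G * ?d\<^sup>2 * A powr (2 / m) * 2 powr a"
  show "K \<ge> 0" using G by (simp add: K_def)
  fix w :: "'a \<Rightarrow> real" and q \<gamma> t :: real
  assume w: "translation_bound G w" and q: "q > 1" and \<gamma>: "0 \<le> \<gamma>" "\<gamma> < DIM('a)" and fin: "weighted_integral q \<gamma> w < \<infinity>" and t: "t > 0"
  have loc: "loc_int w" using w by (rule translation_bound_loc_int)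
  note [measurable] = loc_int_measurable[OF loc]
  define s where "s = t / 2"
  have s: "s > 0" using t by (simp add: s_def)
  define r where "r = (A / s\<^sup>2) powr (1 / m)"
  have r: "r > 0" using A s by (simp add: r_def)
  have rm: "r powr m = A / s\<^sup>2" using m A s by (simp add: r_def powr_powr)
  have rd: "r ^ DIM('a) = A / s\<^sup>2 * r\<^sup>2"
  proof -
    have "r ^ DIM('a) = r powr (m + 2)" using r dm powr_realpow[of r "DIM('a)"] by simp
    also have "\<dots> = r powr m * r powr 2" by (rule powr_add)
    finally show ?thesis using r rm by simp
  qed
  have "(12 * r * ?d * sqrt (G / r ^ DIM('a)))\<^sup>2 = s\<^sup>2"
    using r G s A unfolding rd by (simp add: power_mult_distrib A_def field_simps)
  then have eq: "12 * r * ?d * sqrt (G / r ^ DIM('a)) = s"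
    using r G s by (subst (asm) power2_eq_iff_nonneg) auto
  have bd: "\<bar>cube_average r w x\<bar> \<le> s" for x
    using cube_average_le_if_tendsto_0[OF w r _ d cube_average_tendsto_0[OF loc r q \<gamma> fin]] G unfolding eq by simp
  \<comment> \<open>The average uses up at most half of the level, so the other half must come from
    the deviation, which is small in \<open>L2\<close>.\<close>
  have "{x. \<bar>w x\<bar> > t} \<subseteq> {x \<in> UNIV. 1 \<le> ennreal (1 / s\<^sup>2) * ennreal ((cube_average r w x - w x)\<^sup>2)}"
  proof safe
    fix x assume "\<bar>w x\<bar> > t"
    then have "s \<le> \<bar>cube_average r w x - w x\<bar>" using bd[of x] unfolding s_def by arith
    then have "s\<^sup>2 \<le> (cube_average r w x - w x)\<^sup>2" using s by (metis abs_le_square_iff abs_of_pos)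
    then have "1 \<le> 1 / s\<^sup>2 * (cube_average r w x - w x)\<^sup>2" using s by (simp add: field_simps)
    then show "1 \<le> ennreal (1 / s\<^sup>2) * ennreal ((cube_average r w x - w x)\<^sup>2)"
      by (simp flip: ennreal_mult ennreal_1 del: ennreal_1)
  qed simp
  then have "emeasure lborel {x. \<bar>w x\<bar> > t} \<le> emeasure lborel {x \<in> UNIV. 1 \<le> ennreal (1 / s\<^sup>2) * ennreal ((cube_average r w x - w x)\<^sup>2)}"
    by (intro emeasure_mono) auto
  also have "\<dots> \<le> ennreal (1 / s\<^sup>2) * (\<integral>\<^sup>+x. ennreal ((cube_average r w x - w x)\<^sup>2) * indicator UNIV x \<partial>lborel)"
    by (rule nn_integral_Markov_inequality) auto
  also have "\<dots> \<le> ennreal (1 / s\<^sup>2) * ennreal (G * (r * ?d)\<^sup>2)"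
    using nn_integral_cube_average_diff_le[OF w r] G by (intro mult_left_mono) auto
  also have "\<dots> = ennreal (1 / s\<^sup>2 * (G * (r * ?d)\<^sup>2))"
    using G by (simp flip: ennreal_mult)
  also have "1 / s\<^sup>2 * (G * (r * ?d)\<^sup>2) = K * t powr - a"
  proof -
    have "r\<^sup>2 = r powr 2" using r by simp
    also have "\<dots> = (A / s\<^sup>2) powr (2 / m)" by (simp add: r_def powr_powr)
    also have "\<dots> = A powr (2 / m) / (s powr 2) powr (2 / m)" using A s by (simp add: powr_divide)
    also have "(s powr 2) powr (2 / m) = s powr (4 / m)" by (simp add: powr_powr)
    finally have "1 / s\<^sup>2 * (G * (r * ?d)\<^sup>2) = G * ?d\<^sup>2 * A powr (2 / m) / (s powr 2 * s powr (4 / m))"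
      using s by (simp add: power_mult_distrib)
    also have "s powr 2 * s powr (4 / m) = s powr a" by (simp add: a powr_add)
    also have "s powr a = t powr a / 2 powr a" using t by (simp add: s_def powr_divide)
    finally show ?thesis by (simp add: K_def powr_minus field_simps)
  qed
  finally show "emeasure lborel {x. \<bar>w x\<bar> > t} \<le> ennreal (K * t powr (- (2 * real DIM('a) / (real DIM('a) - 2))))"
    by (simp add: a_def)
qed

section \<open>Integrals of powers from weak-type bounds\<close>

text \<open>Dyadic decomposition of the range: the level \<open>2 ^ k * \<delta>\<close> contributes
  a term of a geometric series with ratio \<open>2 powr (q - a)\<close>, which is below 1. Whole
  superlevel sets are used instead of dyadic shells, since these are the sets whose measure is
  known. The bound \<open>B\<close> is uniform in \<open>f\<close>.\<close>

lemma nn_integral_superlevel_powr_le: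
  assumes K: "K \<ge> 0" and q: "0 < q" "q < a" and \<delta>: "\<delta> > 0"
  obtains B where "B \<ge> 0"
    "\<And>f :: 'a::euclidean_space \<Rightarrow> real. f \<in> borel_measurable borel \<Longrightarrow>
      (\<And>t. t > 0 \<Longrightarrow> emeasure lborel {x. f x > t} \<le> ennreal (K * t powr (- a))) \<Longrightarrow>
      (\<integral>\<^sup>+x. indicator {x. f x > \<delta>} x * ennreal (f x powr q) \<partial>lborel) \<le> ennreal B"
proof
  define \<rho> where "\<rho> = 2 powr (q - a)"
  have "\<rho> < 2 powr 0" unfolding \<rho>_def using q by (intro powr_less_mono) auto
  then have \<rho>: "0 < \<rho>" "\<rho> < 1" by (simp_all add: \<rho>_def)
  define B where "B = (2 * \<delta>) powr q * K * \<delta> powr (- a) * (1 / (1 - \<rho>))"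
  show "B \<ge> 0" using \<rho> K by (simp add: B_def)
  fix f :: "'a \<Rightarrow> real"
  assume [measurable]: "f \<in> borel_measurable borel"
    and f: "\<And>t. t > 0 \<Longrightarrow> emeasure lborel {x. f x > t} \<le> ennreal (K * t powr (- a))"
  define c where "c k = (2 ^ Suc k * \<delta>) powr q" for k :: nat
  have "(\<integral>\<^sup>+x. indicator {x. f x > \<delta>} x * ennreal (f x powr q) \<partial>lborel)
      \<le> (\<integral>\<^sup>+x. (\<Sum>k. ennreal (c k) * indicator {x. f x > 2 ^ k * \<delta>} x) \<partial>lborel)"
  proof (rule nn_integral_mono)
    fix x
    show "indicator {x. f x > \<delta>} x * ennreal (f x powr q) \<le> (\<Sum>k. ennreal (c k) * indicator {x. f x > 2 ^ k * \<delta>} x)"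
    proof (cases "f x > \<delta>")
      case True
      obtain n where n: "f x / \<delta> < 2 ^ n" using real_arch_pow[of 2] by auto
      \<comment> \<open>Since \<open>f x\<close> exceeds \<delta>, this index is not 0, and its
        predecessor \<open>k\<close> satisfies
        \<open>2 ^ k * \<delta> < f x \<le> 2 ^ Suc k * \<delta>\<close>; that single term of the
        series dominates.\<close>
      define N where "N = (LEAST n. f x \<le> 2 ^ n * \<delta>)"
      have ex: "f x \<le> 2 ^ n * \<delta>" using n \<delta> by (simp add: field_simps)
      have N: "f x \<le> 2 ^ N * \<delta>" unfolding N_def using ex by (rule LeastI)
      with True \<delta> have "N \<noteq> 0" by (cases N) auto
      then obtain k where k: "N = Suc k" by (cases N) auto
      have gt: "f x > 2 ^ k * \<delta>"
        using not_less_Least[of k "\<lambda>n. f x \<le> 2 ^ n * \<delta>"] k by (simp add: N_def)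
      define F where "F = (\<lambda>k. ennreal (c k) * indicator {x. f x > 2 ^ k * \<delta>} x)"
      have "ennreal (f x powr q) \<le> F k"
        unfolding F_def using gt N True \<delta> q k by (auto simp: c_def intro!: ennreal_leI powr_mono2)
      also have "\<dots> \<le> (\<Sum>k. F k)"
        using sum_le_suminf[of F "{k}"] by simp
      finally show ?thesis using True by (simp add: F_def)
    qed simp
  qed
  also have "\<dots> = (\<Sum>k. \<integral>\<^sup>+x. ennreal (c k) * indicator {x. f x > 2 ^ k * \<delta>} x \<partial>lborel)"
    by (rule nn_integral_suminf) measurable
  also have "\<dots> \<le> (\<Sum>k. ennreal ((2 * \<delta>) powr q * K * \<delta> powr (- a) * \<rho> ^ k))"
  proof (rule suminf_le)
    fix k
    have "(\<integral>\<^sup>+x. ennreal (c k) * indicator {x. f x > 2 ^ k * \<delta>} x \<partial>lborel) = ennreal (c k) * emeasure lborel {x. f x > 2 ^ k * \<delta>}"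
      by (rule nn_integral_cmult_indicator) measurable
    also have "\<dots> \<le> ennreal (c k) * ennreal (K * (2 ^ k * \<delta>) powr (- a))"
      using \<delta> by (intro mult_left_mono f) auto
    also have "\<dots> = ennreal (c k * (K * (2 ^ k * \<delta>) powr (- a)))"
      using K by (simp add: ennreal_mult c_def)
    also have "c k * (K * (2 ^ k * \<delta>) powr (- a)) = (2 * \<delta>) powr q * K * \<delta> powr (- a) * \<rho> ^ k"
    proof -
      have "(2 ^ Suc k * \<delta>) powr q = (2 * \<delta>) powr q * (2 ^ k) powr q"
        using \<delta> by (subst powr_mult[symmetric]) (auto simp: mult_ac)
      moreover have "(2 ^ k * \<delta>) powr (- a) = (2 ^ k) powr (- a) * \<delta> powr (- a)"
        by (rule powr_mult)
      moreover have "(2 ^ k) powr q * (2 ^ k) powr (- a) = \<rho> ^ k"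
        by (simp add: \<rho>_def powr_powr algebra_simps flip: powr_add powr_realpow)
      ultimately show ?thesis by (simp add: c_def mult_ac)
    qed
    finally show "(\<integral>\<^sup>+x. ennreal (c k) * indicator {x. f x > 2 ^ k * \<delta>} x \<partial>lborel) \<le> ennreal ((2 * \<delta>) powr q * K * \<delta> powr (- a) * \<rho> ^ k)" .
  qed auto
  also have "\<dots> = ennreal (\<Sum>k. (2 * \<delta>) powr q * K * \<delta> powr (- a) * \<rho> ^ k)"
    using K \<rho> by (intro suminf_ennreal2 summable_mult summable_geometric) auto
  also have "(\<Sum>k. (2 * \<delta>) powr q * K * \<delta> powr (- a) * \<rho> ^ k) = B"
    using \<rho> by (simp add: B_def suminf_mult summable_geometric suminf_geometric)
  finally show "(\<integral>\<^sup>+x. indicator {x. f x > \<delta>} x * ennreal (f x powr q) \<partial>lborel) \<le> ennreal B" .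
qed

text \<open>The superlevel set of \<open>1 / norm x\<close> at level \<open>t\<close> lies in a cube
  of side \<open>2 / t\<close>. This is a weak-type bound with exponent equal to the dimension, and
  the dyadic estimate gives all smaller powers without polar coordinates.\<close>

lemma nn_integral_cball_norm_powr_finite:
  fixes \<beta> R :: real
  assumes \<beta>: "0 < \<beta>" "\<beta> < DIM('a::euclidean_space)" and R: "R > 0"
  shows "(\<integral>\<^sup>+x. indicator (cball (0::'a) R) x * ennreal (norm x powr (- \<beta>)) \<partial>lborel) < \<infinity>"
proof -
  let ?d = "real DIM('a)"
  \<comment> \<open>The level is \<open>1 / (2 * R)\<close> rather than \<open>1 / R\<close>, so
    that the strict superlevel set covers the closed ball, apart from the origin.\<close>
  obtain B where B: "B \<ge> 0" "\<And>f :: 'a \<Rightarrow> real. f \<in> borel_measurable borel \<Longrightarrow>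
      (\<And>t. t > 0 \<Longrightarrow> emeasure lborel {x. f x > t} \<le> ennreal (2 ^ DIM('a) * t powr (- ?d))) \<Longrightarrow>
      (\<integral>\<^sup>+x. indicator {x. f x > 1 / (2 * R)} x * ennreal (f x powr \<beta>) \<partial>lborel) \<le> ennreal B"
    using nn_integral_superlevel_powr_le[of "2 ^ DIM('a)" \<beta> ?d "1 / (2 * R)"] \<beta> R by auto
  have "emeasure lborel {x::'a. inverse (norm x) > t} \<le> ennreal (2 ^ DIM('a) * t powr (- ?d))" if t: "t > 0" for t
  proof -
    have "{x::'a. inverse (norm x) > t} \<subseteq> cbox (- ((1 / t) *\<^sub>R One)) ((1 / t) *\<^sub>R One)"
    proof safe
      fix x :: 'a assume x: "inverse (norm x) > t"
      then have "x \<noteq> 0" using t by auto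
      with x t have "norm x \<le> 1 / t" by (simp add: field_simps)
      then show "x \<in> cbox (- ((1 / t) *\<^sub>R One)) ((1 / t) *\<^sub>R One)"
        using Basis_le_norm[of _ x] by (fastforce simp: mem_box abs_le_iff intro: order_trans)
    qed
    then have "emeasure lborel {x::'a. inverse (norm x) > t} \<le> emeasure lborel (cbox (- ((1 / t) *\<^sub>R One)) ((1 / t) *\<^sub>R One) :: 'a set)"
      by (intro emeasure_mono) auto
    also have "\<dots> = ennreal (2 ^ DIM('a) * t powr (- ?d))"
    proof -
      have "(\<Prod>b\<in>(Basis::'a set). ((1 / t) *\<^sub>R One - - ((1 / t) *\<^sub>R One)) \<bullet> b) = (\<Prod>b\<in>(Basis::'a set). 2 / t)"
        by (intro prod.cong) (simp_all add: inner_diff_left inner_add_left field_simps)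
      then show ?thesis
        using t by (subst emeasure_lborel_cbox) (simp_all add: powr_minus powr_realpow power_divide divide_inverse power_inverse)
    qed
    finally show ?thesis .
  qed
  then have "(\<integral>\<^sup>+x. indicator {x. inverse (norm x) > 1 / (2 * R)} x * ennreal (inverse (norm x) powr \<beta>) \<partial>(lborel :: 'a measure)) \<le> ennreal B"
    by (intro B(2)) auto
  moreover have "(\<integral>\<^sup>+x. indicator (cball (0::'a) R) x * ennreal (norm x powr (- \<beta>)) \<partial>lborel)
      \<le> (\<integral>\<^sup>+x. indicator {x. inverse (norm x) > 1 / (2 * R)} x * ennreal (inverse (norm x) powr \<beta>) \<partial>(lborel :: 'a measure))"
  proof (rule nn_integral_mono)
    fix x :: 'a
    show "indicator (cball 0 R) x * ennreal (norm x powr (- \<beta>)) \<le> indicator {x. inverse (norm x) > 1 / (2 * R)} x * ennreal (inverse (norm x) powr \<beta>)"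
    proof (cases "x = 0 \<or> x \<notin> cball 0 R")
      case False
      then have "inverse (norm x) > 1 / (2 * R)" using R by (auto simp: field_simps)
      with False show ?thesis by (simp add: powr_minus inverse_powr)
    qed auto
  qed
  ultimately show ?thesis by (simp add: le_less_trans order_trans)
qed

subsection \<open>Compactness\<close>

lemma tendsto_ennreal_0I:
  fixes f :: "nat \<Rightarrow> ennreal"
  assumes "\<And>e::real. e > 0 \<Longrightarrow> \<forall>\<^sub>F n in sequentially. f n \<le> ennreal e"
  shows "f \<longlonglongrightarrow> 0"
proof (rule order_tendstoI)
  fix a :: ennreal assume "0 < a"
  then obtain b where b: "0 < b" "b < a" using dense by blast
  then have "b \<noteq> top" by auto
  with b(1) obtain e where e: "b = ennreal e" "e > 0"
    by (cases b) auto
  from assms[OF e(2)] show "\<forall>\<^sub>F n in sequentially. f n < a"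
    by eventually_elim (use b e in auto)
qed simp

lemma nn_integral_linear_combination4:
  fixes f1 f2 f3 f4 :: "'a \<Rightarrow> ennreal"
  assumes [measurable]: "f1 \<in> borel_measurable M" "f2 \<in> borel_measurable M" "f3 \<in> borel_measurable M" "f4 \<in> borel_measurable M"
  shows "(\<integral>\<^sup>+x. c1 * f1 x + c2 * f2 x + c3 * f3 x + c4 * f4 x \<partial>M)
    = c1 * (\<integral>\<^sup>+x. f1 x \<partial>M) + c2 * (\<integral>\<^sup>+x. f2 x \<partial>M) + c3 * (\<integral>\<^sup>+x. f3 x \<partial>M) + c4 * (\<integral>\<^sup>+x. f4 x \<partial>M)"
  by (simp add: nn_integral_add nn_integral_cmult)

text \<open>Each of four contributions receives \<open>e / 4\<close>: small values through the
  energy, large values far out through the decay of the weight, and large values near the origin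
  through two terms, one small by the choice of \<epsilon> and one by dominated convergence. The
  threshold \<delta> comes first, since the bounds \<open>B\<close> and \<open>B'\<close> on
  superlevel sets depend on it; \<open>R\<close> and \<epsilon> follow.\<close>

lemma weighted_integral_tendsto_0:
  fixes u :: "nat \<Rightarrow> 'a::euclidean_space \<Rightarrow> real" and p \<gamma> G C :: real
  assumes d: "DIM('a) \<ge> 3" and \<gamma>: "0 < \<gamma>" "\<gamma> < DIM('a)" and p: "1 < p" "p < (DIM('a) - \<gamma>) / (real DIM('a) - 2)"
    and G: "G > 0" and T: "\<And>k. translation_bound G (u k)"
    and C: "C \<ge> 0" "\<And>k. weighted_integral (p + 1) \<gamma> (u k) \<le> ennreal C"
    and lim: "AE x in lborel. (\<lambda>k. u k x) \<longlonglongrightarrow> 0"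
  shows "(\<lambda>k. weighted_integral (2 * p) \<gamma> (u k)) \<longlonglongrightarrow> 0"
proof (rule tendsto_ennreal_0I)
  fix e :: real assume e: "e > 0"
  define d where "d = real DIM('a)"
  have d2: "d > 2" using assms(1) by (simp add: d_def)
  define a where "a = 2 * d / (d - 2)"
  have p': "p * (d - 2) < d - \<gamma>" using p(2) d2 by (simp add: d_def field_simps)
  have dg: "d - \<gamma> > 0" using \<gamma> by (simp add: d_def)
  have "2 * p * d / (d - \<gamma>) < a"
  proof -
    have "2 * p * d * (d - 2) < 2 * d * (d - \<gamma>)" using p' d2 by simp
    then show ?thesis using dg d2 by (simp add: a_def field_simps)
  qed
  \<comment> \<open>Near the origin \<open>|u|\<^bsup>2p\<^esup> |x|\<^bsup>-\<gamma>\<^esup>\<close> is split by Young's inequality into \<open>|u|\<^sup>q\<close> and \<open>|x|\<^bsup>-\<beta>\<^esup>\<close>;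
    subcriticality of \<open>p\<close> is what leaves room for \<open>q < a\<close> with \<open>\<beta> < d\<close>.\<close>
  then obtain q where q: "2 * p * d / (d - \<gamma>) < q" "q < a" using dense by blast
  have "2 * p * 1 < 2 * p * (d / (d - \<gamma>))"
    using p \<gamma> dg by (intro mult_strict_left_mono) (auto simp: field_simps)
  then have qp: "2 * p < q" using q(1) by simp
  \<comment> \<open>Young's inequality with exponents \<open>q / (2 * p)\<close> and
    \<open>q / (q - 2 * p)\<close> turns the weight into \<open>norm x powr (- \<beta>)\<close>. The
    lower bound imposed on \<open>q\<close> is equivalent to \<beta> being smaller than the
    dimension.\<close>
  define \<beta> where "\<beta> = \<gamma> * q / (q - 2 * p)"
  have "\<gamma> * q < d * (q - 2 * p)" using q(1) dg by (simp add: field_simps)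
  then have \<beta>: "0 < \<beta>" "\<beta> < DIM('a)" using qp \<gamma> p by (auto simp: \<beta>_def d_def field_simps)
  note [measurable] = T[THEN translation_bound_loc_int, THEN loc_int_measurable]
  obtain K where K: "K \<ge> 0"
    "\<And>(w :: 'a \<Rightarrow> real) (q::real) (\<gamma>::real) (t::real). translation_bound G w \<Longrightarrow> q > 1 \<Longrightarrow> 0 \<le> \<gamma> \<Longrightarrow> \<gamma> < DIM('a) \<Longrightarrow> weighted_integral q \<gamma> w < \<infinity> \<Longrightarrow> t > 0 \<Longrightarrow>
      emeasure lborel {x. \<bar>w x\<bar> > t} \<le> ennreal (K * t powr (- a))"
    using weak_Sobolev[OF assms(1) G] unfolding a_def d_def by blast
  have level: "emeasure lborel {x. \<bar>u k x\<bar> > t} \<le> ennreal (K * t powr (- a))" if "t > 0" for k t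
    using K(2)[OF T, of "p + 1" \<gamma> k t] p \<gamma> that C(2)[of k] by (auto simp: le_less_trans)
  \<comment> \<open>Chosen so that \<open>\<delta> powr (p - 1) * C\<close> is at most
    \<open>e / 4\<close>; \<open>C + 1\<close> keeps the denominator positive. The choices of
    \<open>R\<close> and \<epsilon> follow the same pattern.\<close>
  define \<delta> where "\<delta> = (e / (4 * (C + 1))) powr (1 / (p - 1))"
  have \<delta>: "\<delta> > 0" using e C by (simp add: \<delta>_def)
  have "\<delta> powr (p - 1) = e / (4 * (C + 1))" using p e C by (simp add: \<delta>_def powr_powr)
  moreover have "e / (4 * (C + 1)) * C \<le> e / 4" using e C(1) by (simp add: field_simps)
  ultimately have \<delta>C: "\<delta> powr (p - 1) * C \<le> e / 4" by simp
  obtain B where B: "B \<ge> 0" "\<And>k. (\<integral>\<^sup>+x. indicator {x. \<bar>u k x\<bar> > \<delta>} x * ennreal (\<bar>u k x\<bar> powr (2 * p)) \<partial>lborel) \<le> ennreal B"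
  proof (rule nn_integral_superlevel_powr_le[OF K(1) _ _ \<delta>, where 'a = 'a and q = "2 * p" and a = a])
    fix B assume B: "B \<ge> 0"
      "\<And>f :: 'a \<Rightarrow> real. f \<in> borel_measurable borel \<Longrightarrow>
        (\<And>t. t > 0 \<Longrightarrow> emeasure lborel {x. f x > t} \<le> ennreal (K * t powr (- a))) \<Longrightarrow>
        (\<integral>\<^sup>+x. indicator {x. f x > \<delta>} x * ennreal (f x powr (2 * p)) \<partial>lborel) \<le> ennreal B"
    show thesis
      by (rule that[OF B(1)], rule B(2)) (use level in auto)
  qed (use p qp q in auto)
  obtain B' where B': "B' \<ge> 0" "\<And>k. (\<integral>\<^sup>+x. indicator {x. \<bar>u k x\<bar> > \<delta>} x * ennreal (\<bar>u k x\<bar> powr (q)) \<partial>lborel) \<le> ennreal B'"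
  proof (rule nn_integral_superlevel_powr_le[OF K(1) _ _ \<delta>, where 'a = 'a and q = "q" and a = a])
    fix B assume B: "B \<ge> 0"
      "\<And>f :: 'a \<Rightarrow> real. f \<in> borel_measurable borel \<Longrightarrow>
        (\<And>t. t > 0 \<Longrightarrow> emeasure lborel {x. f x > t} \<le> ennreal (K * t powr (- a))) \<Longrightarrow>
        (\<integral>\<^sup>+x. indicator {x. f x > \<delta>} x * ennreal (f x powr (q)) \<partial>lborel) \<le> ennreal B"
    show thesis
      by (rule that[OF B(1)], rule B(2)) (use level in auto)
  qed (use p qp q in auto)
  define R where "R = (4 * (B + 1) / e) powr (1 / \<gamma>)"
  have R: "R > 0" using B e by (simp add: R_def)
  have "R powr \<gamma> = 4 * (B + 1) / e" using \<gamma> B e by (simp add: R_def powr_powr)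
  then have "R powr (- \<gamma>) = e / (4 * (B + 1))" by (simp add: powr_minus)
  moreover have "e / (4 * (B + 1)) * B \<le> e / 4" using e B(1) by (simp add: field_simps)
  ultimately have RB: "R powr (- \<gamma>) * B \<le> e / 4" by simp
  define \<epsilon> where "\<epsilon> = e / (4 * (B' + 1))"
  have \<epsilon>: "\<epsilon> > 0" using e B' by (simp add: \<epsilon>_def)
  have \<epsilon>B: "\<epsilon> * B' \<le> e / 4" using e B'(1) by (simp add: \<epsilon>_def field_simps)
  define C' where "C' = \<epsilon> powr (- (2 * p / (q - 2 * p)))"
  \<comment> \<open>The first indicator is eventually 0 wherever \<open>u k\<close> tends to 0,
    while the rest is an integrable majorant not depending on \<open>k\<close>.\<close>
  define h where "h k x = indicator {x. \<bar>u k x\<bar> > \<delta>} x * (indicator (cball 0 R) x * ennreal (norm x powr (- \<beta>)))" for k and x :: 'a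
  have cb [measurable]: "cball (0::'a) R \<in> sets borel" by simp
  have [measurable]: "h k \<in> borel_measurable borel" for k
    unfolding h_def[abs_def] by measurable
  have h0: "(\<lambda>k. \<integral>\<^sup>+x. h k x \<partial>lborel) \<longlonglongrightarrow> (\<integral>\<^sup>+x. 0 \<partial>(lborel :: 'a measure))"
  proof (rule nn_integral_dominated_convergence)
    show "AE x in lborel. h k x \<le> indicator (cball 0 R) x * ennreal (norm x powr (- \<beta>))" for k
      unfolding h_def by (intro AE_I2) (auto simp: indicator_def)
    show "(\<integral>\<^sup>+x. indicator (cball (0::'a) R) x * ennreal (norm x powr (- \<beta>)) \<partial>lborel) < \<infinity>"
      by (rule nn_integral_cball_norm_powr_finite[OF \<beta> R])
    show "AE x in lborel. (\<lambda>k. h k x) \<longlonglongrightarrow> 0"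
      using lim
    proof eventually_elim
      case (elim x)
      have "\<forall>\<^sub>F k in sequentially. dist (u k x) 0 < \<delta>"
        by (rule tendstoD[OF elim \<delta>])
      then have "\<forall>\<^sub>F k in sequentially. h k x = 0"
        by eventually_elim (auto simp: h_def)
      then show ?case by (rule tendsto_eventually)
    qed
  qed (use cb in measurable)
  then have "(\<lambda>k. ennreal C' * (\<integral>\<^sup>+x. h k x \<partial>lborel)) \<longlonglongrightarrow> ennreal C' * 0"
    by (intro ennreal_tendsto_cmult) auto
  then have "\<forall>\<^sub>F k in sequentially. ennreal C' * (\<integral>\<^sup>+x. h k x \<partial>lborel) < ennreal (e / 4)"
    using e by (intro order_tendstoD(2)) auto
  then show "\<forall>\<^sub>F k in sequentially. weighted_integral (2 * p) \<gamma> (u k) \<le> ennreal e"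
  proof eventually_elim
    case (elim k)
    have pw: "ennreal (\<bar>u k x\<bar> powr (2 * p) * norm x powr (- \<gamma>))
      \<le> ennreal (\<delta> powr (p - 1)) * ennreal (\<bar>u k x\<bar> powr (p + 1) * norm x powr (- \<gamma>))
        + ennreal (R powr (- \<gamma>)) * (indicator {x. \<bar>u k x\<bar> > \<delta>} x * ennreal (\<bar>u k x\<bar> powr (2 * p)))
        + ennreal \<epsilon> * (indicator {x. \<bar>u k x\<bar> > \<delta>} x * ennreal (\<bar>u k x\<bar> powr q)) + ennreal C' * h k x"
      (is "?L \<le> ?A + ?B + ?C + ?D") for x
    proof -
      let ?t = "\<bar>u k x\<bar>"
      consider "x = 0" | "?t \<le> \<delta>" | "?t > \<delta>" "norm x > R" | "x \<noteq> 0" "?t > \<delta>" "norm x \<le> R" by linarith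
      then show ?thesis
      proof cases
        case 1
        then show ?thesis by simp
      next
        case 2
        have "?t powr (2 * p) = ?t powr (p - 1) * ?t powr (p + 1)" by (simp flip: powr_add)
        also have "\<dots> \<le> \<delta> powr (p - 1) * ?t powr (p + 1)"
          using 2 p by (intro mult_right_mono powr_mono2) auto
        finally have "?t powr (2 * p) * norm x powr (- \<gamma>) \<le> \<delta> powr (p - 1) * ?t powr (p + 1) * norm x powr (- \<gamma>)"
          by (intro mult_right_mono) auto
        then have "?L \<le> ?A" by (simp add: mult.assoc ennreal_leI flip: ennreal_mult)
        then show ?thesis by (simp add: add_increasing2)
      next
        case 3
        have "norm x powr (- \<gamma>) \<le> R powr (- \<gamma>)" using 3 R \<gamma> by (intro powr_mono2') auto
        then have "?t powr (2 * p) * norm x powr (- \<gamma>) \<le> R powr (- \<gamma>) * ?t powr (2 * p)"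
          by (simp add: mult.commute mult_right_mono)
        then have "?L \<le> ?B" using 3 by (simp add: ennreal_leI flip: ennreal_mult)
        then show ?thesis by (simp add: add_increasing2 add_increasing)
      next
        case 4
        then have t0: "?t > 0" and x0: "norm x > 0" using \<delta> by auto
        show ?thesis
        \<comment> \<open>Young's inequality by comparing the two factors: either the weight is at
          most \<open>\<epsilon> * ?t powr (q - 2 * p)\<close>, or else this bounds
          \<open>?t\<close> by a power of the weight.\<close>
        proof (cases "norm x powr (- \<gamma>) \<le> \<epsilon> * ?t powr (q - 2 * p)")
          case True
          then have "?t powr (2 * p) * norm x powr (- \<gamma>) \<le> ?t powr (2 * p) * (\<epsilon> * ?t powr (q - 2 * p))"
            by (intro mult_left_mono) auto
          also have "\<dots> = \<epsilon> * (?t powr (2 * p) * ?t powr (q - 2 * p))" by simp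
          also have "\<dots> = \<epsilon> * ?t powr q" by (simp flip: powr_add)
          finally have "?L \<le> ?C" using 4 \<epsilon> by (simp add: ennreal_leI flip: ennreal_mult)
          then show ?thesis by (simp add: add_increasing2 add_increasing)
        next
          case False
          then have "?t powr (q - 2 * p) \<le> norm x powr (- \<gamma>) / \<epsilon>" using \<epsilon> by (simp add: field_simps)
          then have "(?t powr (q - 2 * p)) powr (2 * p / (q - 2 * p)) \<le> (norm x powr (- \<gamma>) / \<epsilon>) powr (2 * p / (q - 2 * p))"
            using qp p by (intro powr_mono2) auto
          then have "?t powr (2 * p) \<le> (norm x powr (- \<gamma>) / \<epsilon>) powr (2 * p / (q - 2 * p))"
            using qp by (simp add: powr_powr)
          also have "\<dots> = C' * norm x powr (- \<gamma> * (2 * p / (q - 2 * p)))"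
            using \<epsilon> by (simp add: C'_def powr_divide powr_powr powr_minus_divide[of \<epsilon>])
          finally have "?t powr (2 * p) * norm x powr (- \<gamma>) \<le> C' * norm x powr (- \<gamma> * (2 * p / (q - 2 * p))) * norm x powr (- \<gamma>)"
            by (intro mult_right_mono) auto
          also have "\<dots> = C' * norm x powr (- \<gamma> * (2 * p / (q - 2 * p)) + - \<gamma>)"
            by (simp only: powr_add mult.assoc)
          also have "- \<gamma> * (2 * p / (q - 2 * p)) + - \<gamma> = - \<beta>"
            using qp by (simp add: \<beta>_def field_simps)
          finally have "?L \<le> ?D" using 4 by (simp add: h_def C'_def ennreal_leI flip: ennreal_mult)
          then show ?thesis by (simp add: add_increasing)
        qed
      qed
    qed
    have "weighted_integral (2 * p) \<gamma> (u k) \<le> (\<integral>\<^sup>+x. ennreal (\<delta> powr (p - 1)) * ennreal (\<bar>u k x\<bar> powr (p + 1) * norm x powr (- \<gamma>))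
        + ennreal (R powr (- \<gamma>)) * (indicator {x. \<bar>u k x\<bar> > \<delta>} x * ennreal (\<bar>u k x\<bar> powr (2 * p)))
        + ennreal \<epsilon> * (indicator {x. \<bar>u k x\<bar> > \<delta>} x * ennreal (\<bar>u k x\<bar> powr q)) + ennreal C' * h k x \<partial>lborel)"
      unfolding weighted_integral_def by (intro nn_integral_mono pw)
    also have "\<dots> = ennreal (\<delta> powr (p - 1)) * weighted_integral (p + 1) \<gamma> (u k)
        + ennreal (R powr (- \<gamma>)) * (\<integral>\<^sup>+x. indicator {x. \<bar>u k x\<bar> > \<delta>} x * ennreal (\<bar>u k x\<bar> powr (2 * p)) \<partial>lborel)
        + ennreal \<epsilon> * (\<integral>\<^sup>+x. indicator {x. \<bar>u k x\<bar> > \<delta>} x * ennreal (\<bar>u k x\<bar> powr q) \<partial>lborel) + ennreal C' * (\<integral>\<^sup>+x. h k x \<partial>lborel)"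
      unfolding weighted_integral_def by (rule nn_integral_linear_combination4) measurable
    also have "\<dots> \<le> ennreal (\<delta> powr (p - 1)) * ennreal C + ennreal (R powr (- \<gamma>)) * ennreal B
        + ennreal \<epsilon> * ennreal B' + ennreal (e / 4)"
      using elim by (intro add_mono mult_left_mono C B B') auto
    also have "\<dots> = ennreal (\<delta> powr (p - 1) * C + R powr (- \<gamma>) * B + \<epsilon> * B' + e / 4)"
      using C B B' \<epsilon> e by (simp flip: ennreal_mult ennreal_plus)
    also have "\<dots> \<le> ennreal e"
      using \<delta>C RB \<epsilon>B by (intro ennreal_leI) linarith
    finally show ?case .
  qed
qed

section \<open>Almost everywhere convergent subsequences\<close>

text \<open>Extracts a rapidly Cauchy subsequence. With an integrable \<rho> the hypothesis is a
  form of Cauchy convergence in measure, the truncation making every integral finite; with \<rho>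
  equal to 1 it follows from Cauchy convergence in \<open>L2\<close>. Both cases occur.\<close>

lemma AE_convergent_subsequence:
  fixes f :: "nat \<Rightarrow> 'a::euclidean_space \<Rightarrow> 'b::euclidean_space"
  assumes [measurable]: "\<And>n. f n \<in> borel_measurable borel" "\<rho> \<in> borel_measurable borel"
    and \<rho>: "\<And>x. 0 < \<rho> x"
    and Cauchy: "\<And>e::real. e > 0 \<Longrightarrow> \<exists>N. \<forall>m\<ge>N. \<forall>n\<ge>N. (\<integral>\<^sup>+x. ennreal (min 1 ((norm (f m x - f n x))\<^sup>2) * \<rho> x) \<partial>lborel) \<le> ennreal e"
  obtains \<sigma> where "strict_mono (\<sigma> :: nat \<Rightarrow> nat)" "AE x in lborel. convergent (\<lambda>k. f (\<sigma> k) x)"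
proof -
  have "\<forall>k. \<exists>N. \<forall>m\<ge>N. \<forall>n\<ge>N. (\<integral>\<^sup>+x. ennreal (min 1 ((norm (f m x - f n x))\<^sup>2) * \<rho> x) \<partial>lborel) \<le> ennreal ((1/4) ^ k)"
    by (intro allI Cauchy) simp
  then obtain N where N: "\<And>k m n. m \<ge> N k \<Longrightarrow> n \<ge> N k \<Longrightarrow>
      (\<integral>\<^sup>+x. ennreal (min 1 ((norm (f m x - f n x))\<^sup>2) * \<rho> x) \<partial>lborel) \<le> ennreal ((1/4) ^ k)"
    by metis
  \<comment> \<open>The sum forces \<open>\<sigma> k \<ge> N k\<close>, and the summand
    \<open>k\<close> makes the sequence strictly increasing.\<close>
  define \<sigma> where "\<sigma> k = k + (\<Sum>i\<le>k. N i)" for k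
  have mono: "strict_mono \<sigma>" by (rule strict_mono_Suc_iff[THEN iffD2]) (simp add: \<sigma>_def)
  have \<sigma>N: "\<sigma> k \<ge> N k" for k
    using member_le_sum[of k "{..k}" N] by (simp add: \<sigma>_def)
  have \<sigma>N': "\<sigma> (Suc k) \<ge> N k" for k
    using member_le_sum[of k "{..Suc k}" N] by (simp add: \<sigma>_def)
  \<comment> \<open>The integrals are at most \<open>(1/4) ^ k\<close>, hence stay summable after
    multiplication by \<open>2 ^ k\<close>. Finiteness of the weighted sum at almost every point
    gives pointwise geometric decay.\<close>
  define D where "D k x = min 1 ((norm (f (\<sigma> (Suc k)) x - f (\<sigma> k) x))\<^sup>2) * \<rho> x" for k x
  have D0: "D k x \<ge> 0" for k x using \<rho>[of x] by (simp add: D_def)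
  have [measurable]: "D k \<in> borel_measurable borel" for k unfolding D_def[abs_def] by measurable
  have "(\<integral>\<^sup>+x. (\<Sum>k. ennreal (2 ^ k) * ennreal (D k x)) \<partial>lborel) = (\<Sum>k. \<integral>\<^sup>+x. ennreal (2 ^ k) * ennreal (D k x) \<partial>lborel)"
    by (rule nn_integral_suminf) measurable
  also have "\<dots> \<le> (\<Sum>k. ennreal ((1/2) ^ k))"
  proof (rule suminf_le)
    fix k
    have "(\<integral>\<^sup>+x. ennreal (2 ^ k) * ennreal (D k x) \<partial>lborel) = ennreal (2 ^ k) * (\<integral>\<^sup>+x. ennreal (D k x) \<partial>lborel)"
      by (rule nn_integral_cmult) measurable
    also have "\<dots> \<le> ennreal (2 ^ k) * ennreal ((1/4) ^ k)"
      unfolding D_def by (intro mult_left_mono N \<sigma>N \<sigma>N') auto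
    also have "\<dots> = ennreal ((1/2) ^ k)"
      by (simp flip: ennreal_mult power_mult_distrib)
    finally show "(\<integral>\<^sup>+x. ennreal (2 ^ k) * ennreal (D k x) \<partial>lborel) \<le> ennreal ((1/2) ^ k)" .
  qed auto
  also have "\<dots> = ennreal (\<Sum>k. (1/2) ^ k)"
    by (rule suminf_ennreal2) (auto intro: summable_geometric)
  finally have "(\<integral>\<^sup>+x. (\<Sum>k. ennreal (2 ^ k) * ennreal (D k x)) \<partial>lborel) < \<infinity>"
    by (rule le_less_trans) simp
  then have "AE x in lborel. (\<Sum>k. ennreal (2 ^ k) * ennreal (D k x)) \<noteq> \<infinity>"
    by (intro nn_integral_PInf_AE) auto
  then have "AE x in lborel. convergent (\<lambda>k. f (\<sigma> k) x)"
  proof eventually_elim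
    case (elim x)
    define F where "F = (\<lambda>k. ennreal (2 ^ k) * ennreal (D k x))"
    obtain S where S: "(\<Sum>k. F k) = ennreal S" "S \<ge> 0"
      using elim unfolding F_def by (metis ennreal_cases infinity_ennreal_def)
    have DS: "D k x \<le> S * (1/2) ^ k" for k
    proof -
      have "F k \<le> (\<Sum>k. F k)" using sum_le_suminf[of F "{k}"] by simp
      moreover have "F k = ennreal (2 ^ k * D k x)" using D0 by (simp add: F_def ennreal_mult)
      ultimately have "2 ^ k * D k x \<le> S"
        unfolding S(1) using S(2) by (simp add: ennreal_le_iff)
      then show ?thesis by (simp add: field_simps)
    qed
    define c where "c = S / \<rho> x"
    have min_le: "min 1 ((norm (f (\<sigma> (Suc k)) x - f (\<sigma> k) x))\<^sup>2) \<le> c * (1/2) ^ k" for k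
      using DS[of k] \<rho>[of x] by (simp add: D_def c_def field_simps)
    \<comment> \<open>Once the bound is below 1 the truncation is inactive, and the increments are
      dominated by a geometric series of ratio \<open>sqrt (1/2)\<close>.\<close>
    have "(\<lambda>k. c * (1/2) ^ k) \<longlonglongrightarrow> c * 0" by (intro tendsto_intros) auto
    then have "\<forall>\<^sub>F k in sequentially. c * (1/2) ^ k < 1" by (intro order_tendstoD(2)) auto
    then have ev: "\<forall>\<^sub>F k in sequentially. norm (f (\<sigma> (Suc k)) x - f (\<sigma> k) x) \<le> sqrt c * (sqrt (1/2)) ^ k"
    proof eventually_elim
      case (elim k)
      then have "(norm (f (\<sigma> (Suc k)) x - f (\<sigma> k) x))\<^sup>2 \<le> c * (1/2) ^ k"
        using min_le[of k] by linarith
      then have "norm (f (\<sigma> (Suc k)) x - f (\<sigma> k) x) \<le> sqrt (c * (1/2) ^ k)" by (rule real_le_rsqrt)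
      then show ?case by (simp add: real_sqrt_mult real_sqrt_power)
    qed
    have "summable (\<lambda>k. sqrt c * (sqrt (1/2)) ^ k)"
      by (intro summable_mult summable_geometric) (auto simp: real_sqrt_divide)
    then have "summable (\<lambda>k. f (\<sigma> (Suc k)) x - f (\<sigma> k) x)"
      using ev by (rule summable_comparison_test_ev[rotated])
    then have "convergent (\<lambda>n. f (\<sigma> 0) x + (\<Sum>k<n. f (\<sigma> (Suc k)) x - f (\<sigma> k) x))"
      by (intro convergent_add convergent_const) (simp add: summable_iff_convergent)
    then show ?case by (simp add: sum_lessThan_telescope[of "\<lambda>k. f (\<sigma> k) x"])
  qed
  with mono show thesis by (rule that)
qed

text \<open>The equicontinuity argument of Arzela and Ascoli: a nearby point of the dense set
  changes all values by at most \<open>e / 4\<close>.\<close>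

lemma convergent_if_Lipschitz_dense:
  fixes f :: "nat \<Rightarrow> 'a::euclidean_space \<Rightarrow> real"
  assumes Lip: "\<And>n x h. \<bar>f n (x + h) - f n x\<bar> \<le> L * norm h" and L: "L \<ge> 0"
    and dense: "\<And>X :: 'a set. open X \<Longrightarrow> X \<noteq> {} \<Longrightarrow> \<exists>y\<in>D. y \<in> X"
    and conv: "\<And>y. y \<in> D \<Longrightarrow> convergent (\<lambda>n. f n y)"
  shows "convergent (\<lambda>n. f n x)"
proof -
  have "Cauchy (\<lambda>n. f n x)"
  proof (rule metric_CauchyI)
    fix e :: real assume e: "e > 0"
    define r where "r = e / (4 * (L + 1))"
    have r: "r > 0" using e L by (simp add: r_def)
    have "L * r \<le> e / 4" using e L by (simp add: r_def field_simps)
    obtain y where y: "y \<in> D" "y \<in> ball x r" using dense[of "ball x r"] r by auto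
    have *: "\<bar>f n x - f n y\<bar> \<le> e / 4" for n
    proof -
      have "\<bar>f n x - f n y\<bar> \<le> L * norm (x - y)" using Lip[of n y "x - y"] by simp
      also have "\<dots> \<le> L * r" using y L by (intro mult_left_mono) (auto simp: dist_norm)
      finally show ?thesis using \<open>L * r \<le> e / 4\<close> by simp
    qed
    have "Cauchy (\<lambda>n. f n y)" "e / 4 > 0" using convergent_Cauchy[OF conv[OF y(1)]] e by simp_all
    from metric_CauchyD[OF this]
    obtain N where N: "\<And>m n. m \<ge> N \<Longrightarrow> n \<ge> N \<Longrightarrow> dist (f m y) (f n y) < e / 4" by blast
    have "dist (f m x) (f n x) < e" if "m \<ge> N" "n \<ge> N" for m n
      using N[OF that] *[of m] *[of n] e unfolding dist_real_def by linarith
    then show "\<exists>N. \<forall>m\<ge>N. \<forall>n\<ge>N. dist (f m x) (f n x) < e" by blast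
  qed
  then show ?thesis by (simp add: Cauchy_convergent_iff)
qed

text \<open>Made for a chain of four differences. The outer two are controlled in \<open>L2\<close>
  and stay untruncated; the inner two only converge pointwise and keep the truncation needed for
  dominated convergence.\<close>

lemma min_1_square_sum4_le:
  fixes a b c d :: real
  shows "min 1 ((a + b + c + d)\<^sup>2) \<le> 4 * (a\<^sup>2 + min 1 (b\<^sup>2) + min 1 (c\<^sup>2) + d\<^sup>2)"
proof -
  have "(a + b + c + d)\<^sup>2 \<le> 4 * (a\<^sup>2 + b\<^sup>2 + c\<^sup>2 + d\<^sup>2)"
  proof -
    have "4 * (a\<^sup>2 + b\<^sup>2 + c\<^sup>2 + d\<^sup>2) - (a + b + c + d)\<^sup>2
      = (a - b)\<^sup>2 + (a - c)\<^sup>2 + (a - d)\<^sup>2 + (b - c)\<^sup>2 + (b - d)\<^sup>2 + (c - d)\<^sup>2"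
      by (simp add: power2_eq_square algebra_simps)
    moreover have "\<dots> \<ge> 0" by simp
    ultimately show ?thesis by linarith
  qed
  moreover have "a\<^sup>2 \<ge> 0" "d\<^sup>2 \<ge> 0" "b\<^sup>2 \<ge> 0" "c\<^sup>2 \<ge> 0" by simp_all
  ultimately show ?thesis
    by (cases "1 \<le> b\<^sup>2"; cases "1 \<le> c\<^sup>2"; cases "1 \<le> (a + b + c + d)\<^sup>2"; simp add: min_def; linarith)
qed

text \<open>The averages at all scales \<open>1 / Suc k\<close> converge pointwise along one
  subsequence. They are uniformly close to the functions in \<open>L2\<close>, so the functions
  themselves are Cauchy in measure.\<close>

lemma Rellich:
  fixes w :: "nat \<Rightarrow> 'a::euclidean_space \<Rightarrow> real" and q \<gamma> G C :: real
  assumes G: "G \<ge> 0" and T: "\<And>n. translation_bound G (w n)" and q: "q > 1" and \<gamma>: "\<gamma> \<ge> 0"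
    and C: "C \<ge> 0" "\<And>n. weighted_integral q \<gamma> (w n) \<le> ennreal C"
  obtains \<sigma> where "strict_mono (\<sigma> :: nat \<Rightarrow> nat)" "AE x in lborel. convergent (\<lambda>k. w (\<sigma> k) x)"
proof -
  note loc = T[THEN translation_bound_loc_int]
  note [measurable] = loc[THEN loc_int_measurable]
  obtain D :: "'a set" where D: "countable D" "\<And>X. open X \<Longrightarrow> X \<noteq> {} \<Longrightarrow> \<exists>y\<in>D. y \<in> X"
    using countable_dense_setE by blast
  define r where "r k = 1 / real (Suc k)" for k
  have r: "r k > 0" for k by (simp add: r_def)
  \<comment> \<open>The bound on averages with threshold 1. It does not involve \<open>n\<close>,
    and division by it maps all averages into the interval from -1 to 1.\<close>
  define b where "b k x = 1 + 1 / r k ^ DIM('a) * ((norm x + r k * DIM('a)) powr \<gamma> * C)" for k and x :: 'a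
  have b: "b k x > 0" for k x using r[of k] C by (simp add: b_def add_pos_nonneg)
  have bd: "\<bar>cube_average (r k) (w n) x\<bar> \<le> b k x" for k n x
    using abs_cube_average_le_weighted_integral[OF loc r _ q \<gamma> C(2,1), of 1 k n x] by (simp add: b_def)
  \<comment> \<open>One diagonal argument over the countable set of pairs of a scale and a point of
    the dense set.\<close>
  obtain \<sigma> :: "nat \<Rightarrow> nat" where \<sigma>: "strict_mono \<sigma>"
    "\<And>z. z \<in> UNIV \<times> D \<Longrightarrow> \<exists>l. (\<lambda>n. (\<lambda>n (k, x). cube_average (r k) (w n) x / b k x) (\<sigma> n) z) \<longlonglongrightarrow> l"
  proof (rule function_convergent_subsequence[of "UNIV \<times> D" "\<lambda>n (k, x). cube_average (r k) (w n) x / b k x" 1])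
    show "countable ((UNIV :: nat set) \<times> D)" using D(1) by simp
    show "norm (case z of (k, x) \<Rightarrow> cube_average (r k) (w n) x / b k x) \<le> 1" for n and z :: "nat \<times> 'a"
      using bd b by (cases z) (simp add: divide_le_eq abs_of_pos)
  qed (use that in blast)
  define v where "v n = w (\<sigma> n)" for n
  have v_meas [measurable]: "v n \<in> borel_measurable borel" for n unfolding v_def by measurable
  have conv: "convergent (\<lambda>n. cube_average (r k) (v n) x)" for k x
  proof (rule convergent_if_Lipschitz_dense[OF _ _ D(2)])
    show "\<bar>cube_average (r k) (v n) (x + h) - cube_average (r k) (v n) x\<bar> \<le> sqrt (G / r k ^ DIM('a)) * norm h" for n x h
      unfolding v_def by (rule cube_average_shift_le[OF T r G])
    show "sqrt (G / r k ^ DIM('a)) \<ge> 0" using r[of k] G by simp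
    show "convergent (\<lambda>n. cube_average (r k) (v n) y)" if "y \<in> D" for y
    proof -
      obtain l where "(\<lambda>n. cube_average (r k) (w (\<sigma> n)) y / b k y) \<longlonglongrightarrow> l"
        using \<sigma>(2)[of "(k, y)"] \<open>y \<in> D\<close> by auto
      then have "(\<lambda>n. cube_average (r k) (w (\<sigma> n)) y / b k y * b k y) \<longlonglongrightarrow> l * b k y"
        by (intro tendsto_intros)
      then show ?thesis using b[of k y] by (auto simp: convergent_def v_def)
    qed
  qed
  define l where "l k x = lim (\<lambda>n. cube_average (r k) (v n) x)" for k x
  have l: "(\<lambda>n. cube_average (r k) (v n) x) \<longlonglongrightarrow> l k x" for k x
    using conv unfolding l_def by (simp add: convergent_LIMSEQ_iff)
  have [measurable]: "l k \<in> borel_measurable borel" for k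
    by (rule borel_measurable_LIMSEQ_real[OF l]) measurable
  \<comment> \<open>An integrable positive weight takes the place of an exhaustion by balls.\<close>
  obtain \<rho> :: "'a \<Rightarrow> real" where \<rho>_lborel: "\<rho> \<in> borel_measurable lborel"
    and \<rho>: "\<And>x. 0 < \<rho> x" "\<And>x. \<rho> x \<le> 1" "integrable lborel \<rho>"
    by (rule sigma_finite_measure.obtain_positive_integrable_function[OF sigma_finite_lborel]) blast
  have [measurable]: "\<rho> \<in> borel_measurable borel" using \<rho>_lborel by simp
  have \<rho>_fin: "(\<integral>\<^sup>+x. ennreal (\<rho> x) \<partial>lborel) < \<infinity>"
    using \<rho>(1,3) by (simp add: integrable_iff_bounded abs_of_pos)
  define E where "E k n = (\<integral>\<^sup>+x. ennreal (min 1 ((cube_average (r k) (v n) x - l k x)\<^sup>2) * \<rho> x) \<partial>lborel)" for k n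
  have E0: "E k \<longlonglongrightarrow> 0" for k
  proof -
    have "E k \<longlonglongrightarrow> (\<integral>\<^sup>+x. 0 \<partial>(lborel :: 'a measure))"
      unfolding E_def
    proof (rule nn_integral_dominated_convergence)
      show "AE x in lborel. ennreal (min 1 ((cube_average (r k) (v n) x - l k x)\<^sup>2) * \<rho> x) \<le> ennreal (\<rho> x)" for n
        using \<rho>(1) by (intro AE_I2 ennreal_leI mult_left_le_one_le) (auto simp: less_imp_le)
      show "(\<integral>\<^sup>+x. ennreal (\<rho> x) \<partial>lborel) < \<infinity>" by (rule \<rho>_fin)
      show "AE x in lborel. (\<lambda>n. ennreal (min 1 ((cube_average (r k) (v n) x - l k x)\<^sup>2) * \<rho> x)) \<longlonglongrightarrow> 0"
      proof (intro AE_I2)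
        fix x
        have "(\<lambda>n. min 1 ((cube_average (r k) (v n) x - l k x)\<^sup>2) * \<rho> x) \<longlonglongrightarrow> min 1 ((l k x - l k x)\<^sup>2) * \<rho> x"
          by (intro tendsto_intros l)
        then show "(\<lambda>n. ennreal (min 1 ((cube_average (r k) (v n) x - l k x)\<^sup>2) * \<rho> x)) \<longlonglongrightarrow> 0"
          by (intro tendsto_ennrealI[of _ 0, simplified]) simp
      qed
    qed measurable
    then show ?thesis by simp
  qed
  have J: "(\<integral>\<^sup>+x. ennreal (min 1 ((norm (v m x - v n x))\<^sup>2) * \<rho> x) \<partial>lborel)
      \<le> 4 * (ennreal (G * (r k * DIM('a))\<^sup>2) + E k m + E k n + ennreal (G * (r k * DIM('a))\<^sup>2))" for m n k
  proof -
    let ?A = "\<lambda>n x. ennreal ((cube_average (r k) (v n) x - v n x)\<^sup>2)"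
    have A: "(\<integral>\<^sup>+x. ?A n x \<partial>lborel) \<le> ennreal (G * (r k * DIM('a))\<^sup>2)" for n
      unfolding v_def by (rule nn_integral_cube_average_diff_le[OF T r G])
    have "(\<integral>\<^sup>+x. ennreal (min 1 ((norm (v m x - v n x))\<^sup>2) * \<rho> x) \<partial>lborel)
        \<le> (\<integral>\<^sup>+x. 4 * ?A m x + 4 * ennreal (min 1 ((cube_average (r k) (v m) x - l k x)\<^sup>2) * \<rho> x)
            + 4 * ennreal (min 1 ((cube_average (r k) (v n) x - l k x)\<^sup>2) * \<rho> x) + 4 * ?A n x \<partial>lborel)"
    proof (rule nn_integral_mono)
      fix x
      let ?a = "cube_average (r k) (v m) x - v m x" and ?b = "cube_average (r k) (v m) x - l k x"
        and ?c = "cube_average (r k) (v n) x - l k x" and ?d = "cube_average (r k) (v n) x - v n x"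
      have "min 1 ((norm (v m x - v n x))\<^sup>2) \<le> 4 * (?a\<^sup>2 + min 1 (?b\<^sup>2) + min 1 (?c\<^sup>2) + ?d\<^sup>2)"
      proof -
        have "- ?a + ?b + - ?c + ?d = v m x - v n x" by simp
        with min_1_square_sum4_le[of "- ?a" ?b "- ?c" ?d] show ?thesis
          by (simp only: real_norm_def power2_abs power2_minus)
      qed
      then have "min 1 ((norm (v m x - v n x))\<^sup>2) * \<rho> x \<le> 4 * (?a\<^sup>2 + min 1 (?b\<^sup>2) + min 1 (?c\<^sup>2) + ?d\<^sup>2) * \<rho> x"
        using \<rho>(1)[of x] by (intro mult_right_mono) auto
      also have "\<dots> = 4 * (?a\<^sup>2 * \<rho> x) + 4 * (min 1 (?b\<^sup>2) * \<rho> x) + 4 * (min 1 (?c\<^sup>2) * \<rho> x) + 4 * (?d\<^sup>2 * \<rho> x)"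
        by (simp add: algebra_simps)
      also have "\<dots> \<le> 4 * ?a\<^sup>2 + 4 * (min 1 (?b\<^sup>2) * \<rho> x) + 4 * (min 1 (?c\<^sup>2) * \<rho> x) + 4 * ?d\<^sup>2"
        using \<rho>(1,2)[of x] by (intro add_mono mult_left_mono mult_right_le_one_le) auto
      finally have *: "min 1 ((norm (v m x - v n x))\<^sup>2) * \<rho> x
          \<le> 4 * ?a\<^sup>2 + 4 * (min 1 (?b\<^sup>2) * \<rho> x) + 4 * (min 1 (?c\<^sup>2) * \<rho> x) + 4 * ?d\<^sup>2" .
      have "min 1 (?b\<^sup>2) * \<rho> x \<ge> 0" "min 1 (?c\<^sup>2) * \<rho> x \<ge> 0" using \<rho>(1)[of x] by auto
      then have "ennreal (4 * ?a\<^sup>2 + 4 * (min 1 (?b\<^sup>2) * \<rho> x) + 4 * (min 1 (?c\<^sup>2) * \<rho> x) + 4 * ?d\<^sup>2)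
        = 4 * ?A m x + 4 * ennreal (min 1 (?b\<^sup>2) * \<rho> x) + 4 * ennreal (min 1 (?c\<^sup>2) * \<rho> x) + 4 * ?A n x"
        by (simp add: ennreal_plus ennreal_mult)
      with ennreal_leI[OF *]
      show "ennreal (min 1 ((norm (v m x - v n x))\<^sup>2) * \<rho> x)
        \<le> 4 * ?A m x + 4 * ennreal (min 1 (?b\<^sup>2) * \<rho> x) + 4 * ennreal (min 1 (?c\<^sup>2) * \<rho> x) + 4 * ?A n x"
        by simp
    qed
    also have "\<dots> = 4 * (\<integral>\<^sup>+x. ?A m x \<partial>lborel) + 4 * E k m + 4 * E k n + 4 * (\<integral>\<^sup>+x. ?A n x \<partial>lborel)"
      unfolding E_def by (rule nn_integral_linear_combination4) measurable
    also have "\<dots> \<le> 4 * ennreal (G * (r k * DIM('a))\<^sup>2) + 4 * E k m + 4 * E k n + 4 * ennreal (G * (r k * DIM('a))\<^sup>2)"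
      by (intro add_mono mult_left_mono A) auto
    finally show ?thesis by (simp add: distrib_left)
  qed
  obtain \<tau> where \<tau>: "strict_mono (\<tau> :: nat \<Rightarrow> nat)" "AE x in lborel. convergent (\<lambda>k. v (\<tau> k) x)"
  proof (rule AE_convergent_subsequence[of v \<rho>])
    fix e :: real assume e: "e > 0"
    \<comment> \<open>The scale is fixed before \<open>N\<close>, because the convergence of the
      averages is not uniform in the scale. Four terms with a factor 4 explain
      \<open>e / 16\<close>.\<close>
    have "(\<lambda>k. G * (r k * DIM('a))\<^sup>2) \<longlonglongrightarrow> G * ((0::real) * real DIM('a))\<^sup>2"
      unfolding r_def by (intro tendsto_intros lim_inverse_n'[THEN LIMSEQ_Suc])
    then have "\<forall>\<^sub>F k in sequentially. G * (r k * DIM('a))\<^sup>2 < e / 16"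
      using e by (intro order_tendstoD(2)) auto
    then obtain k where k: "G * (r k * DIM('a))\<^sup>2 < e / 16"
      by (auto simp: eventually_sequentially)
    have "\<forall>\<^sub>F n in sequentially. E k n < ennreal (e / 16)"
      using E0[of k] e by (intro order_tendstoD(2)) auto
    then obtain N where N: "\<And>n. n \<ge> N \<Longrightarrow> E k n < ennreal (e / 16)"
      by (auto simp: eventually_sequentially)
    have "(\<integral>\<^sup>+x. ennreal (min 1 ((norm (v m x - v n x))\<^sup>2) * \<rho> x) \<partial>lborel) \<le> ennreal e" if "m \<ge> N" "n \<ge> N" for m n
    proof -
      have "(\<integral>\<^sup>+x. ennreal (min 1 ((norm (v m x - v n x))\<^sup>2) * \<rho> x) \<partial>lborel)
          \<le> 4 * (ennreal (G * (r k * DIM('a))\<^sup>2) + E k m + E k n + ennreal (G * (r k * DIM('a))\<^sup>2))"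
        by (rule J)
      also have "\<dots> \<le> 4 * (ennreal (e / 16) + ennreal (e / 16) + ennreal (e / 16) + ennreal (e / 16))"
        using N[OF that(1)] N[OF that(2)] k by (intro mult_left_mono add_mono) (auto intro: ennreal_leI)
      also have "\<dots> = ennreal (4 * (e / 16 + e / 16 + e / 16 + e / 16))"
        using e by (simp only: ennreal_mult' ennreal_plus) (simp flip: ennreal_plus)
      finally show ?thesis by simp
    qed
    then show "\<exists>N. \<forall>m\<ge>N. \<forall>n\<ge>N. (\<integral>\<^sup>+x. ennreal (min 1 ((norm (v m x - v n x))\<^sup>2) * \<rho> x) \<partial>lborel) \<le> ennreal e"
      by blast
  qed (use \<rho> in auto)
  show thesis
    by (rule that[of "\<sigma> \<circ> \<tau>"]) (use \<sigma>(1) \<tau> in \<open>auto simp: strict_mono_o v_def\<close>)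
qed

subsection \<open>Convexity and scaling of the energy\<close>

lemma abs_midpoint_powr_le:
  fixes a b q :: real
  assumes q: "q \<ge> 1"
  shows "\<bar>(a + b) / 2\<bar> powr q \<le> (\<bar>a\<bar> powr q + \<bar>b\<bar> powr q) / 2"
proof -
  have half: "(t / 2) powr q \<le> t powr q / 2" if "t \<ge> 0" for t :: real
  proof -
    have "(t / 2) powr q = t powr q / 2 powr q" using that by (simp add: powr_divide)
    also have "\<dots> \<le> t powr q / 2 powr 1" using q by (intro divide_left_mono powr_mono) auto
    finally show ?thesis by simp
  qed
  have "\<bar>(a + b) / 2\<bar> powr q \<le> ((\<bar>a\<bar> + \<bar>b\<bar>) / 2) powr q"
    using q by (intro powr_mono2) auto
  also have "\<dots> \<le> (\<bar>a\<bar> powr q + \<bar>b\<bar> powr q) / 2"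
  \<comment> \<open>Convexity is applied at positive points; if one of the two numbers vanishes, the
    claim is \<open>half\<close>.\<close>
  proof (cases "a = 0 \<or> b = 0")
    case True
    then show ?thesis using half[of "\<bar>a\<bar>"] half[of "\<bar>b\<bar>"] q by auto
  next
    case False
    then show ?thesis
      using convex_onD[OF powr_convex[OF q], of "1/2" "\<bar>a\<bar>" "\<bar>b\<bar>"] by (simp add: add_divide_distrib)
  qed
  finally show ?thesis .
qed

text \<open>For small \<kappa> the constant in front of \<open>a\<close> is close to 1, so adding a
  \<open>b\<close> with small integral hardly increases the integral of the power. This is how the
  constraint is shown to be continuous.\<close>

lemma abs_add_powr_le:
  fixes a b q \<kappa> :: real
  assumes q: "q \<ge> 0" and \<kappa>: "\<kappa> > 0"
  shows "\<bar>a + b\<bar> powr q \<le> (1 + \<kappa>) powr q * \<bar>a\<bar> powr q + (1 + 1 / \<kappa>) powr q * \<bar>b\<bar> powr q"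
proof (cases "\<bar>b\<bar> \<le> \<kappa> * \<bar>a\<bar>")
  case True
  then have "\<bar>a + b\<bar> powr q \<le> ((1 + \<kappa>) * \<bar>a\<bar>) powr q"
    using q by (intro powr_mono2) (auto simp: algebra_simps)
  also have "\<dots> = (1 + \<kappa>) powr q * \<bar>a\<bar> powr q" using \<kappa> by (simp add: powr_mult)
  finally show ?thesis by (simp add: add_increasing2)
next
  case False
  then have "\<bar>a\<bar> \<le> \<bar>b\<bar> / \<kappa>" using \<kappa> by (simp add: field_simps)
  then have "\<bar>a + b\<bar> \<le> (1 + 1 / \<kappa>) * \<bar>b\<bar>" by (simp add: algebra_simps)
  then have "\<bar>a + b\<bar> powr q \<le> ((1 + 1 / \<kappa>) * \<bar>b\<bar>) powr q"
    using q by (intro powr_mono2) auto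
  also have "\<dots> = (1 + 1 / \<kappa>) powr q * \<bar>b\<bar> powr q" using \<kappa> by (simp add: powr_mult)
  finally show ?thesis by (simp add: add_increasing)
qed

lemma weighted_integral_cmult:
  fixes w :: "'a::euclidean_space \<Rightarrow> real"
  assumes [measurable]: "w \<in> borel_measurable borel"
  shows "weighted_integral q \<gamma> (\<lambda>x. c * w x) = ennreal (\<bar>c\<bar> powr q) * weighted_integral q \<gamma> w"
proof -
  have "weighted_integral q \<gamma> (\<lambda>x. c * w x) = (\<integral>\<^sup>+x. ennreal (\<bar>c\<bar> powr q) * ennreal (\<bar>w x\<bar> powr q * norm x powr (- \<gamma>)) \<partial>lborel)"
    unfolding weighted_integral_def by (simp add: abs_mult powr_mult mult.assoc ennreal_mult)
  also have "\<dots> = ennreal (\<bar>c\<bar> powr q) * weighted_integral q \<gamma> w"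
    unfolding weighted_integral_def by (rule nn_integral_cmult) measurable
  finally show ?thesis .
qed

lemma weighted_integral_add_le:
  fixes v z :: "'a::euclidean_space \<Rightarrow> real"
  assumes [measurable]: "v \<in> borel_measurable borel" "z \<in> borel_measurable borel"
    and q: "q \<ge> 0" and \<kappa>: "\<kappa> > 0"
  shows "weighted_integral q \<gamma> (\<lambda>x. v x + z x) \<le> ennreal ((1 + \<kappa>) powr q) * weighted_integral q \<gamma> v + ennreal ((1 + 1 / \<kappa>) powr q) * weighted_integral q \<gamma> z"
proof -
  have "weighted_integral q \<gamma> (\<lambda>x. v x + z x) \<le> (\<integral>\<^sup>+x. ennreal ((1 + \<kappa>) powr q) * ennreal (\<bar>v x\<bar> powr q * norm x powr (- \<gamma>))
      + ennreal ((1 + 1 / \<kappa>) powr q) * ennreal (\<bar>z x\<bar> powr q * norm x powr (- \<gamma>)) \<partial>lborel)"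
    unfolding weighted_integral_def
  proof (rule nn_integral_mono)
    fix x :: 'a
    have "\<bar>v x + z x\<bar> powr q * norm x powr (- \<gamma>)
      \<le> ((1 + \<kappa>) powr q * \<bar>v x\<bar> powr q + (1 + 1 / \<kappa>) powr q * \<bar>z x\<bar> powr q) * norm x powr (- \<gamma>)"
      by (intro mult_right_mono abs_add_powr_le q \<kappa>) auto
    also have "\<dots> = (1 + \<kappa>) powr q * (\<bar>v x\<bar> powr q * norm x powr (- \<gamma>)) + (1 + 1 / \<kappa>) powr q * (\<bar>z x\<bar> powr q * norm x powr (- \<gamma>))"
      by (simp add: algebra_simps)
    finally show "ennreal (\<bar>v x + z x\<bar> powr q * norm x powr (- \<gamma>)) \<le> ennreal ((1 + \<kappa>) powr q) * ennreal (\<bar>v x\<bar> powr q * norm x powr (- \<gamma>))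
      + ennreal ((1 + 1 / \<kappa>) powr q) * ennreal (\<bar>z x\<bar> powr q * norm x powr (- \<gamma>))"
      by (simp add: ennreal_leI flip: ennreal_mult ennreal_plus)
  qed
  also have "\<dots> = ennreal ((1 + \<kappa>) powr q) * weighted_integral q \<gamma> v + ennreal ((1 + 1 / \<kappa>) powr q) * weighted_integral q \<gamma> z"
    unfolding weighted_integral_def by (simp add: nn_integral_add nn_integral_cmult)
  finally show ?thesis .
qed

lemma weighted_integral_midpoint_le:
  fixes v z :: "'a::euclidean_space \<Rightarrow> real"
  assumes [measurable]: "v \<in> borel_measurable borel" "z \<in> borel_measurable borel" and q: "q \<ge> 1"
  shows "weighted_integral q \<gamma> (\<lambda>x. 1/2 * v x + 1/2 * z x) \<le> ennreal (1/2) * (weighted_integral q \<gamma> v + weighted_integral q \<gamma> z)"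
proof -
  have "weighted_integral q \<gamma> (\<lambda>x. 1/2 * v x + 1/2 * z x) \<le> (\<integral>\<^sup>+x. ennreal (1/2) * (ennreal (\<bar>v x\<bar> powr q * norm x powr (- \<gamma>))
      + ennreal (\<bar>z x\<bar> powr q * norm x powr (- \<gamma>))) \<partial>lborel)"
    unfolding weighted_integral_def
  proof (rule nn_integral_mono)
    fix x :: 'a
    have "\<bar>1/2 * v x + 1/2 * z x\<bar> powr q * norm x powr (- \<gamma>) \<le> (\<bar>v x\<bar> powr q + \<bar>z x\<bar> powr q) / 2 * norm x powr (- \<gamma>)"
      using abs_midpoint_powr_le[OF q, of "v x" "z x"] by (intro mult_right_mono) (auto simp: add_divide_distrib)
    also have "\<dots> = 1/2 * (\<bar>v x\<bar> powr q * norm x powr (- \<gamma>) + \<bar>z x\<bar> powr q * norm x powr (- \<gamma>))"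
      by (simp add: algebra_simps)
    finally show "ennreal (\<bar>1/2 * v x + 1/2 * z x\<bar> powr q * norm x powr (- \<gamma>)) \<le> ennreal (1/2) * (ennreal (\<bar>v x\<bar> powr q * norm x powr (- \<gamma>))
      + ennreal (\<bar>z x\<bar> powr q * norm x powr (- \<gamma>)))"
      by (subst ennreal_plus[symmetric], simp, simp, subst ennreal_mult[symmetric]) (auto intro: ennreal_leI)
  qed
  also have "\<dots> = ennreal (1/2) * (weighted_integral q \<gamma> v + weighted_integral q \<gamma> z)"
    unfolding weighted_integral_def by (subst nn_integral_cmult) (auto simp: nn_integral_add)
  finally show ?thesis .
qed

text \<open>Takes the gradient as an argument, so that linear combinations and limits of pairs can
  be formed without reference to the choice in \<open>weak_gradient\<close>.\<close>

definition gradient_energy :: "real \<Rightarrow> real \<Rightarrow> ('a::euclidean_space \<Rightarrow> real) \<Rightarrow> ('a \<Rightarrow> 'a) \<Rightarrow> ennreal" where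
  "gradient_energy p \<gamma> w g = ennreal (1/2) * (\<integral>\<^sup>+x. ennreal ((norm (g x))\<^sup>2) \<partial>lborel) + ennreal (1 / (p + 1)) * weighted_integral (p + 1) \<gamma> w"

lemma gradient_energy_le_imp:
  assumes en: "gradient_energy p \<gamma> w g \<le> ennreal E" and p: "p > 1" and E: "E \<ge> 0"
  shows "(\<integral>\<^sup>+x. ennreal ((norm (g x))\<^sup>2) \<partial>lborel) \<le> ennreal (2 * E)" "weighted_integral (p + 1) \<gamma> w \<le> ennreal ((p + 1) * E)"
proof -
  have cancel: "X \<le> ennreal (c * E)" if "ennreal (1 / c) * X \<le> ennreal E" "c > 0" for X c
  proof -
    have "X = ennreal c * (ennreal (1 / c) * X)"
      using that(2) by (simp flip: mult.assoc ennreal_mult)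
    also have "\<dots> \<le> ennreal c * ennreal E" by (intro mult_left_mono that) simp
    also have "\<dots> = ennreal (c * E)" using that(2) E by (simp add: ennreal_mult)
    finally show ?thesis .
  qed
  have "ennreal (1/2) * (\<integral>\<^sup>+x. ennreal ((norm (g x))\<^sup>2) \<partial>lborel) \<le> gradient_energy p \<gamma> w g"
    unfolding gradient_energy_def by simp
  from cancel[OF order_trans[OF this en]]
  show "(\<integral>\<^sup>+x. ennreal ((norm (g x))\<^sup>2) \<partial>lborel) \<le> ennreal (2 * E)" by simp
  have "ennreal (1 / (p + 1)) * weighted_integral (p + 1) \<gamma> w \<le> gradient_energy p \<gamma> w g"
    unfolding gradient_energy_def by simp
  from cancel[OF order_trans[OF this en]] p
  show "weighted_integral (p + 1) \<gamma> w \<le> ennreal ((p + 1) * E)" by simp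
qed

text \<open>The parallelogram identity makes the energy uniformly convex in the gradient; this
  replaces weak compactness in the direct method.\<close>

lemma gradient_energy_midpoint_le:
  fixes v w :: "'a::euclidean_space \<Rightarrow> real"
  assumes [measurable]: "v \<in> borel_measurable borel" "w \<in> borel_measurable borel"
    "f \<in> borel_measurable borel" "g \<in> borel_measurable borel" and p: "p > 1"
  shows "gradient_energy p \<gamma> (\<lambda>x. 1/2 * v x + 1/2 * w x) (\<lambda>x. (1/2) *\<^sub>R f x + (1/2) *\<^sub>R g x)
      + ennreal (1/8) * (\<integral>\<^sup>+x. ennreal ((norm (f x - g x))\<^sup>2) \<partial>lborel)
    \<le> ennreal (1/2) * (gradient_energy p \<gamma> v f + gradient_energy p \<gamma> w g)"
proof -
  have "ennreal (1/2) * ennreal ((norm ((1/2) *\<^sub>R f x + (1/2) *\<^sub>R g x))\<^sup>2) + ennreal (1/8) * ennreal ((norm (f x - g x))\<^sup>2)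
      = ennreal (1/4) * ennreal ((norm (f x))\<^sup>2) + ennreal (1/4) * ennreal ((norm (g x))\<^sup>2)" for x
  proof -
    \<comment> \<open>The parallelogram identity with the factor 1/2 of the energy; it leaves 1/8 in
      front of the squared difference.\<close>
    have "1/2 * (norm ((1/2) *\<^sub>R f x + (1/2) *\<^sub>R g x))\<^sup>2 + 1/8 * (norm (f x - g x))\<^sup>2
        = 1/4 * (norm (f x))\<^sup>2 + 1/4 * (norm (g x))\<^sup>2"
      by (simp add: power2_norm_eq_inner inner_add_left inner_add_right inner_diff_left inner_diff_right inner_commute algebra_simps)
    moreover have h: "ennreal (1/2) * ennreal (X\<^sup>2) = ennreal (1/2 * X\<^sup>2)" "ennreal (1/8) * ennreal (X\<^sup>2) = ennreal (1/8 * X\<^sup>2)"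
      "ennreal (1/4) * ennreal (X\<^sup>2) = ennreal (1/4 * X\<^sup>2)" for X :: real
      by (rule ennreal_mult[symmetric]; simp)+
    moreover have "ennreal (s * X\<^sup>2) + ennreal (t * Y\<^sup>2) = ennreal (s * X\<^sup>2 + t * Y\<^sup>2)" if "s \<ge> 0" "t \<ge> 0" for s t X Y :: real
      using that by (intro ennreal_plus[symmetric]) auto
    ultimately show ?thesis by (simp only: h)
  qed
  then have "(\<integral>\<^sup>+x. ennreal (1/2) * ennreal ((norm ((1/2) *\<^sub>R f x + (1/2) *\<^sub>R g x))\<^sup>2) + ennreal (1/8) * ennreal ((norm (f x - g x))\<^sup>2) \<partial>lborel)
      = (\<integral>\<^sup>+x. ennreal (1/4) * ennreal ((norm (f x))\<^sup>2) + ennreal (1/4) * ennreal ((norm (g x))\<^sup>2) \<partial>lborel)"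
    by simp
  then have G: "ennreal (1/2) * (\<integral>\<^sup>+x. ennreal ((norm ((1/2) *\<^sub>R f x + (1/2) *\<^sub>R g x))\<^sup>2) \<partial>lborel) + ennreal (1/8) * (\<integral>\<^sup>+x. ennreal ((norm (f x - g x))\<^sup>2) \<partial>lborel)
      = ennreal (1/4) * (\<integral>\<^sup>+x. ennreal ((norm (f x))\<^sup>2) \<partial>lborel) + ennreal (1/4) * (\<integral>\<^sup>+x. ennreal ((norm (g x))\<^sup>2) \<partial>lborel)"
    by (simp add: nn_integral_add nn_integral_cmult)
  have W: "ennreal (1 / (p + 1)) * weighted_integral (p + 1) \<gamma> (\<lambda>x. 1/2 * v x + 1/2 * w x)
      \<le> ennreal (1 / (p + 1)) * (ennreal (1/2) * (weighted_integral (p + 1) \<gamma> v + weighted_integral (p + 1) \<gamma> w))"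
    using p by (intro mult_left_mono weighted_integral_midpoint_le) auto
  have q: "ennreal (1/4) = ennreal (1/2) * ennreal (1/2)" by (rule trans[OF _ ennreal_mult]) auto
  show ?thesis
    using add_mono[OF eq_refl[OF G] W] unfolding gradient_energy_def q by (simp add: distrib_left mult_ac add_ac)
qed

text \<open>The two terms scale by \<open>c\<^sup>2\<close> and \<open>c powr (p + 1)\<close>. For
  \<open>c > 1\<close> the latter is larger because \<open>p > 1\<close>; for
  \<open>c \<le> 1\<close> both are at most 1.\<close>

lemma gradient_energy_cmult_le:
  fixes v :: "'a::euclidean_space \<Rightarrow> real"
  assumes [measurable]: "v \<in> borel_measurable borel" "f \<in> borel_measurable borel"
    and p: "p > 1" and c: "c > 0"
  shows "gradient_energy p \<gamma> (\<lambda>x. c * v x) (\<lambda>x. c *\<^sub>R f x) \<le> ennreal (max 1 (c powr (p + 1))) * gradient_energy p \<gamma> v f"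
proof -
  let ?m = "max 1 (c powr (p + 1))"
  have c2: "c\<^sup>2 \<le> ?m"
  proof (cases "c \<le> 1")
    case True
    then show ?thesis using c by (simp add: power_le_one le_max_iff_disj)
  next
    case False
    have "c\<^sup>2 = c powr 2" using c by simp
    also have "\<dots> \<le> c powr (p + 1)" using False p by (intro powr_mono) auto
    finally show ?thesis by simp
  qed
  have "(\<integral>\<^sup>+x. ennreal ((norm (c *\<^sub>R f x))\<^sup>2) \<partial>lborel) = (\<integral>\<^sup>+x. ennreal (c\<^sup>2) * ennreal ((norm (f x))\<^sup>2) \<partial>lborel)"
    by (simp add: power_mult_distrib ennreal_mult)
  also have "\<dots> = ennreal (c\<^sup>2) * (\<integral>\<^sup>+x. ennreal ((norm (f x))\<^sup>2) \<partial>lborel)"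
    by (rule nn_integral_cmult) measurable
  also have "\<dots> \<le> ennreal ?m * (\<integral>\<^sup>+x. ennreal ((norm (f x))\<^sup>2) \<partial>lborel)"
    by (intro mult_right_mono ennreal_leI c2) auto
  finally have 1: "(\<integral>\<^sup>+x. ennreal ((norm (c *\<^sub>R f x))\<^sup>2) \<partial>lborel) \<le> ennreal ?m * (\<integral>\<^sup>+x. ennreal ((norm (f x))\<^sup>2) \<partial>lborel)" .
  have 2: "weighted_integral (p + 1) \<gamma> (\<lambda>x. c * v x) \<le> ennreal ?m * weighted_integral (p + 1) \<gamma> v"
    using c by (subst weighted_integral_cmult) (auto intro!: mult_right_mono ennreal_leI)
  have "gradient_energy p \<gamma> (\<lambda>x. c * v x) (\<lambda>x. c *\<^sub>R f x) \<le> ennreal (1/2) * (ennreal ?m * (\<integral>\<^sup>+x. ennreal ((norm (f x))\<^sup>2) \<partial>lborel))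
      + ennreal (1 / (p + 1)) * (ennreal ?m * weighted_integral (p + 1) \<gamma> v)"
    unfolding gradient_energy_def by (intro add_mono mult_left_mono 1 2) auto
  also have "\<dots> = ennreal ?m * gradient_energy p \<gamma> v f"
    unfolding gradient_energy_def by (simp add: distrib_left mult_ac)
  finally show ?thesis .
qed

lemma nn_integral_limit_le:
  fixes u :: "nat \<Rightarrow> 'a \<Rightarrow> ennreal"
  assumes [measurable]: "\<And>k. u k \<in> borel_measurable M"
    and lim: "AE x in M. (\<lambda>k. u k x) \<longlonglongrightarrow> u' x"
    and bd: "eventually (\<lambda>k. (\<integral>\<^sup>+x. u k x \<partial>M) \<le> B) sequentially"
  shows "(\<integral>\<^sup>+x. u' x \<partial>M) \<le> B"
proof -
  have "(\<integral>\<^sup>+x. u' x \<partial>M) = (\<integral>\<^sup>+x. liminf (\<lambda>k. u k x) \<partial>M)"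
    by (rule nn_integral_cong_AE) (use lim in eventually_elim, simp add: lim_imp_Liminf)
  also have "\<dots> \<le> liminf (\<lambda>k. \<integral>\<^sup>+x. u k x \<partial>M)" by (rule nn_integral_liminf) measurable
  also have "\<dots> \<le> limsup (\<lambda>k. \<integral>\<^sup>+x. u k x \<partial>M)" by (rule Liminf_le_Limsup) simp
  also have "\<dots> \<le> B" by (rule Limsup_bounded[OF bd])
  finally show ?thesis .
qed

lemma weighted_integral_limit_le:
  fixes u :: "nat \<Rightarrow> 'a::euclidean_space \<Rightarrow> real"
  assumes [measurable]: "\<And>k. u k \<in> borel_measurable borel" and q: "q > 0"
    and lim: "AE x in lborel. (\<lambda>k. u k x) \<longlonglongrightarrow> u' x"
    and bd: "eventually (\<lambda>k. weighted_integral q \<gamma> (u k) \<le> B) sequentially"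
  shows "weighted_integral q \<gamma> u' \<le> B"
  unfolding weighted_integral_def
proof (rule nn_integral_limit_le[OF _ _ bd[unfolded weighted_integral_def]])
  show "AE x in lborel. (\<lambda>k. ennreal (\<bar>u k x\<bar> powr q * norm x powr (- \<gamma>))) \<longlonglongrightarrow> ennreal (\<bar>u' x\<bar> powr q * norm x powr (- \<gamma>))"
    using lim
  proof eventually_elim
    case (elim x)
    have "continuous_on UNIV (\<lambda>t::real. \<bar>t\<bar> powr q)"
      using q by (intro continuous_on_powr' continuous_intros) auto
    then have "isCont (\<lambda>t::real. \<bar>t\<bar> powr q) (u' x)"
      by (simp add: continuous_on_eq_continuous_at)
    from isCont_tendsto_compose[OF this elim] show ?case
      by (intro tendsto_ennrealI tendsto_mult tendsto_const)
  qed
qed measurable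

lemma nn_integral_cball_le_weighted_integral:
  fixes w :: "'a::euclidean_space \<Rightarrow> real"
  assumes [measurable]: "w \<in> borel_measurable borel" and \<gamma>: "\<gamma> \<ge> 0" and q: "q > 1" and e: "e > 0"
  shows "(\<integral>\<^sup>+x. indicator (cball 0 R) x * ennreal \<bar>w x\<bar> \<partial>lborel)
    \<le> ennreal e * emeasure lborel (cball (0::'a) R) + ennreal (e powr (1 - q)) * (ennreal (R powr \<gamma>) * weighted_integral q \<gamma> w)"
proof -
  have cb [measurable]: "cball (0::'a) R \<in> sets borel" by simp
  have "(\<integral>\<^sup>+x. indicator (cball 0 R) x * ennreal \<bar>w x\<bar> \<partial>lborel)
      \<le> (\<integral>\<^sup>+x. ennreal e * indicator (cball 0 R) x + ennreal (e powr (1 - q)) * (indicator (cball 0 R) x * ennreal (\<bar>w x\<bar> powr q)) \<partial>lborel)"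
  proof (rule nn_integral_mono)
    fix x :: 'a
    have "ennreal \<bar>w x\<bar> \<le> ennreal (e + e powr (1 - q) * \<bar>w x\<bar> powr q)"
      by (intro ennreal_leI le_add_powr e q) simp
    also have "\<dots> = ennreal e + ennreal (e powr (1 - q)) * ennreal (\<bar>w x\<bar> powr q)"
      using e by (simp add: ennreal_mult)
    finally show "indicator (cball 0 R) x * ennreal \<bar>w x\<bar> \<le> ennreal e * indicator (cball 0 R) x + ennreal (e powr (1 - q)) * (indicator (cball 0 R) x * ennreal (\<bar>w x\<bar> powr q))"
      by (cases "x \<in> cball 0 R") auto
  qed
  also have "\<dots> = ennreal e * emeasure lborel (cball (0::'a) R) + ennreal (e powr (1 - q)) * (\<integral>\<^sup>+x. indicator (cball 0 R) x * ennreal (\<bar>w x\<bar> powr q) \<partial>lborel)"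
    using cb by (simp add: nn_integral_add nn_integral_cmult nn_integral_cmult_indicator del: mem_cball mem_cball_0)
  also have "\<dots> \<le> ennreal e * emeasure lborel (cball (0::'a) R) + ennreal (e powr (1 - q)) * (ennreal (R powr \<gamma>) * weighted_integral q \<gamma> w)"
    by (intro add_mono mult_left_mono nn_integral_cball_powr_le_weighted_integral \<gamma>) auto
  finally show ?thesis .
qed

subsection \<open>Limits of weak gradients\<close>

lemma loc_intI_cball:
  fixes f :: "'a::euclidean_space \<Rightarrow> 'b::euclidean_space"
  assumes [measurable]: "f \<in> borel_measurable borel"
    and fin: "\<And>R. R > 0 \<Longrightarrow> (\<integral>\<^sup>+x. indicator (cball 0 R) x * ennreal (norm (f x)) \<partial>lborel) < \<infinity>"
  shows "loc_int f"
  unfolding loc_int_def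
proof (intro conjI allI impI)
  fix K :: "'a set" assume K: "compact K"
  then have [measurable]: "K \<in> sets borel" by (rule borel_compact)
  obtain R where R: "R > 0" "\<And>x. x \<in> K \<Longrightarrow> norm x \<le> R"
    using compact_imp_bounded[OF K] by (auto simp: bounded_pos)
  have "(\<integral>\<^sup>+x. ennreal (norm (indicator K x *\<^sub>R f x)) \<partial>lborel) \<le> (\<integral>\<^sup>+x. indicator (cball 0 R) x * ennreal (norm (f x)) \<partial>lborel)"
    using R(2) by (intro nn_integral_mono) (auto simp: indicator_def)
  also have "\<dots> < \<infinity>" by (rule fin[OF R(1)])
  finally show "set_integrable lborel K f" by (simp add: set_integrable_def integrable_iff_bounded)
qed fact

lemma loc_int_if_weighted_integral_finite:
  fixes w :: "'a::euclidean_space \<Rightarrow> real"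
  assumes w: "w \<in> borel_measurable borel" and \<gamma>: "\<gamma> \<ge> 0" and q: "q > 1" and fin: "weighted_integral q \<gamma> w < \<infinity>"
  shows "loc_int w"
proof (rule loc_intI_cball[OF w])
  fix R :: real
  have "ennreal 1 * emeasure lborel (cball (0::'a) R) + ennreal (1 powr (1 - q)) * (ennreal (R powr \<gamma>) * weighted_integral q \<gamma> w) < \<infinity>"
    using fin emeasure_lborel_cball_finite[of "0::'a" R] by (simp add: ennreal_mult_less_top)
  with nn_integral_cball_le_weighted_integral[OF w \<gamma> q, of 1 R]
  show "(\<integral>\<^sup>+x. indicator (cball 0 R) x * ennreal (norm (w x)) \<partial>lborel) < \<infinity>"
    by (simp add: le_less_trans)
qed

text \<open>Lets the weighted estimates be reused for gradients. It is stated as an inequality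
  because \<open>norm x powr 0\<close> is 1 away from the origin but 0 at it.\<close>

lemma weighted_integral_2_norm_le:
  fixes g :: "'a::euclidean_space \<Rightarrow> 'b::real_normed_vector"
  shows "weighted_integral 2 0 (\<lambda>x. norm (g x)) \<le> (\<integral>\<^sup>+x. ennreal ((norm (g x))\<^sup>2) \<partial>lborel)"
  unfolding weighted_integral_def by (intro nn_integral_mono ennreal_leI) simp

lemma nn_integral_cball_tendsto_0:
  fixes u :: "nat \<Rightarrow> 'a::euclidean_space \<Rightarrow> real"
  assumes [measurable]: "\<And>n. u n \<in> borel_measurable borel" and \<gamma>: "\<gamma> \<ge> 0" and q: "q > 1"
    and lim: "(\<lambda>n. weighted_integral q \<gamma> (u n)) \<longlonglongrightarrow> 0"
  shows "(\<lambda>n. \<integral>\<^sup>+x. indicator (cball 0 R) x * ennreal \<bar>u n x\<bar> \<partial>lborel) \<longlonglongrightarrow> 0"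
proof (rule tendsto_ennreal_0I)
  fix e :: real assume e: "e > 0"
  define b where "b = measure lborel (cball (0::'a) R)"
  have b: "emeasure lborel (cball (0::'a) R) = ennreal b" "b \<ge> 0"
    unfolding b_def using emeasure_lborel_cball_finite[of "0::'a" R]
    by (auto intro!: emeasure_eq_ennreal_measure)
  define \<delta> where "\<delta> = e / (2 * (b + 1))"
  have \<delta>: "\<delta> > 0" using e b by (simp add: \<delta>_def)
  have "\<delta> * b \<le> e / 2" using e b(2) by (simp add: \<delta>_def field_simps)
  have "(\<lambda>n. ennreal (\<delta> powr (1 - q) * R powr \<gamma>) * weighted_integral q \<gamma> (u n)) \<longlonglongrightarrow> ennreal (\<delta> powr (1 - q) * R powr \<gamma>) * 0"
    by (intro ennreal_tendsto_cmult lim) simp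
  then have "\<forall>\<^sub>F n in sequentially. ennreal (\<delta> powr (1 - q) * R powr \<gamma>) * weighted_integral q \<gamma> (u n) < ennreal (e / 2)"
    using e by (intro order_tendstoD(2)) auto
  then show "\<forall>\<^sub>F n in sequentially. (\<integral>\<^sup>+x. indicator (cball 0 R) x * ennreal \<bar>u n x\<bar> \<partial>lborel) \<le> ennreal e"
  proof eventually_elim
    case (elim n)
    have "(\<integral>\<^sup>+x. indicator (cball 0 R) x * ennreal \<bar>u n x\<bar> \<partial>lborel)
        \<le> ennreal \<delta> * emeasure lborel (cball (0::'a) R) + ennreal (\<delta> powr (1 - q)) * (ennreal (R powr \<gamma>) * weighted_integral q \<gamma> (u n))"
      by (rule nn_integral_cball_le_weighted_integral[OF _ \<gamma> q \<delta>]) measurable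
    also have "\<dots> = ennreal (\<delta> * b) + ennreal (\<delta> powr (1 - q) * R powr \<gamma>) * weighted_integral q \<gamma> (u n)"
      using \<delta> b by (simp add: ennreal_mult mult.assoc)
    also have "\<dots> \<le> ennreal (e / 2) + ennreal (e / 2)"
      using elim \<open>\<delta> * b \<le> e / 2\<close> by (intro add_mono ennreal_leI) auto
    also have "\<dots> = ennreal e" using e by (simp flip: ennreal_plus)
    finally show ?case .
  qed
qed

lemma integral_compact_support_tendsto:
  fixes v :: "nat \<Rightarrow> 'a::euclidean_space \<Rightarrow> 'b::euclidean_space" and \<phi> :: "'a \<Rightarrow> real"
  assumes v: "\<And>n. loc_int (v n)" and w: "loc_int w" and cont: "continuous_on UNIV \<phi>" and K: "compact K"
    and supp: "\<And>x. x \<notin> K \<Longrightarrow> \<phi> x = 0"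
    and lim: "\<And>R. (\<lambda>n. \<integral>\<^sup>+x. indicator (cball 0 R) x * ennreal \<bar>norm (v n x - w x)\<bar> \<partial>lborel) \<longlonglongrightarrow> 0"
  shows "(\<lambda>n. \<integral>x. \<phi> x *\<^sub>R v n x \<partial>lborel) \<longlonglongrightarrow> (\<integral>x. \<phi> x *\<^sub>R w x \<partial>lborel)"
proof (rule tendsto_L1_int)
  note [measurable] = v[THEN loc_int_measurable] w[THEN loc_int_measurable]
  show "integrable lborel (\<lambda>x. \<phi> x *\<^sub>R v n x)" for n
    by (rule integrable_mult_compact_support[OF v cont K supp])
  show "integrable lborel (\<lambda>x. \<phi> x *\<^sub>R w x)"
    by (rule integrable_mult_compact_support[OF w cont K supp])
  obtain R where R: "\<And>x. x \<in> K \<Longrightarrow> norm x \<le> R"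
    using compact_imp_bounded[OF K] by (auto simp: bounded_iff)
  have "bounded (\<phi> ` K)"
    using K cont by (intro compact_imp_bounded compact_continuous_image) (auto intro: continuous_on_subset)
  then obtain C where C: "\<And>x. x \<in> K \<Longrightarrow> \<bar>\<phi> x\<bar> \<le> C"
    by (auto simp: bounded_iff)
  let ?I = "\<lambda>n. \<integral>\<^sup>+x. indicator (cball 0 R) x * ennreal \<bar>norm (v n x - w x)\<bar> \<partial>lborel"
  have cb [measurable]: "cball (0::'a) R \<in> sets borel" by simp
  have up: "(\<lambda>n. ennreal \<bar>C\<bar> * ?I n) \<longlonglongrightarrow> 0"
    using ennreal_tendsto_cmult[OF _ lim[of R], of "ennreal \<bar>C\<bar>"] by simp
  show "((\<lambda>n. \<integral>\<^sup>+x. ennreal (norm (\<phi> x *\<^sub>R v n x - \<phi> x *\<^sub>R w x)) \<partial>lborel) \<longlongrightarrow> 0) sequentially"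
  proof (rule tendsto_sandwich[OF _ _ tendsto_const up])
    show "\<forall>\<^sub>F n in sequentially. (\<integral>\<^sup>+x. ennreal (norm (\<phi> x *\<^sub>R v n x - \<phi> x *\<^sub>R w x)) \<partial>lborel) \<le> ennreal \<bar>C\<bar> * ?I n"
    proof (intro always_eventually allI)
      fix n
      have "(\<integral>\<^sup>+x. ennreal (norm (\<phi> x *\<^sub>R v n x - \<phi> x *\<^sub>R w x)) \<partial>lborel)
          \<le> (\<integral>\<^sup>+x. ennreal \<bar>C\<bar> * (indicator (cball 0 R) x * ennreal \<bar>norm (v n x - w x)\<bar>) \<partial>lborel)"
      proof (rule nn_integral_mono)
        fix x
        show "ennreal (norm (\<phi> x *\<^sub>R v n x - \<phi> x *\<^sub>R w x)) \<le> ennreal \<bar>C\<bar> * (indicator (cball 0 R) x * ennreal \<bar>norm (v n x - w x)\<bar>)"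
        proof (cases "x \<in> K")
          case True
          have "norm (\<phi> x *\<^sub>R v n x - \<phi> x *\<^sub>R w x) = \<bar>\<phi> x\<bar> * norm (v n x - w x)"
            by (simp flip: scaleR_diff_right)
          also have "\<dots> \<le> \<bar>C\<bar> * norm (v n x - w x)" using C[OF True] by (intro mult_right_mono) auto
          finally have "ennreal (norm (\<phi> x *\<^sub>R v n x - \<phi> x *\<^sub>R w x)) \<le> ennreal (\<bar>C\<bar> * norm (v n x - w x))"
            by (rule ennreal_leI)
          then show ?thesis using R[OF True] by (simp add: ennreal_mult)
        next
          case False
          then show ?thesis using supp by simp
        qed
      qed
      also have "\<dots> = ennreal \<bar>C\<bar> * ?I n"
        using cb by (intro nn_integral_cmult) measurable
      finally show "(\<integral>\<^sup>+x. ennreal (norm (\<phi> x *\<^sub>R v n x - \<phi> x *\<^sub>R w x)) \<partial>lborel) \<le> ennreal \<bar>C\<bar> * ?I n" .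
    qed
  qed simp
qed

text \<open>Both modes of convergence imply \<open>L1\<close> convergence on balls, under which
  either side of the integration by parts identity converges for a fixed test function.\<close>

lemma wgrad_limit:
  fixes v :: "nat \<Rightarrow> 'a::euclidean_space \<Rightarrow> real" and q \<gamma> :: real
  assumes wg: "\<And>n. wgrad (v n) (f n)"
    and [measurable]: "w \<in> borel_measurable borel" "g \<in> borel_measurable borel"
    and \<gamma>: "\<gamma> \<ge> 0" and q: "q > 1"
    and w: "weighted_integral q \<gamma> w < \<infinity>" "(\<lambda>n. weighted_integral q \<gamma> (\<lambda>x. v n x - w x)) \<longlonglongrightarrow> 0"
    and g: "(\<integral>\<^sup>+x. ennreal ((norm (g x))\<^sup>2) \<partial>lborel) < \<infinity>" "(\<lambda>n. \<integral>\<^sup>+x. ennreal ((norm (f n x - g x))\<^sup>2) \<partial>lborel) \<longlonglongrightarrow> 0"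
  shows "wgrad w g"
proof -
  have loc: "loc_int (v n)" "loc_int (f n)" for n using wg by (auto simp: wgrad_def)
  note [measurable] = loc[THEN loc_int_measurable]
  have lw: "loc_int w" by (rule loc_int_if_weighted_integral_finite[OF _ \<gamma> q w(1)]) measurable
  have "weighted_integral 2 0 (\<lambda>x. norm (g x)) < \<infinity>" using weighted_integral_2_norm_le[of g] g(1) by (rule le_less_trans)
  then have ng: "loc_int (\<lambda>x. norm (g x))" by (intro loc_int_if_weighted_integral_finite[of _ 0 2]) auto
  have lg: "loc_int g"
    unfolding loc_int_def set_integrable_def
  proof (intro conjI allI impI)
    fix K :: "'a set" assume K: "compact K"
    then have [measurable]: "K \<in> sets borel" by (rule borel_compact)
    have "integrable lborel (\<lambda>x. indicator K x *\<^sub>R norm (g x))"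
      using ng K by (simp add: loc_int_def set_integrable_def)
    then show "integrable lborel (\<lambda>x. indicator K x *\<^sub>R g x)"
      by (rule Bochner_Integration.integrable_bound) auto
  qed measurable
  have limw: "(\<lambda>n. \<integral>\<^sup>+x. indicator (cball 0 R) x * ennreal \<bar>norm (v n x - w x)\<bar> \<partial>lborel) \<longlonglongrightarrow> 0" for R
    using nn_integral_cball_tendsto_0[OF _ \<gamma> q w(2), of R] by simp
  have "(\<lambda>n. weighted_integral 2 0 (\<lambda>x. norm (f n x - g x))) \<longlonglongrightarrow> 0"
    by (rule tendsto_sandwich[OF _ _ tendsto_const g(2)]) (auto intro!: always_eventually weighted_integral_2_norm_le)
  then have limg: "(\<lambda>n. \<integral>\<^sup>+x. indicator (cball 0 R) x * ennreal \<bar>norm (f n x - g x)\<bar> \<partial>lborel) \<longlonglongrightarrow> 0" for R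
    by (intro nn_integral_cball_tendsto_0[of _ 0 2]) auto
  have "(\<integral>x. frechet_derivative \<phi> (at x) b * w x \<partial>lborel) = - (\<integral>x. \<phi> x * (g x \<bullet> b) \<partial>lborel)"
    if \<phi>: "test_function \<phi>" for \<phi> :: "'a \<Rightarrow> real" and b
  proof -
    obtain K where K: "compact K" "\<And>x. x \<notin> K \<Longrightarrow> \<phi> x = 0" "\<And>x v. x \<notin> K \<Longrightarrow> frechet_derivative \<phi> (at x) v = 0"
      using test_function_props[OF \<phi>] by blast
    note c = test_function_continuous[OF \<phi>]
    have 1: "(\<lambda>n. \<integral>x. frechet_derivative \<phi> (at x) b * v n x \<partial>lborel) \<longlonglongrightarrow> (\<integral>x. frechet_derivative \<phi> (at x) b * w x \<partial>lborel)"
      using integral_compact_support_tendsto[OF loc(1) lw c(2) K(1) K(3) limw] by simp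
    have "(\<lambda>n. \<integral>x. \<phi> x *\<^sub>R f n x \<partial>lborel) \<longlonglongrightarrow> (\<integral>x. \<phi> x *\<^sub>R g x \<partial>lborel)"
      by (rule integral_compact_support_tendsto[OF loc(2) lg c(1) K(1) K(2) limg])
    then have "(\<lambda>n. (\<integral>x. \<phi> x *\<^sub>R f n x \<partial>lborel) \<bullet> b) \<longlonglongrightarrow> (\<integral>x. \<phi> x *\<^sub>R g x \<partial>lborel) \<bullet> b"
      by (intro tendsto_intros)
    moreover have "(\<integral>x. \<phi> x *\<^sub>R h x \<partial>lborel) \<bullet> b = (\<integral>x. \<phi> x * (h x \<bullet> b) \<partial>lborel)" if "loc_int h" for h :: "'a \<Rightarrow> 'a"
      using integrable_test_function(1)[OF that \<phi>] by (simp flip: integral_inner_left)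
    ultimately have "(\<lambda>n. - (\<integral>x. \<phi> x * (f n x \<bullet> b) \<partial>lborel)) \<longlonglongrightarrow> - (\<integral>x. \<phi> x * (g x \<bullet> b) \<partial>lborel)"
      using loc(2) lg by (intro tendsto_minus) simp
    moreover have "- (\<integral>x. \<phi> x * (f n x \<bullet> b) \<partial>lborel) = (\<integral>x. frechet_derivative \<phi> (at x) b * v n x \<partial>lborel)" for n
      using wg[of n] \<phi> by (simp add: wgrad_def)
    ultimately show ?thesis using 1 LIMSEQ_unique by auto
  qed
  then show ?thesis using lw lg by (simp add: wgrad_def)
qed

subsection \<open>Minimizing sequences\<close>

lemma translation_bound_diff:
  assumes v: "wgrad v f" "(\<integral>\<^sup>+x. ennreal ((norm (f x))\<^sup>2) \<partial>lborel) \<le> ennreal G"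
    and w: "wgrad w g" "(\<integral>\<^sup>+x. ennreal ((norm (g x))\<^sup>2) \<partial>lborel) \<le> ennreal G" and G: "G \<ge> 0"
  shows "translation_bound (4 * G) (\<lambda>x. v x - w x)"
proof (rule wgrad_imp_translation_bound)
  note [measurable] = wgrad_measurable[OF v(1)] wgrad_measurable[OF w(1)]
  show "wgrad (\<lambda>x. v x - w x) (\<lambda>x. f x - g x)"
    using wgrad_lincomb[OF v(1) w(1), of 1 "-1"] by simp
  have "(\<integral>\<^sup>+x. ennreal ((norm (f x - g x))\<^sup>2) \<partial>lborel) \<le> (\<integral>\<^sup>+x. 2 * ennreal ((norm (f x))\<^sup>2) + 2 * ennreal ((norm (g x))\<^sup>2) \<partial>lborel)"
  proof (rule nn_integral_mono)
    fix x
    have "0 \<le> (norm (f x + g x))\<^sup>2" by simp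
    also have "(norm (f x + g x))\<^sup>2 = 2 * (norm (f x))\<^sup>2 + 2 * (norm (g x))\<^sup>2 - (norm (f x - g x))\<^sup>2"
      by (simp add: power2_norm_eq_inner inner_add_left inner_add_right inner_diff_left inner_diff_right inner_commute)
    finally have "ennreal ((norm (f x - g x))\<^sup>2) \<le> ennreal (2 * (norm (f x))\<^sup>2 + 2 * (norm (g x))\<^sup>2)"
      by (intro ennreal_leI) linarith
    then show "ennreal ((norm (f x - g x))\<^sup>2) \<le> 2 * ennreal ((norm (f x))\<^sup>2) + 2 * ennreal ((norm (g x))\<^sup>2)"
      by (simp add: ennreal_mult)
  qed
  also have "\<dots> = 2 * (\<integral>\<^sup>+x. ennreal ((norm (f x))\<^sup>2) \<partial>lborel) + 2 * (\<integral>\<^sup>+x. ennreal ((norm (g x))\<^sup>2) \<partial>lborel)"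
    by (simp add: nn_integral_add nn_integral_cmult)
  also have "\<dots> \<le> 2 * ennreal G + 2 * ennreal G"
    by (intro add_mono mult_left_mono v w) auto
  also have "\<dots> = ennreal (4 * G)"
    using G by (simp add: ennreal_mult flip: distrib_right)
  finally show "(\<integral>\<^sup>+x. ennreal ((norm (f x - g x))\<^sup>2) \<partial>lborel) \<le> ennreal (4 * G)" .
qed

text \<open>\<open>weighted_integral_tendsto_0\<close> is applied to differences
  \<open>v (\<sigma> (m k)) - v (\<sigma> (n k))\<close> of the sequence rather than to differences
  with \<open>w\<close>: it demands a translation bound, and no weak gradient of the limit is known
  yet. Hence the Cauchy form of the conclusion.\<close>

lemma bounded_energy_compact:
  fixes v :: "nat \<Rightarrow> 'a::euclidean_space \<Rightarrow> real" and p \<gamma> E :: real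
  assumes d: "DIM('a) \<ge> 3" and \<gamma>: "0 < \<gamma>" "\<gamma> < DIM('a)" and p: "1 < p" "p < (DIM('a) - \<gamma>) / (real DIM('a) - 2)"
    and wg: "\<And>n. wgrad (v n) (f n)" and en: "\<And>n. gradient_energy p \<gamma> (v n) (f n) \<le> ennreal E" and E: "E > 0"
  obtains \<sigma> w where "strict_mono (\<sigma> :: nat \<Rightarrow> nat)" "w \<in> borel_measurable borel"
    "AE x in lborel. (\<lambda>n. v (\<sigma> n) x) \<longlonglongrightarrow> w x"
    "\<And>e::real. e > 0 \<Longrightarrow> \<exists>N. \<forall>m\<ge>N. \<forall>n\<ge>N. weighted_integral (2 * p) \<gamma> (\<lambda>x. v (\<sigma> m) x - v (\<sigma> n) x) \<le> ennreal e"
proof -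
  note [measurable] = wgrad_measurable[OF wg]
  have E0: "E \<ge> 0" using E by simp
  note bd = gradient_energy_le_imp[OF en p(1) E0]
  have C: "0 \<le> (p + 1) * E" using p E by simp
  obtain \<sigma> where \<sigma>: "strict_mono (\<sigma> :: nat \<Rightarrow> nat)" "AE x in lborel. convergent (\<lambda>n. v (\<sigma> n) x)"
  proof (rule Rellich)
    show "translation_bound (2 * E) (v n)" for n by (rule wgrad_imp_translation_bound[OF wg bd(1)])
    show "weighted_integral (p + 1) \<gamma> (v n) \<le> ennreal ((p + 1) * E)" for n by (rule bd(2))
  qed (use E \<gamma> p C in auto)
  define w where "w x = lim (\<lambda>n. v (\<sigma> n) x)" for x
  have ae: "AE x in lborel. (\<lambda>n. v (\<sigma> n) x) \<longlonglongrightarrow> w x"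
    using \<sigma>(2) by eventually_elim (simp add: w_def convergent_LIMSEQ_iff)
  show thesis
  proof (rule that[OF \<sigma>(1) _ ae])
    show "w \<in> borel_measurable borel" unfolding w_def[abs_def] by (rule borel_measurable_lim_metric) measurable
    fix e :: real assume e: "e > 0"
    show "\<exists>N. \<forall>m\<ge>N. \<forall>n\<ge>N. weighted_integral (2 * p) \<gamma> (\<lambda>x. v (\<sigma> m) x - v (\<sigma> n) x) \<le> ennreal e"
    proof (rule ccontr)
      assume "\<not> ?thesis"
      then have "\<forall>k. \<exists>m n. m \<ge> k \<and> n \<ge> k \<and> \<not> weighted_integral (2 * p) \<gamma> (\<lambda>x. v (\<sigma> m) x - v (\<sigma> n) x) \<le> ennreal e"
        by blast
      then obtain m n where mn: "\<And>k. m k \<ge> k" "\<And>k. n k \<ge> k"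
        "\<And>k. \<not> weighted_integral (2 * p) \<gamma> (\<lambda>x. v (\<sigma> (m k)) x - v (\<sigma> (n k)) x) \<le> ennreal e"
        by metis
      define u where "u k x = v (\<sigma> (m k)) x - v (\<sigma> (n k)) x" for k x
      \<comment> \<open>Bounds the contribution of either term to the weighted integral of the
        difference; the power of 2 comes from \<open>weighted_integral_add_le\<close> with \<kappa>
        equal to 1.\<close>
      define c where "c = 2 powr (p + 1) * ((p + 1) * E)"
      have c: "c \<ge> 0" using p E0 by (simp add: c_def)
      have lim: "filterlim m sequentially sequentially" "filterlim n sequentially sequentially"
        using mn(1,2) by (auto intro: filterlim_at_top_mono[OF filterlim_ident])
      have "(\<lambda>k. weighted_integral (2 * p) \<gamma> (u k)) \<longlonglongrightarrow> 0"
      proof (rule weighted_integral_tendsto_0[OF d \<gamma> p])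
        show "0 < 4 * (2 * E)" using E by simp
        show "translation_bound (4 * (2 * E)) (u k)" for k
          unfolding u_def[abs_def] using E0 by (intro translation_bound_diff[OF wg bd(1) wg bd(1)]) auto
        show "0 \<le> c + c" using c by simp
        show "weighted_integral (p + 1) \<gamma> (u k) \<le> ennreal (c + c)" for k
        proof -
          have "weighted_integral (p + 1) \<gamma> (u k) \<le> ennreal ((1 + 1) powr (p + 1)) * weighted_integral (p + 1) \<gamma> (v (\<sigma> (m k)))
              + ennreal ((1 + 1 / 1) powr (p + 1)) * weighted_integral (p + 1) \<gamma> (\<lambda>x. - 1 * v (\<sigma> (n k)) x)"
            using weighted_integral_add_le[of "v (\<sigma> (m k))" "\<lambda>x. - 1 * v (\<sigma> (n k)) x" "p + 1" 1 \<gamma>] p by (simp add: u_def[abs_def])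
          also have "weighted_integral (p + 1) \<gamma> (\<lambda>x. - 1 * v (\<sigma> (n k)) x) = weighted_integral (p + 1) \<gamma> (v (\<sigma> (n k)))"
            by (subst weighted_integral_cmult) auto
          also have "ennreal ((1 + 1) powr (p + 1)) * weighted_integral (p + 1) \<gamma> (v (\<sigma> (m k))) + ennreal ((1 + 1 / 1) powr (p + 1)) * weighted_integral (p + 1) \<gamma> (v (\<sigma> (n k)))
              \<le> ennreal ((1 + 1) powr (p + 1)) * ennreal ((p + 1) * E) + ennreal ((1 + 1 / 1) powr (p + 1)) * ennreal ((p + 1) * E)"
            by (intro add_mono mult_left_mono bd(2)) auto
          also have "\<dots> = ennreal (c + c)"
          proof -
            have "ennreal (2 powr (p + 1)) * ennreal ((p + 1) * E) = ennreal c"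
              unfolding c_def using C by (intro ennreal_mult[symmetric]) auto
            moreover have "ennreal (c + c) = ennreal c + ennreal c" using c by (rule ennreal_plus[OF _ c])
            ultimately show ?thesis by (simp only: one_add_one div_by_1)
          qed
          finally show ?thesis .
        qed
        show "AE x in lborel. (\<lambda>k. u k x) \<longlonglongrightarrow> 0"
          using ae
        proof eventually_elim
          case (elim x)
          from tendsto_diff[OF filterlim_compose[OF elim lim(1)] filterlim_compose[OF elim lim(2)]]
          show ?case by (simp add: u_def)
        qed
      qed
      then have "\<forall>\<^sub>F k in sequentially. weighted_integral (2 * p) \<gamma> (u k) < ennreal e"
        using e by (intro order_tendstoD(2)) auto
      then obtain k where "weighted_integral (2 * p) \<gamma> (u k) < ennreal e"
        by (auto simp: eventually_sequentially)
      with mn(3)[of k] show False by (simp add: u_def[abs_def])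
    qed
  qed
qed

lemma ennreal_le_realE:
  assumes "x \<le> ennreal b" "b \<ge> 0"
  obtains m where "x = ennreal m" "0 \<le> m" "m \<le> b"
  using assms by (cases x) (auto simp: ennreal_le_iff top_unique)

section \<open>Midpoints of nearly minimizing pairs\<close>

text \<open>By convexity the midpoint satisfies the constraint with some \<open>m \<le> M\<close>,
  and closeness of \<open>v\<close> and \<open>w\<close> keeps \<open>m\<close> near
  \<open>M\<close>. Rescaling to the value \<open>M\<close> gives a competitor whose energy is
  larger by a factor of at most \<open>1 + \<eta>\<close>.\<close>

lemma gradient_energy_midpoint_ge:
  fixes p \<gamma> M I \<eta> :: real
  assumes p: "p > 1" and M: "M > 0" and \<eta>: "\<eta> > 0"
    and I: "\<And>(v :: 'a::euclidean_space \<Rightarrow> real) f. wgrad v f \<Longrightarrow> weighted_integral (2 * p) \<gamma> v = ennreal M \<Longrightarrow> ennreal I \<le> gradient_energy p \<gamma> v f"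
  obtains e :: real where "e > 0"
    "\<And>(v :: 'a \<Rightarrow> real) f w g. wgrad v f \<Longrightarrow> weighted_integral (2 * p) \<gamma> v = ennreal M \<Longrightarrow> wgrad w g \<Longrightarrow> weighted_integral (2 * p) \<gamma> w = ennreal M \<Longrightarrow>
      weighted_integral (2 * p) \<gamma> (\<lambda>x. v x - w x) \<le> ennreal e \<Longrightarrow>
      ennreal I \<le> ennreal (1 + \<eta>) * gradient_energy p \<gamma> (\<lambda>x. 1/2 * v x + 1/2 * w x) (\<lambda>x. (1/2) *\<^sub>R f x + (1/2) *\<^sub>R g x)"
proof -
  \<comment> \<open>Restoring the constraint multiplies the energy by at most the maximum of 1 and
    \<open>(M / m) powr s\<close>. This is at most \<open>1 + \<eta>\<close> as soon as
    \<open>\<theta> * M \<le> m\<close>, with \<theta> defined next.\<close>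
  define s where "s = (p + 1) / (2 * p)"
  have s: "s > 0" using p by (simp add: s_def)
  define \<theta> where "\<theta> = (1 + \<eta>) powr (- 1 / s)"
  have "\<theta> < (1 + \<eta>) powr 0" unfolding \<theta>_def using \<eta> s by (intro powr_less_mono) auto
  then have \<theta>: "0 < \<theta>" "\<theta> < 1" using \<eta> by (simp_all add: \<theta>_def)
  have \<theta>s: "(1 / \<theta>) powr s = 1 + \<eta>" using \<eta> s by (simp add: \<theta>_def powr_divide powr_powr powr_minus_divide)
  \<comment> \<open>The admissible loss \<theta> is split into two equal factors: one pays for
    \<open>(1 + \<kappa>) powr (2 * p)\<close>, the other for the remainder
    \<open>B * e = (1 - h) * M\<close>.\<close>
  define h where "h = sqrt \<theta>"
  have h: "0 < h" "h < 1" "h * h = \<theta>" using \<theta> by (simp_all add: h_def)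
  define \<kappa> where "\<kappa> = (1 / h) powr (1 / (2 * p)) - 1"
  have "1 powr (1 / (2 * p)) < (1 / h) powr (1 / (2 * p))"
    using h p by (intro powr_less_mono2) auto
  then have \<kappa>: "\<kappa> > 0" by (simp add: \<kappa>_def)
  have \<kappa>p: "(1 + \<kappa>) powr (2 * p) = 1 / h" using p h by (simp add: \<kappa>_def powr_powr)
  define B where "B = (1 + 1 / \<kappa>) powr (2 * p)"
  have "1 + 1 / \<kappa> > 0" using \<kappa> by (intro add_pos_pos) auto
  then have B: "B > 0" by (simp add: B_def)
  define e where "e = (1 - h) * M / B"
  show thesis
  proof (rule that)
    show e: "e > 0" using h M B by (simp add: e_def)
    fix v w :: "'a \<Rightarrow> real" and f g
    assume v: "wgrad v f" "weighted_integral (2 * p) \<gamma> v = ennreal M" and w: "wgrad w g" "weighted_integral (2 * p) \<gamma> w = ennreal M"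
      and vw: "weighted_integral (2 * p) \<gamma> (\<lambda>x. v x - w x) \<le> ennreal e"
    note [measurable] = wgrad_measurable[OF v(1)] wgrad_measurable[OF w(1)]
    define u where "u = (\<lambda>x. 1/2 * v x + 1/2 * w x)"
    define k where "k = (\<lambda>x. (1/2) *\<^sub>R f x + (1/2) *\<^sub>R g x)"
    have [measurable]: "u \<in> borel_measurable borel" "k \<in> borel_measurable borel"
      unfolding u_def k_def by measurable
    have u: "wgrad u k" unfolding u_def k_def by (rule wgrad_lincomb[OF v(1) w(1)])
    have "weighted_integral (2 * p) \<gamma> u \<le> ennreal (1/2) * (ennreal M + ennreal M)"
      using weighted_integral_midpoint_le[of v w "2 * p" \<gamma>] p v w by (simp add: u_def)
    also have "\<dots> = ennreal (1/2 * (M + M))"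
      using M by (subst ennreal_mult) (auto simp del: ennreal_plus simp flip: ennreal_plus)
    also have "1/2 * (M + M) = M" by simp
    finally obtain m where m: "weighted_integral (2 * p) \<gamma> u = ennreal m" "0 \<le> m" "m \<le> M"
      by (rule ennreal_le_realE) (use M in simp)
    have "ennreal M \<le> ennreal ((1 + \<kappa>) powr (2 * p)) * weighted_integral (2 * p) \<gamma> u + ennreal B * weighted_integral (2 * p) \<gamma> (\<lambda>x. 1/2 * (v x - w x))"
    proof -
      have "(\<lambda>x. u x + 1/2 * (v x - w x)) = v" by (simp add: u_def fun_eq_iff field_simps)
      then show ?thesis
        using weighted_integral_add_le[of u "\<lambda>x. 1/2 * (v x - w x)" "2 * p" \<kappa> \<gamma>] \<kappa> p v(2) unfolding B_def by simp
    qed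
    also have "\<dots> \<le> ennreal ((1 + \<kappa>) powr (2 * p)) * weighted_integral (2 * p) \<gamma> u + ennreal B * ennreal e"
    proof (intro add_left_mono mult_left_mono)
      have "weighted_integral (2 * p) \<gamma> (\<lambda>x. 1/2 * (v x - w x)) = ennreal (\<bar>1/2\<bar> powr (2 * p)) * weighted_integral (2 * p) \<gamma> (\<lambda>x. v x - w x)"
        by (rule weighted_integral_cmult) measurable
      also have "\<dots> \<le> ennreal 1 * ennreal e"
        using p by (intro mult_mono vw ennreal_leI powr_le1) auto
      finally show "weighted_integral (2 * p) \<gamma> (\<lambda>x. 1/2 * (v x - w x)) \<le> ennreal e" by simp
    qed simp
    also have "\<dots> = ennreal (1 / h * m) + ennreal (B * e)"
    proof -
      have "ennreal (1 / h) * ennreal m = ennreal (1 / h * m)"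
        using h m by (intro ennreal_mult[symmetric]) auto
      moreover have "ennreal B * ennreal e = ennreal (B * e)"
        using B e by (intro ennreal_mult[symmetric]) auto
      ultimately show ?thesis unfolding \<kappa>p m(1) by (simp only:)
    qed
    also have "\<dots> = ennreal (1 / h * m + B * e)"
      using h m B e by (intro ennreal_plus[symmetric]) auto
    finally have "ennreal M \<le> ennreal (1 / h * m + B * e)" .
    then have "M \<le> 1 / h * m + B * e"
      using h m B e by (subst (asm) ennreal_le_iff) auto
    then have "M \<le> m / h + (1 - h) * M" using B by (simp add: e_def)
    then have "h * M \<le> m / h" by (simp add: algebra_simps)
    then have "h * M * h \<le> m" using h(1) by (simp only: pos_le_divide_eq)
    moreover have "h * M * h = \<theta> * M" unfolding h(3)[symmetric] by simp
    ultimately have \<theta>M: "\<theta> * M \<le> m" by simp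
    have m0: "m > 0" using mult_pos_pos[OF \<theta>(1) M] \<theta>M by linarith
    define c where "c = (M / m) powr (1 / (2 * p))"
    have c: "c > 0" using M m0 by (simp add: c_def)
    have cp: "c powr (p + 1) = (M / m) powr s" by (simp add: c_def s_def powr_powr)
    also have "\<dots> \<le> (1 / \<theta>) powr s"
      using \<theta>M \<theta> M m0 s by (intro powr_mono2) (auto simp: field_simps)
    finally have cle: "max 1 (c powr (p + 1)) \<le> 1 + \<eta>" using \<theta>s \<eta> by simp
    have "wgrad (\<lambda>x. c * u x) (\<lambda>x. c *\<^sub>R k x)"
      using wgrad_lincomb[OF u u, of c 0] by simp
    moreover have "weighted_integral (2 * p) \<gamma> (\<lambda>x. c * u x) = ennreal M"
    proof -
      have "c powr (2 * p) = M / m" using M m0 p by (simp add: c_def powr_powr)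
      then have "\<bar>c\<bar> powr (2 * p) * m = M" using c m0 by simp
      then show ?thesis
        by (subst weighted_integral_cmult) (simp_all add: m flip: ennreal_mult)
    qed
    ultimately have "ennreal I \<le> gradient_energy p \<gamma> (\<lambda>x. c * u x) (\<lambda>x. c *\<^sub>R k x)" by (rule I)
    also have "\<dots> \<le> ennreal (max 1 (c powr (p + 1))) * gradient_energy p \<gamma> u k"
      by (rule gradient_energy_cmult_le[OF _ _ p c]) measurable
    also have "\<dots> \<le> ennreal (1 + \<eta>) * gradient_energy p \<gamma> u k"
      by (intro mult_right_mono ennreal_leI cle) simp
    finally show "ennreal I \<le> ennreal (1 + \<eta>) * gradient_energy p \<gamma> (\<lambda>x. 1/2 * v x + 1/2 * w x) (\<lambda>x. (1/2) *\<^sub>R f x + (1/2) *\<^sub>R g x)"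
      unfolding u_def k_def .
  qed
qed

text \<open>The energies of \<open>v\<close> and \<open>w\<close> exceed \<open>I\<close> by little
  and that of the midpoint is hardly below \<open>I\<close>, so the quadratic surplus in the
  parallelogram identity must be small.\<close>

lemma gradients_close:
  fixes p \<gamma> M I \<epsilon> :: real
  assumes p: "p > 1" and M: "M > 0" and I0: "I \<ge> 0" and \<epsilon>: "\<epsilon> > 0"
    and I: "\<And>(v :: 'a::euclidean_space \<Rightarrow> real) f. wgrad v f \<Longrightarrow> weighted_integral (2 * p) \<gamma> v = ennreal M \<Longrightarrow> ennreal I \<le> gradient_energy p \<gamma> v f"
  obtains e :: real where "e > 0"
    "\<And>(v :: 'a \<Rightarrow> real) f w g. wgrad v f \<Longrightarrow> weighted_integral (2 * p) \<gamma> v = ennreal M \<Longrightarrow> wgrad w g \<Longrightarrow> weighted_integral (2 * p) \<gamma> w = ennreal M \<Longrightarrow>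
      weighted_integral (2 * p) \<gamma> (\<lambda>x. v x - w x) \<le> ennreal e \<Longrightarrow> gradient_energy p \<gamma> v f \<le> ennreal (I + e) \<Longrightarrow> gradient_energy p \<gamma> w g \<le> ennreal (I + e) \<Longrightarrow>
      (\<integral>\<^sup>+x. ennreal ((norm (f x - g x))\<^sup>2) \<partial>lborel) \<le> ennreal \<epsilon>"
proof -
  \<comment> \<open>The surplus \<open>?D / 8\<close> is bounded by the gap \<open>I - a\<close>
    plus \<open>e'\<close>. Each is allowed \<open>\<epsilon> / 16\<close>, which makes
    \<open>?D\<close> at most \<epsilon>.\<close>
  define \<eta> where "\<eta> = \<epsilon> / (16 * (I + 1))"
  have \<eta>: "\<eta> > 0" using \<epsilon> I0 by (simp add: \<eta>_def)
  have I\<eta>: "I * \<eta> \<le> \<epsilon> / 16" using \<epsilon> I0 by (simp add: \<eta>_def field_simps)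
  obtain e where e: "e > 0"
    "\<And>(v :: 'a \<Rightarrow> real) f w g. wgrad v f \<Longrightarrow> weighted_integral (2 * p) \<gamma> v = ennreal M \<Longrightarrow> wgrad w g \<Longrightarrow> weighted_integral (2 * p) \<gamma> w = ennreal M \<Longrightarrow>
      weighted_integral (2 * p) \<gamma> (\<lambda>x. v x - w x) \<le> ennreal e \<Longrightarrow>
      ennreal I \<le> ennreal (1 + \<eta>) * gradient_energy p \<gamma> (\<lambda>x. 1/2 * v x + 1/2 * w x) (\<lambda>x. (1/2) *\<^sub>R f x + (1/2) *\<^sub>R g x)"
    using gradient_energy_midpoint_ge[OF p M \<eta> I] by blast
  define e' where "e' = min e (\<epsilon> / 16)"
  show thesis
  proof (rule that)
    show e': "e' > 0" using e(1) \<epsilon> by (simp add: e'_def)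
    fix v w :: "'a \<Rightarrow> real" and f g
    assume v: "wgrad v f" "weighted_integral (2 * p) \<gamma> v = ennreal M" and w: "wgrad w g" "weighted_integral (2 * p) \<gamma> w = ennreal M"
      and vw: "weighted_integral (2 * p) \<gamma> (\<lambda>x. v x - w x) \<le> ennreal e'"
      and en: "gradient_energy p \<gamma> v f \<le> ennreal (I + e')" "gradient_energy p \<gamma> w g \<le> ennreal (I + e')"
    note [measurable] = wgrad_measurable[OF v(1)] wgrad_measurable[OF w(1)]
    let ?u = "\<lambda>x. 1/2 * v x + 1/2 * w x" and ?h = "\<lambda>x. (1/2) *\<^sub>R f x + (1/2) *\<^sub>R g x"
    let ?D = "\<integral>\<^sup>+x. ennreal ((norm (f x - g x))\<^sup>2) \<partial>lborel"
    have "weighted_integral (2 * p) \<gamma> (\<lambda>x. v x - w x) \<le> ennreal e"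
      using vw by (rule order_trans) (simp add: e'_def ennreal_leI)
    note mid = e(2)[OF v w this]
    have "gradient_energy p \<gamma> ?u ?h + ennreal (1/8) * ?D \<le> ennreal (1/2) * (gradient_energy p \<gamma> v f + gradient_energy p \<gamma> w g)"
      by (rule gradient_energy_midpoint_le[OF _ _ _ _ p]) measurable
    also have "\<dots> \<le> ennreal (1/2) * (ennreal (I + e') + ennreal (I + e'))"
      by (intro mult_left_mono add_mono en) simp
    also have "\<dots> = ennreal (1/2 * ((I + e') + (I + e')))"
      using I0 e' by (simp only: ennreal_mult ennreal_plus add_nonneg_nonneg less_imp_le zero_le_divide_1_iff zero_le_numeral)
    also have "1/2 * ((I + e') + (I + e')) = I + e'" by simp
    finally have *: "gradient_energy p \<gamma> ?u ?h + ennreal (1/8) * ?D \<le> ennreal (I + e')" .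
    have "gradient_energy p \<gamma> ?u ?h \<le> ennreal (I + e')" "ennreal (1/8) * ?D \<le> ennreal (I + e')"
      by (rule order_trans[OF _ *], simp)+
    then obtain a b where a: "gradient_energy p \<gamma> ?u ?h = ennreal a" "a \<ge> 0" and b: "ennreal (1/8) * ?D = ennreal b" "b \<ge> 0"
      using I0 e' by (elim ennreal_le_realE) auto
    have ab: "a + b \<le> I + e'"
      using * a b I0 e' by (simp flip: ennreal_plus)
    have "I \<le> (1 + \<eta>) * a"
    proof -
      have "ennreal (1 + \<eta>) * ennreal a = ennreal ((1 + \<eta>) * a)"
        using a(2) \<eta> by (intro ennreal_mult[symmetric]) auto
      then show ?thesis using mid a(2) \<eta> unfolding a(1) by (simp only:) (simp add: ennreal_le_iff)
    qed
    then have "I - a \<le> \<eta> * a" by (simp add: algebra_simps)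
    moreover have "\<eta> * a \<le> I * \<eta>" if "a < I"
      using that \<eta> by (subst mult.commute) (intro mult_right_mono, auto)
    ultimately have "I - a \<le> \<epsilon> / 16"
      using I\<eta> \<epsilon> by (cases "a < I") auto
    moreover have "e' \<le> \<epsilon> / 16" by (simp add: e'_def)
    ultimately have "b \<le> \<epsilon> / 8" using ab by linarith
    have "?D = ennreal 8 * (ennreal (1/8) * ?D)"
      by (subst mult.assoc[symmetric], subst ennreal_mult[symmetric]) auto
    also have "\<dots> = ennreal (8 * b)" unfolding b(1) using b(2) by (simp add: ennreal_mult)
    also have "\<dots> \<le> ennreal \<epsilon>" using \<open>b \<le> \<epsilon> / 8\<close> by (intro ennreal_leI) simp
    finally show "?D \<le> ennreal \<epsilon>" .
  qed
qed

text \<open>As a single integral the energy is accessible to one application of Fatou's lemma, for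
  which a bound on the sum of both terms suffices.\<close>

lemma gradient_energy_eq_nn_integral:
  assumes [measurable]: "w \<in> borel_measurable borel" "g \<in> borel_measurable borel"
  shows "gradient_energy p \<gamma> w g = (\<integral>\<^sup>+x. ennreal (1/2) * ennreal ((norm (g x))\<^sup>2)
    + ennreal (1 / (p + 1)) * ennreal (\<bar>w x\<bar> powr (p + 1) * norm x powr (- \<gamma>)) \<partial>lborel)"
  unfolding gradient_energy_def weighted_integral_def
  by (subst nn_integral_add; measurable) (simp add: nn_integral_cmult)

lemma gradient_energy_limit_le:
  fixes v :: "nat \<Rightarrow> 'a::euclidean_space \<Rightarrow> real" and p :: real
  assumes [measurable]: "\<And>k. v k \<in> borel_measurable borel" "\<And>k. f k \<in> borel_measurable borel"
      "w \<in> borel_measurable borel" "g \<in> borel_measurable borel"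
    and p: "p > 1"
    and lim: "AE x in lborel. (\<lambda>k. v k x) \<longlonglongrightarrow> w x" "AE x in lborel. (\<lambda>k. f k x) \<longlonglongrightarrow> g x"
    and bd: "eventually (\<lambda>k. gradient_energy p \<gamma> (v k) (f k) \<le> B) sequentially"
  shows "gradient_energy p \<gamma> w g \<le> B"
proof -
  have m: "v k \<in> borel_measurable borel" "f k \<in> borel_measurable borel" for k by measurable
  show ?thesis
    unfolding gradient_energy_eq_nn_integral[OF assms(3,4)]
  proof (rule nn_integral_limit_le[OF _ _ bd[unfolded gradient_energy_eq_nn_integral[OF m]]])
    show "AE x in lborel. (\<lambda>k. ennreal (1/2) * ennreal ((norm (f k x))\<^sup>2)
        + ennreal (1 / (p + 1)) * ennreal (\<bar>v k x\<bar> powr (p + 1) * norm x powr (- \<gamma>)))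
      \<longlonglongrightarrow> ennreal (1/2) * ennreal ((norm (g x))\<^sup>2) + ennreal (1 / (p + 1)) * ennreal (\<bar>w x\<bar> powr (p + 1) * norm x powr (- \<gamma>))"
      using lim
    proof eventually_elim
      case (elim x)
      have "continuous_on UNIV (\<lambda>t::real. \<bar>t\<bar> powr (p + 1))"
        using p by (intro continuous_on_powr' continuous_intros) auto
      then have "isCont (\<lambda>t::real. \<bar>t\<bar> powr (p + 1)) (w x)"
        by (simp add: continuous_on_eq_continuous_at)
      from isCont_tendsto_compose[OF this elim(1)] show ?case
        by (intro tendsto_add ennreal_tendsto_cmult tendsto_ennrealI tendsto_mult tendsto_const tendsto_power tendsto_norm elim(2) ennreal_less_top) auto
    qed
  qed measurable
qed

lemma ex_minimizer_wgrad:
  fixes p \<gamma> M :: real and v0 :: "'a::euclidean_space \<Rightarrow> real"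
  assumes d: "DIM('a) \<ge> 3" and \<gamma>: "0 < \<gamma>" "\<gamma> < DIM('a)" and p: "1 < p" "p < (DIM('a) - \<gamma>) / (real DIM('a) - 2)"
    and M: "M > 0" and v0: "wgrad v0 f0" "weighted_integral (2 * p) \<gamma> v0 = ennreal M" "gradient_energy p \<gamma> v0 f0 < \<infinity>"
  obtains w :: "'a \<Rightarrow> real" and g where "wgrad w g" "weighted_integral (2 * p) \<gamma> w = ennreal M"
    "\<And>(v :: 'a \<Rightarrow> real) f. wgrad v f \<Longrightarrow> weighted_integral (2 * p) \<gamma> v = ennreal M \<Longrightarrow> gradient_energy p \<gamma> w g \<le> gradient_energy p \<gamma> v f"
proof -
  define A where "A = {(v, f). wgrad (v :: 'a \<Rightarrow> real) f \<and> weighted_integral (2 * p) \<gamma> v = ennreal M}"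
  define J where "J = (INF (v, f)\<in>A. gradient_energy p \<gamma> v f)"
  have Jle: "J \<le> gradient_energy p \<gamma> v f" if "wgrad v f" "weighted_integral (2 * p) \<gamma> v = ennreal M" for v :: "'a \<Rightarrow> real" and f
    unfolding J_def by (rule INF_lower2[of "(v, f)"]) (use that in \<open>auto simp: A_def\<close>)
  \<comment> \<open>The given pair of finite energy makes the infimum a real number
    \<open>I\<close>, to which small errors can be added.\<close>
  have "J < \<infinity>" using Jle[OF v0(1,2)] v0(3) by (rule le_less_trans)
  then obtain I where I: "J = ennreal I" "I \<ge> 0" by (cases J) auto
  have "\<exists>(v :: 'a \<Rightarrow> real) f. wgrad v f \<and> weighted_integral (2 * p) \<gamma> v = ennreal M \<and> gradient_energy p \<gamma> v f \<le> ennreal (I + 1 / real (Suc n))" for n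
  proof -
    have "J < ennreal (I + 1 / real (Suc n))" unfolding I(1) using I(2) by (intro ennreal_lessI add_nonneg_pos) auto
    then obtain z where "z \<in> A" "(case z of (v, f) \<Rightarrow> gradient_energy p \<gamma> v f) < ennreal (I + 1 / real (Suc n))"
      unfolding J_def INF_less_iff by blast
    then show ?thesis by (cases z) (auto simp: A_def intro: less_imp_le)
  qed
  then obtain v :: "nat \<Rightarrow> 'a \<Rightarrow> real" and f where v: "\<And>n. wgrad (v n) (f n)" "\<And>n. weighted_integral (2 * p) \<gamma> (v n) = ennreal M"
    "\<And>n. gradient_energy p \<gamma> (v n) (f n) \<le> ennreal (I + 1 / real (Suc n))"
    by metis
  have bdE: "gradient_energy p \<gamma> (v n) (f n) \<le> ennreal (I + 1)" for n
    using v(3)[of n] by (rule order_trans) (intro ennreal_leI, simp)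
  have I1: "I + 1 > 0" using I by simp
  obtain \<sigma> w where \<sigma>: "strict_mono (\<sigma> :: nat \<Rightarrow> nat)" and w_meas [measurable]: "w \<in> borel_measurable borel"
    and limw: "AE x in lborel. (\<lambda>n. v (\<sigma> n) x) \<longlonglongrightarrow> w x"
    and Cw: "\<And>e::real. e > 0 \<Longrightarrow> \<exists>N. \<forall>m\<ge>N. \<forall>n\<ge>N. weighted_integral (2 * p) \<gamma> (\<lambda>x. v (\<sigma> m) x - v (\<sigma> n) x) \<le> ennreal e"
    by (rule bounded_energy_compact[OF d \<gamma> p v(1) bdE I1]) (rule that)
  define V where "V n = v (\<sigma> n)" for n
  define F where "F n = f (\<sigma> n)" for n
  have wg: "wgrad (V n) (F n)" and VM: "weighted_integral (2 * p) \<gamma> (V n) = ennreal M" for n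
    unfolding V_def F_def by (rule v)+
  note [measurable] = wgrad_measurable[OF wg]
  have enV: "gradient_energy p \<gamma> (V n) (F n) \<le> ennreal (I + 1 / real (Suc n))" for n
  proof -
    have "1 / real (Suc (\<sigma> n)) \<le> 1 / real (Suc n)"
      using seq_suble[OF \<sigma>, of n] by (intro divide_left_mono) auto
    then show ?thesis
      unfolding V_def F_def by (intro order_trans[OF v(3)] ennreal_leI) auto
  qed
  have enV': "\<forall>\<^sub>F n in sequentially. gradient_energy p \<gamma> (V n) (F n) \<le> ennreal (I + e)" if "e > 0" for e :: real
  proof -
    obtain N where "1 / real (Suc N) < e" using nat_approx_posE[OF \<open>e > 0\<close>] by blast
    then have "gradient_energy p \<gamma> (V n) (F n) \<le> ennreal (I + e)" if "n \<ge> N" for n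
      using that by (intro order_trans[OF enV] ennreal_leI) (smt (verit) frac_le of_nat_0_less_iff of_nat_mono Suc_le_mono zero_less_Suc)
    then show ?thesis by (auto simp: eventually_sequentially)
  qed
  have limV: "AE x in lborel. (\<lambda>n. V n x) \<longlonglongrightarrow> w x" using limw by (simp add: V_def)
  have CV: "\<exists>N. \<forall>m\<ge>N. \<forall>n\<ge>N. weighted_integral (2 * p) \<gamma> (\<lambda>x. V m x - V n x) \<le> ennreal e" if "e > 0" for e :: real
    using Cw[OF that] by (simp add: V_def)
  have CF: "\<exists>N. \<forall>m\<ge>N. \<forall>n\<ge>N. (\<integral>\<^sup>+x. ennreal ((norm (F m x - F n x))\<^sup>2) \<partial>lborel) \<le> ennreal e" if "e > 0" for e :: real
  proof (rule gradients_close[OF p(1) M I(2) that Jle[unfolded I(1)]])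
    fix e' :: real
    assume e': "e' > 0" and close: "\<And>(v :: 'a \<Rightarrow> real) f w g. wgrad v f \<Longrightarrow> weighted_integral (2 * p) \<gamma> v = ennreal M \<Longrightarrow> wgrad w g \<Longrightarrow> weighted_integral (2 * p) \<gamma> w = ennreal M \<Longrightarrow>
      weighted_integral (2 * p) \<gamma> (\<lambda>x. v x - w x) \<le> ennreal e' \<Longrightarrow> gradient_energy p \<gamma> v f \<le> ennreal (I + e') \<Longrightarrow> gradient_energy p \<gamma> w g \<le> ennreal (I + e') \<Longrightarrow>
      (\<integral>\<^sup>+x. ennreal ((norm (f x - g x))\<^sup>2) \<partial>lborel) \<le> ennreal e"
    obtain N1 where N1: "\<And>m n. m \<ge> N1 \<Longrightarrow> n \<ge> N1 \<Longrightarrow> weighted_integral (2 * p) \<gamma> (\<lambda>x. V m x - V n x) \<le> ennreal e'"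
      using CV[OF e'] by blast
    obtain N2 where N2: "\<And>n. n \<ge> N2 \<Longrightarrow> gradient_energy p \<gamma> (V n) (F n) \<le> ennreal (I + e')"
      using enV'[OF e'] by (auto simp: eventually_sequentially)
    show ?thesis
    proof (intro exI[of _ "max N1 N2"] allI impI)
      fix m n assume mn: "m \<ge> max N1 N2" "n \<ge> max N1 N2"
      show "(\<integral>\<^sup>+x. ennreal ((norm (F m x - F n x))\<^sup>2) \<partial>lborel) \<le> ennreal e"
        by (rule close[OF wg VM wg VM N1 N2 N2]) (use mn in auto)
    qed
  qed
  \<comment> \<open>A further subsequence, needed to obtain a pointwise limit for the gradients; the
    constant weight 1 is enough as they are Cauchy in \<open>L2\<close>.\<close>
  obtain \<tau> where \<tau>: "strict_mono (\<tau> :: nat \<Rightarrow> nat)" "AE x in lborel. convergent (\<lambda>k. F (\<tau> k) x)"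
  proof (rule AE_convergent_subsequence[of F "\<lambda>_. 1"])
    fix e :: real assume "e > 0"
    then obtain N where N: "\<And>m n. m \<ge> N \<Longrightarrow> n \<ge> N \<Longrightarrow> (\<integral>\<^sup>+x. ennreal ((norm (F m x - F n x))\<^sup>2) \<partial>lborel) \<le> ennreal e"
      using CF by blast
    have "(\<integral>\<^sup>+x. ennreal (min 1 ((norm (F m x - F n x))\<^sup>2) * 1) \<partial>lborel) \<le> ennreal e" if "m \<ge> N" "n \<ge> N" for m n
      by (rule order_trans[OF _ N[OF that]]) (auto intro!: nn_integral_mono ennreal_leI)
    then show "\<exists>N. \<forall>m\<ge>N. \<forall>n\<ge>N. (\<integral>\<^sup>+x. ennreal (min 1 ((norm (F m x - F n x))\<^sup>2) * 1) \<partial>lborel) \<le> ennreal e"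
      by blast
  qed auto
  define g where "g x = lim (\<lambda>k. F (\<tau> k) x)" for x
  have g_meas [measurable]: "g \<in> borel_measurable borel"
    unfolding g_def[abs_def] by (rule borel_measurable_lim_metric) measurable
  have limF: "AE x in lborel. (\<lambda>k. F (\<tau> k) x) \<longlonglongrightarrow> g x"
    using \<tau>(2) by eventually_elim (simp add: g_def convergent_LIMSEQ_iff)
  have \<tau>_ge: "\<tau> k \<ge> k" for k by (rule seq_suble[OF \<tau>(1)])
  \<comment> \<open>The Cauchy estimate passes to the limit in its second index by Fatou's lemma
    along \<tau>, so the whole sequence converges in \<open>L2\<close>.\<close>
  have F0: "(\<lambda>n. \<integral>\<^sup>+x. ennreal ((norm (F n x - g x))\<^sup>2) \<partial>lborel) \<longlonglongrightarrow> 0"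
  proof (rule tendsto_ennreal_0I)
    fix e :: real assume "e > 0"
    then obtain N where N: "\<And>m n. m \<ge> N \<Longrightarrow> n \<ge> N \<Longrightarrow> (\<integral>\<^sup>+x. ennreal ((norm (F m x - F n x))\<^sup>2) \<partial>lborel) \<le> ennreal e"
      using CF by blast
    have "(\<integral>\<^sup>+x. ennreal ((norm (F n x - g x))\<^sup>2) \<partial>lborel) \<le> ennreal e" if n: "n \<ge> N" for n
    proof (rule nn_integral_limit_le)
      show "AE x in lborel. (\<lambda>k. ennreal ((norm (F n x - F (\<tau> k) x))\<^sup>2)) \<longlonglongrightarrow> ennreal ((norm (F n x - g x))\<^sup>2)"
        using limF by eventually_elim (intro tendsto_intros tendsto_ennrealI)
      show "\<forall>\<^sub>F k in sequentially. (\<integral>\<^sup>+x. ennreal ((norm (F n x - F (\<tau> k) x))\<^sup>2) \<partial>lborel) \<le> ennreal e"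
        using eventually_ge_at_top[of N] by eventually_elim (use n \<tau>_ge in \<open>auto intro!: N intro: order_trans\<close>)
    qed measurable
    then show "\<forall>\<^sub>F n in sequentially. (\<integral>\<^sup>+x. ennreal ((norm (F n x - g x))\<^sup>2) \<partial>lborel) \<le> ennreal e"
      by (auto simp: eventually_sequentially)
  qed
  have V0: "(\<lambda>n. weighted_integral (2 * p) \<gamma> (\<lambda>x. V n x - w x)) \<longlonglongrightarrow> 0"
  proof (rule tendsto_ennreal_0I)
    fix e :: real assume "e > 0"
    then obtain N where N: "\<And>m n. m \<ge> N \<Longrightarrow> n \<ge> N \<Longrightarrow> weighted_integral (2 * p) \<gamma> (\<lambda>x. V m x - V n x) \<le> ennreal e"
      using CV by blast
    have "weighted_integral (2 * p) \<gamma> (\<lambda>x. V n x - w x) \<le> ennreal e" if n: "n \<ge> N" for n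
    proof (rule weighted_integral_limit_le)
      show "AE x in lborel. (\<lambda>k. V n x - V k x) \<longlonglongrightarrow> V n x - w x"
        using limV by eventually_elim (intro tendsto_intros)
      show "\<forall>\<^sub>F k in sequentially. weighted_integral (2 * p) \<gamma> (\<lambda>x. V n x - V k x) \<le> ennreal e"
        using eventually_ge_at_top[of N] by eventually_elim (use n in \<open>auto intro!: N\<close>)
    qed (use p in simp_all)
    then show "\<forall>\<^sub>F n in sequentially. weighted_integral (2 * p) \<gamma> (\<lambda>x. V n x - w x) \<le> ennreal e"
      by (auto simp: eventually_sequentially)
  qed
  have wM: "weighted_integral (2 * p) \<gamma> w \<le> ennreal M"
    by (rule weighted_integral_limit_le[OF _ _ limV]) (use p VM in auto)
  then obtain m where m: "weighted_integral (2 * p) \<gamma> w = ennreal m" "0 \<le> m" "m \<le> M"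
    by (rule ennreal_le_realE) (use M in simp)
  \<comment> \<open>Fatou's lemma only gives \<open>m \<le> M\<close>. For the converse
    \<open>V n\<close> is written as \<open>w\<close> plus a remainder; \<open>n\<close> tends to
    infinity at fixed \<kappa>, and then \<kappa> tends to 0.\<close>
  have Mle: "M \<le> (1 + \<kappa>) powr (2 * p) * m" if \<kappa>: "\<kappa> > 0" for \<kappa> :: real
  proof -
    let ?B = "ennreal ((1 + 1 / \<kappa>) powr (2 * p))"
    have "ennreal M \<le> ennreal ((1 + \<kappa>) powr (2 * p)) * ennreal m + ?B * weighted_integral (2 * p) \<gamma> (\<lambda>x. V n x - w x)" for n
      using weighted_integral_add_le[of w "\<lambda>x. V n x - w x" "2 * p" \<kappa> \<gamma>] \<kappa> p(1) VM[of n] m(1) by simp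
    moreover have "(\<lambda>n. ennreal ((1 + \<kappa>) powr (2 * p)) * ennreal m + ?B * weighted_integral (2 * p) \<gamma> (\<lambda>x. V n x - w x))
      \<longlonglongrightarrow> ennreal ((1 + \<kappa>) powr (2 * p)) * ennreal m + ?B * 0"
      by (intro tendsto_add tendsto_const ennreal_tendsto_cmult V0) simp
    ultimately have "ennreal M \<le> ennreal ((1 + \<kappa>) powr (2 * p)) * ennreal m + ?B * 0"
      by (intro LIMSEQ_le_const) auto
    then have "ennreal M \<le> ennreal ((1 + \<kappa>) powr (2 * p) * m)"
      using m(2) by (simp add: ennreal_mult)
    then show ?thesis using m(2) by (subst (asm) ennreal_le_iff) auto
  qed
  have "M \<le> m"
  proof (rule LIMSEQ_le_const)
    have "(\<lambda>n. (1 + inverse (real (Suc n))) powr (2 * p) * m) \<longlonglongrightarrow> (1 + 0) powr (2 * p) * m"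
      by (intro tendsto_intros LIMSEQ_inverse_real_of_nat) auto
    then show "(\<lambda>n. (1 + inverse (real (Suc n))) powr (2 * p) * m) \<longlonglongrightarrow> m" by simp
    show "\<exists>N. \<forall>n\<ge>N. M \<le> (1 + inverse (real (Suc n))) powr (2 * p) * m"
      by (intro exI allI impI Mle) simp
  qed
  with m have wM': "weighted_integral (2 * p) \<gamma> w = ennreal M" by simp
  \<comment> \<open>Established before \<open>wgrad w g\<close>, since it provides the square
    integrability of \<open>g\<close> that the passage to the limit in the weak gradient
    requires.\<close>
  have gradient_energy_le: "gradient_energy p \<gamma> w g \<le> J"
  proof (rule ennreal_le_epsilon)
    fix e :: real assume e: "e > 0"
    have "gradient_energy p \<gamma> w g \<le> ennreal (I + e)"
    proof (rule gradient_energy_limit_le[OF _ _ _ _ p(1) _ limF])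
      show "AE x in lborel. (\<lambda>k. V (\<tau> k) x) \<longlonglongrightarrow> w x"
        using limV
        by eventually_elim (rule filterlim_compose[OF _ filterlim_subseq[OF \<tau>(1)]])
      show "\<forall>\<^sub>F k in sequentially. gradient_energy p \<gamma> (V (\<tau> k)) (F (\<tau> k)) \<le> ennreal (I + e)"
        by (rule eventually_compose_filterlim[OF enV'[OF e] filterlim_subseq[OF \<tau>(1)]])
    qed measurable
    then show "gradient_energy p \<gamma> w g \<le> J + ennreal e" using I e by (simp add: ennreal_plus)
  qed
  have "wgrad w g"
  proof (rule wgrad_limit[OF wg])
    show "weighted_integral (2 * p) \<gamma> w < \<infinity>" by (simp add: wM')
    have "(\<integral>\<^sup>+x. ennreal ((norm (g x))\<^sup>2) \<partial>lborel) \<le> ennreal (2 * I)"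
      by (rule gradient_energy_le_imp(1)[OF gradient_energy_le[unfolded I(1)] p(1) I(2)])
    then show "(\<integral>\<^sup>+x. ennreal ((norm (g x))\<^sup>2) \<partial>lborel) < \<infinity>" by (rule le_less_trans) simp
  qed (use \<gamma> p F0 V0 in auto)
  from this wM' show thesis
  proof (rule that)
    show "gradient_energy p \<gamma> w g \<le> gradient_energy p \<gamma> v f" if "wgrad v f" "weighted_integral (2 * p) \<gamma> v = ennreal M" for v :: "'a \<Rightarrow> real" and f
      using gradient_energy_le Jle[OF that] by (rule order_trans)
  qed
qed

subsection \<open>An admissible function\<close>

lemma loc_int_const: "loc_int (\<lambda>x::'a::euclidean_space. c::real)"
  unfolding loc_int_def set_integrable_def
  by (auto intro!: integrable_mult_left integrable_real_indicator borel_compact emeasure_compact_finite)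

text \<open>The integral of the derivative is unchanged by shifts along \<open>v\<close>. Averaged
  over shifts by \<open>s *\<^sub>R v\<close> with \<open>s\<close> in the unit interval, it becomes
  the integral of \<open>\<phi> (x + v) - \<phi> x\<close>, which vanishes by translation
  invariance.\<close>

lemma integral_test_function_derivative:
  fixes \<phi> :: "'a::euclidean_space \<Rightarrow> real"
  assumes \<phi>: "test_function \<phi>"
  shows "(\<integral>x. frechet_derivative \<phi> (at x) v \<partial>lborel) = 0"
proof -
  let ?I = "indicator {0..1::real} :: real \<Rightarrow> real"
  define D where "D x = frechet_derivative \<phi> (at x) v" for x
  have int: "integrable lborel D" "integrable lborel \<phi>"
    using integrable_test_function(2)[OF loc_int_const[of 1] \<phi>, of v] integrable_test_function(1)[OF loc_int_const[of 1] \<phi>]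
    by (simp_all add: D_def[abs_def])
  have [measurable]: "D \<in> borel_measurable borel" "\<phi> \<in> borel_measurable borel"
    using int[THEN borel_measurable_integrable] by simp_all
  have pair: "integrable (lborel \<Otimes>\<^sub>M lborel) (\<lambda>(s, x). ?I s * D (x + s *\<^sub>R v))"
  proof (rule integrable_pair_if_bounded_slices)
    show "(\<integral>\<^sup>+x. ennreal \<bar>D x\<bar> \<partial>lborel) < \<infinity>"
      using int(1) by (simp add: integrable_iff_bounded)
    fix s :: real assume "s \<in> {0..1}"
    then show "(\<integral>\<^sup>+x. ennreal \<bar>?I s * D (x + s *\<^sub>R v)\<bar> \<partial>lborel) \<le> (\<integral>\<^sup>+x. ennreal \<bar>D x\<bar> \<partial>lborel)"
      using nn_integral_lborel_shift[of "\<lambda>x. ennreal \<bar>D x\<bar>" "s *\<^sub>R v"] by simp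
  qed auto
  have "(\<integral>x. D x \<partial>lborel) = (\<integral>s. ?I s * (\<integral>x. D x \<partial>lborel) \<partial>lborel)" by simp
  also have "\<dots> = (\<integral>s. (\<integral>x. ?I s * D (x + s *\<^sub>R v) \<partial>lborel) \<partial>lborel)"
    using integral_lborel_shift[of D "_ *\<^sub>R v"] by simp
  also have "\<dots> = (\<integral>x. (\<integral>s. ?I s * D (x + s *\<^sub>R v) \<partial>lborel) \<partial>lborel)"
    using lborel_pair.Fubini_integral[OF pair] by simp
  also have "\<dots> = (\<integral>x. \<phi> (x + v) - \<phi> x \<partial>lborel)"
    unfolding D_def test_function_FTC[OF \<phi>] ..
  also have "\<dots> = 0"
    using int(2) integrable_lborel_shift[OF int(2), of v] integral_lborel_shift[of \<phi> v] by simp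
  finally show ?thesis by (simp add: D_def)
qed

lemma test_function_mult:
  assumes "test_function \<phi>" "test_function \<psi>"
  shows "test_function (\<lambda>x. \<phi> x * \<psi> x)"
proof -
  have "closure {x. \<phi> x * \<psi> x \<noteq> 0} \<subseteq> closure {x. \<phi> x \<noteq> 0}"
    by (intro closure_mono) auto
  moreover have "compact (closure {x. \<phi> x \<noteq> 0})" using assms by (simp add: test_function_def)
  then have "compact (closure {x. \<phi> x \<noteq> 0} \<inter> closure {x. \<phi> x * \<psi> x \<noteq> 0})"
    by (rule compact_Int_closed) (rule closed_closure)
  ultimately have "compact (closure {x. \<phi> x * \<psi> x \<noteq> 0})"
    by (simp only: Int_absorb1)
  then show ?thesis using assms by (auto simp: test_function_def intro: Ck_mult)
qed

lemma loc_int_continuous: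
  fixes f :: "'a::euclidean_space \<Rightarrow> 'b::euclidean_space"
  assumes "continuous_on UNIV f" shows "loc_int f"
  unfolding loc_int_def set_integrable_def
  using assms by (auto intro!: borel_measurable_continuous_onI borel_integrable_compact intro: continuous_on_subset)

text \<open>Integration by parts: the product of two test functions is a test function, and its
  derivative integrates to zero. The sum \<open>g\<close> is the classical gradient.\<close>

lemma test_function_wgrad:
  fixes \<phi> :: "'a::euclidean_space \<Rightarrow> real"
  assumes \<phi>: "test_function \<phi>"
  defines "g \<equiv> \<lambda>x. \<Sum>b\<in>Basis. frechet_derivative \<phi> (at x) b *\<^sub>R b"
  shows "wgrad \<phi> g" "(\<integral>\<^sup>+x. ennreal ((norm (g x))\<^sup>2) \<partial>lborel) < \<infinity>"
proof -
  have contg: "continuous_on UNIV g"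
    unfolding g_def by (intro continuous_intros test_function_continuous(2)[OF \<phi>])
  have gv: "g x \<bullet> v = frechet_derivative \<phi> (at x) v" for x v
  proof -
    interpret bounded_linear "frechet_derivative \<phi> (at x)"
      using test_function_continuous(3)[OF \<phi>] has_derivative_bounded_linear by blast
    have "frechet_derivative \<phi> (at x) v = frechet_derivative \<phi> (at x) (\<Sum>b\<in>Basis. (v \<bullet> b) *\<^sub>R b)"
      by (simp add: euclidean_representation)
    also have "\<dots> = g x \<bullet> v"
      unfolding sum scaleR by (simp add: g_def inner_sum_left inner_commute[of v] mult.commute)
    finally show ?thesis ..
  qed
  have loc: "loc_int \<phi>" "loc_int g"
    by (intro loc_int_continuous test_function_continuous(1)[OF \<phi>] contg)+
  show "wgrad \<phi> g"
    unfolding wgrad_def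
  proof (intro conjI loc allI impI)
    fix \<psi> :: "'a \<Rightarrow> real" and v assume \<psi>: "test_function \<psi>"
    have "frechet_derivative (\<lambda>x. \<psi> x * \<phi> x) (at x) v = frechet_derivative \<psi> (at x) v * \<phi> x + \<psi> x * (g x \<bullet> v)" for x
      using frechet_derivative_at[OF has_derivative_mult[OF test_function_continuous(3)[OF \<psi>] test_function_continuous(3)[OF \<phi>]], symmetric]
      by (simp add: gv)
    moreover have "(\<integral>x. frechet_derivative (\<lambda>x. \<psi> x * \<phi> x) (at x) v \<partial>lborel) = 0"
      by (intro integral_test_function_derivative test_function_mult \<phi> \<psi>)
    ultimately have "(\<integral>x. frechet_derivative \<psi> (at x) v * \<phi> x + \<psi> x * (g x \<bullet> v) \<partial>lborel) = 0" by simp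
    moreover have "integrable lborel (\<lambda>x. frechet_derivative \<psi> (at x) v * \<phi> x)"
      using integrable_test_function(2)[OF loc(1) \<psi>] by simp
    moreover have "integrable lborel (\<lambda>x. \<psi> x * (g x \<bullet> v))"
      using integrable_test_function(1)[OF loc_int_inner[OF loc(2)] \<psi>] by simp
    ultimately show "(\<integral>x. frechet_derivative \<psi> (at x) v * \<phi> x \<partial>lborel) = - (\<integral>x. \<psi> x * (g x \<bullet> v) \<partial>lborel)"
      by simp
  qed
  obtain K where K: "compact K" "\<And>x. x \<notin> K \<Longrightarrow> \<phi> x = 0" "\<And>x v. x \<notin> K \<Longrightarrow> frechet_derivative \<phi> (at x) v = 0"
    using test_function_props[OF \<phi>] by blast
  have "integrable lborel (\<lambda>x. indicator K x *\<^sub>R (norm (g x))\<^sup>2)"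
    by (intro borel_integrable_compact K(1) continuous_on_power continuous_on_norm continuous_on_subset[OF contg]) simp
  also have "(\<lambda>x. indicator K x *\<^sub>R (norm (g x))\<^sup>2) = (\<lambda>x. (norm (g x))\<^sup>2)"
  proof
    fix x show "indicator K x *\<^sub>R (norm (g x))\<^sup>2 = (norm (g x))\<^sup>2"
      using K(3)[of x] by (cases "x \<in> K") (simp_all add: g_def)
  qed
  finally show "(\<integral>\<^sup>+x. ennreal ((norm (g x))\<^sup>2) \<partial>lborel) < \<infinity>"
    by (simp add: integrable_iff_bounded)
qed

lemma weighted_integral_bump:
  fixes q \<gamma> :: real
  assumes \<gamma>: "0 < \<gamma>" "\<gamma> < DIM('a::euclidean_space)" and q: "q > 0"
  shows "weighted_integral q \<gamma> (bump (0 :: 'a) One 1) < \<infinity>" "weighted_integral q \<gamma> (bump (0 :: 'a) One 1) > 0"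
proof -
  let ?\<phi> = "bump (0 :: 'a) One 1"
  have [measurable]: "?\<phi> \<in> borel_measurable borel"
    by (intro borel_measurable_continuous_onI test_function_continuous test_function_bump) simp
  have nz: "?\<phi> x \<noteq> 0 \<longleftrightarrow> x \<in> box 0 One" for x by (rule bump_nonzero_iff) simp
  have "weighted_integral q \<gamma> ?\<phi> \<le> (\<integral>\<^sup>+x. indicator (cball (0::'a) DIM('a)) x * ennreal (norm x powr (- \<gamma>)) \<partial>lborel)"
    unfolding weighted_integral_def
  proof (rule nn_integral_mono)
    fix x :: 'a
    show "ennreal (\<bar>?\<phi> x\<bar> powr q * norm x powr (- \<gamma>)) \<le> indicator (cball 0 DIM('a)) x * ennreal (norm x powr (- \<gamma>))"
    proof (cases "x \<in> box 0 One")
      case True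
      then have "norm x \<le> DIM('a)" using box_subset_cbox norm_unit_cube_le by blast
      moreover have "\<bar>?\<phi> x\<bar> powr q \<le> 1" using bump_bounds[of 0 One 1 x] q by (intro powr_le1) auto
      ultimately show ?thesis by (auto intro!: ennreal_leI mult_left_le_one_le)
    next
      case False
      then show ?thesis using nz[of x] q by simp
    qed
  qed
  also have "\<dots> < \<infinity>" by (rule nn_integral_cball_norm_powr_finite[OF \<gamma>]) simp
  finally show "weighted_integral q \<gamma> ?\<phi> < \<infinity>" .
  show "weighted_integral q \<gamma> ?\<phi> > 0"
  proof (rule ccontr)
    assume "\<not> ?thesis"
    then have "weighted_integral q \<gamma> ?\<phi> = 0" by simp
    then have "AE x in lborel. ennreal (\<bar>?\<phi> x\<bar> powr q * norm x powr (- \<gamma>)) = 0"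
      unfolding weighted_integral_def by (subst (asm) nn_integral_0_iff_AE) auto
    then have "AE x in lborel. x \<notin> box (0 :: 'a) One"
    proof eventually_elim
      case (elim x)
      then have "\<bar>?\<phi> x\<bar> powr q * norm x powr (- \<gamma>) \<le> 0" by (simp add: ennreal_eq_0_iff)
      moreover have "\<bar>?\<phi> x\<bar> powr q * norm x powr (- \<gamma>) > 0" if "x \<in> box 0 One"
      proof -
        \<comment> \<open>The origin is a corner of the open box and does not belong to it, so the
          weight is positive throughout.\<close>
        have "x \<noteq> 0" using that by (auto simp: mem_box)
        then show ?thesis using nz[of x] that by simp
      qed
      ultimately show ?case by force
    qed
    then have "emeasure lborel (box (0 :: 'a) One) = 0"
      by (subst (asm) AE_iff_measurable[of "box 0 One"]) auto
    then show False by simp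
  qed
qed

lemma ex_admissible_wgrad:
  fixes p \<gamma> M :: real
  assumes \<gamma>: "0 < \<gamma>" "\<gamma> < DIM('a::euclidean_space)" and p: "p > 1" and M: "M > 0"
  obtains v :: "'a::euclidean_space \<Rightarrow> real" and f where "wgrad v f" "weighted_integral (2 * p) \<gamma> v = ennreal M" "gradient_energy p \<gamma> v f < \<infinity>"
proof -
  let ?\<phi> = "bump (0 :: 'a) One 1"
  define g where "g x = (\<Sum>b\<in>Basis. frechet_derivative ?\<phi> (at x) b *\<^sub>R b)" for x
  have \<phi>: "test_function ?\<phi>" by (rule test_function_bump) simp
  have wg: "wgrad ?\<phi> g" "(\<integral>\<^sup>+x. ennreal ((norm (g x))\<^sup>2) \<partial>lborel) < \<infinity>"
    using test_function_wgrad[OF \<phi>] by (simp_all add: g_def[abs_def])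
  note [measurable] = wgrad_measurable[OF wg(1)]
  obtain m where m: "weighted_integral (2 * p) \<gamma> ?\<phi> = ennreal m" "m > 0"
  proof (cases "weighted_integral (2 * p) \<gamma> ?\<phi>")
    case (real m)
    then show thesis using weighted_integral_bump(2)[OF \<gamma>, of "2 * p"] p that by simp
  next
    case top
    then show thesis using weighted_integral_bump(1)[OF \<gamma>, of "2 * p"] p by simp
  qed
  define c where "c = (M / m) powr (1 / (2 * p))"
  have c: "c > 0" using m M by (simp add: c_def)
  have "\<bar>c\<bar> powr (2 * p) * m = M" using m M p by (simp add: c_def powr_powr)
  then have "weighted_integral (2 * p) \<gamma> (\<lambda>x. c * ?\<phi> x) = ennreal M"
    using m by (subst weighted_integral_cmult) (simp_all flip: ennreal_mult)
  moreover have "wgrad (\<lambda>x. c * ?\<phi> x) (\<lambda>x. c *\<^sub>R g x)"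
    using wgrad_lincomb[OF wg(1) wg(1), of c 0] by simp
  moreover have "gradient_energy p \<gamma> (\<lambda>x. c * ?\<phi> x) (\<lambda>x. c *\<^sub>R g x) < \<infinity>"
  proof -
    have "gradient_energy p \<gamma> ?\<phi> g < \<infinity>"
      using wg(2) weighted_integral_bump(1)[OF \<gamma>, of "p + 1"] p
      unfolding gradient_energy_def infinity_ennreal_def by (intro ennreal_add_less_top[THEN iffD2] conjI ennreal_mult_less_top[THEN iffD2] disjI2 ennreal_less_top) auto
    then have "ennreal (max 1 (c powr (p + 1))) * gradient_energy p \<gamma> ?\<phi> g < \<infinity>" by (simp add: ennreal_mult_less_top)
    then show ?thesis by (rule le_less_trans[OF gradient_energy_cmult_le[OF _ _ p c], rotated 2]) measurable
  qed
  ultimately show thesis by (intro that)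
qed

subsection \<open>Passing to Borel representatives\<close>

lemma locally_integrable_cong_AE:
  fixes f f' :: "'a::euclidean_space \<Rightarrow> 'b::euclidean_space"
  assumes f: "locally_integrable f" and f' [measurable]: "f' \<in> borel_measurable borel" and ae: "AE x in lborel. f x = f' x"
  shows "locally_integrable f'"
proof -
  have m: "f \<in> borel_measurable lebesgue" "f' \<in> borel_measurable lebesgue"
    using f by (auto simp: locally_integrable_def measurable_completion)
  note [measurable] = m
  have ae': "AE x in lebesgue. f x = f' x" using ae by (rule AE_completion)
  show ?thesis
    unfolding locally_integrable_def
  proof (intro conjI allI impI m(2))
    fix K :: "'a set" assume K: "compact K"
    then have [measurable]: "K \<in> sets lebesgue" by (simp add: borel_compact)
    have "integrable lebesgue (\<lambda>x. indicator K x *\<^sub>R f x)"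
      using f K by (simp add: locally_integrable_def set_integrable_def)
    moreover have "AE x in lebesgue. indicator K x *\<^sub>R f x = indicator K x *\<^sub>R f' x"
      using ae' by eventually_elim simp
    moreover have "(\<lambda>x. indicator K x *\<^sub>R f' x) \<in> borel_measurable lebesgue" by measurable
    ultimately show "set_integrable lebesgue K f'"
      unfolding set_integrable_def by (subst integrable_cong_AE[symmetric]) auto
  qed
qed

lemma has_weak_gradient_cong_AE:
  fixes w :: "'a::euclidean_space \<Rightarrow> real"
  assumes wg: "has_weak_gradient w g" and [measurable]: "w' \<in> borel_measurable borel" "g' \<in> borel_measurable borel"
    and ae: "AE x in lborel. w x = w' x" "AE x in lborel. g x = g' x"
  shows "wgrad w' g'"
proof -
  have [measurable]: "w \<in> borel_measurable lebesgue" "g \<in> borel_measurable lebesgue"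
    using wg by (auto simp: has_weak_gradient_def locally_integrable_def)
  have [measurable]: "(\<lambda>x. x :: 'a) \<in> borel_measurable lebesgue"
    by (rule measurable_completion) simp
  note ae' = ae[THEN AE_completion]
  have "has_weak_gradient w' g'"
    unfolding has_weak_gradient_def
  proof (intro conjI allI impI ballI)
    show "locally_integrable w'" "locally_integrable g'"
      using wg ae by (auto simp: has_weak_gradient_def intro: locally_integrable_cong_AE)
    fix \<phi> :: "'a \<Rightarrow> real" and b :: 'a assume \<phi>: "test_function \<phi>" and b: "b \<in> Basis"
    have [measurable]: "\<phi> \<in> borel_measurable lebesgue" "(\<lambda>x. frechet_derivative \<phi> (at x) b) \<in> borel_measurable lebesgue"
      using test_function_continuous[OF \<phi>] by (auto intro!: measurable_completion borel_measurable_continuous_onI)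
    have "(\<integral>x. w' x * frechet_derivative \<phi> (at x) b \<partial>lebesgue) = (\<integral>x. w x * frechet_derivative \<phi> (at x) b \<partial>lebesgue)"
    proof (rule integral_cong_AE)
      show "AE x in lebesgue. w' x * frechet_derivative \<phi> (at x) b = w x * frechet_derivative \<phi> (at x) b"
        using ae'(1) by eventually_elim simp
    qed measurable
    also have "\<dots> = - (\<integral>x. (g x \<bullet> b) * \<phi> x \<partial>lebesgue)"
      using wg \<phi> b by (simp add: has_weak_gradient_def)
    also have "(\<integral>x. (g x \<bullet> b) * \<phi> x \<partial>lebesgue) = (\<integral>x. (g' x \<bullet> b) * \<phi> x \<partial>lebesgue)"
    proof (rule integral_cong_AE)
      show "AE x in lebesgue. (g x \<bullet> b) * \<phi> x = (g' x \<bullet> b) * \<phi> x"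
        using ae'(2) by eventually_elim simp
    qed measurable
    finally show "(\<integral>x. w' x * frechet_derivative \<phi> (at x) b \<partial>lebesgue) = - (\<integral>x. (g' x \<bullet> b) * \<phi> x \<partial>lebesgue)" .
  qed
  then show ?thesis by (simp add: has_weak_gradient_iff_wgrad)
qed

text \<open>Each coordinate has a Borel representative; the exceptional null sets are finite in
  number.\<close>

lemma ex_borel_representative:
  fixes f :: "'a::euclidean_space \<Rightarrow> 'b::euclidean_space"
  assumes "f \<in> borel_measurable lebesgue"
  obtains f' where "f' \<in> borel_measurable borel" "AE x in lborel. f x = f' x"
proof -
  have "\<exists>h. h \<in> borel_measurable borel \<and> (AE x in lborel. f x \<bullet> b = h x)" for b
    using completion_ex_borel_measurable_real[of "\<lambda>x. f x \<bullet> b" lborel] assms by auto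
  then obtain h where h: "\<And>b. h b \<in> borel_measurable borel" "\<And>b. AE x in lborel. f x \<bullet> b = h b x"
    by metis
  note [measurable] = h(1)
  show thesis
  proof (rule that)
    show "(\<lambda>x. \<Sum>b\<in>Basis. h b x *\<^sub>R b) \<in> borel_measurable borel" by measurable
    have "AE x in lborel. \<forall>b\<in>Basis. f x \<bullet> b = h b x"
      by (intro AE_finite_allI h(2)) simp
    then show "AE x in lborel. f x = (\<Sum>b\<in>Basis. h b x *\<^sub>R b)"
    proof eventually_elim
      case (elim x)
      then have "(\<Sum>b\<in>Basis. h b x *\<^sub>R b) = (\<Sum>b\<in>Basis. (f x \<bullet> b) *\<^sub>R b)" by (intro sum.cong) auto
      then show ?case by (simp add: euclidean_representation)
    qed
  qed
qed

lemma has_weak_gradient_ex_wgrad: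
  assumes "has_weak_gradient w g"
  obtains w' g' where "wgrad w' g'" "AE x in lborel. w x = w' x" "AE x in lborel. g x = g' x"
proof -
  have m: "w \<in> borel_measurable lebesgue" "g \<in> borel_measurable lebesgue"
    using assms by (auto simp: has_weak_gradient_def locally_integrable_def)
  obtain w' where w': "w' \<in> borel_measurable borel" "AE x in lborel. w x = w' x"
    by (rule ex_borel_representative[OF m(1)])
  obtain g' where g': "g' \<in> borel_measurable borel" "AE x in lborel. g x = g' x"
    by (rule ex_borel_representative[OF m(2)])
  show thesis
    by (rule that[OF has_weak_gradient_cong_AE[OF assms w'(1) g'(1) w'(2) g'(2)] w'(2) g'(2)])
qed

section \<open>From norms and chosen gradients to integrals of Borel functions\<close>

lemma ennreal_powr_powr_inverse:
  assumes "q > 0" shows "ennreal_powr (ennreal_powr X (1 / q)) q = X"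
  using assms by (cases X) (auto simp: ennreal_powr_def powr_powr)

lemma ennreal_powr_finite_iff: "ennreal_powr X a < top \<longleftrightarrow> X < top"
  by (auto simp: ennreal_powr_def less_top)

lemma weighted_norm_powr_eq_weighted_integral:
  fixes w :: "'a::euclidean_space \<Rightarrow> real"
  assumes "q > 0" "AE x in lborel. w x = w' x"
  shows "ennreal_powr (weighted_norm q \<gamma> w) q = weighted_integral q \<gamma> w'"
    "weighted_norm q \<gamma> w < \<infinity> \<longleftrightarrow> weighted_integral q \<gamma> w' < \<infinity>"
proof -
  have "(\<integral>\<^sup>+x. ennreal (norm (w x) powr q * norm x powr (- \<gamma>)) \<partial>lebesgue) = weighted_integral q \<gamma> w'"
    unfolding nn_integral_completion weighted_integral_def
    by (rule nn_integral_cong_AE) (use assms(2) in eventually_elim, simp)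
  then show "ennreal_powr (weighted_norm q \<gamma> w) q = weighted_integral q \<gamma> w'"
    "weighted_norm q \<gamma> w < \<infinity> \<longleftrightarrow> weighted_integral q \<gamma> w' < \<infinity>"
    using assms(1) by (simp_all add: weighted_norm_def ennreal_powr_powr_inverse ennreal_powr_finite_iff)
qed

text \<open>For \<gamma> equal to 0 the weight is 1 except at the origin, where it is 0; hence that
  point is discarded as a null set.\<close>

lemma Lq_norm_2_powr_eq:
  fixes g :: "'a::euclidean_space \<Rightarrow> 'b::real_normed_vector"
  assumes "AE x in lborel. g x = g' x"
  shows "ennreal_powr (Lq_norm 2 g) 2 = (\<integral>\<^sup>+x. ennreal ((norm (g' x))\<^sup>2) \<partial>lborel)"
    "Lq_norm 2 g < \<infinity> \<longleftrightarrow> (\<integral>\<^sup>+x. ennreal ((norm (g' x))\<^sup>2) \<partial>lborel) < \<infinity>"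
proof -
  have "(\<integral>\<^sup>+x. ennreal (norm (g x) powr 2 * norm x powr (- 0)) \<partial>lebesgue) = (\<integral>\<^sup>+x. ennreal ((norm (g' x))\<^sup>2) \<partial>lborel)"
    unfolding nn_integral_completion
    by (rule nn_integral_cong_AE) (use assms AE_lborel_singleton[of 0] in eventually_elim, simp)
  then show "ennreal_powr (Lq_norm 2 g) 2 = (\<integral>\<^sup>+x. ennreal ((norm (g' x))\<^sup>2) \<partial>lborel)"
    "Lq_norm 2 g < \<infinity> \<longleftrightarrow> (\<integral>\<^sup>+x. ennreal ((norm (g' x))\<^sup>2) \<partial>lborel) < \<infinity>"
    by (simp_all add: weighted_norm_def ennreal_powr_powr_inverse ennreal_powr_finite_iff)
qed

lemma energy_eq_gradient_energy:
  assumes p: "p > 1" and "AE x in lborel. w x = w' x" "AE x in lborel. weak_gradient w x = g' x"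
  shows "energy p \<gamma> w = gradient_energy p \<gamma> w' g'"
  using weighted_norm_powr_eq_weighted_integral(1)[of "p + 1" w w' \<gamma>] Lq_norm_2_powr_eq(1)[of "weak_gradient w" g'] assms
  by (simp add: energy_def gradient_energy_def)

lemma H_norm_finite_iff_gradient_energy:
  assumes p: "p > 1" and "AE x in lborel. w x = w' x" "AE x in lborel. weak_gradient w x = g' x"
  shows "H_norm p \<gamma> w < \<infinity> \<longleftrightarrow> gradient_energy p \<gamma> w' g' < \<infinity>"
proof -
  have "c * X < top \<longleftrightarrow> X < top" if "c = ennreal r" "r > 0" for c X r
    using that by (auto simp: ennreal_mult_less_top)
  from this[OF refl, of "1/2"] this[OF refl, of "1 / (p + 1)"] p
  have "gradient_energy p \<gamma> w' g' < \<infinity> \<longleftrightarrow> (\<integral>\<^sup>+x. ennreal ((norm (g' x))\<^sup>2) \<partial>lborel) < \<infinity> \<and> weighted_integral (p + 1) \<gamma> w' < \<infinity>"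
    unfolding gradient_energy_def infinity_ennreal_def ennreal_add_less_top by auto
  moreover have "H_norm p \<gamma> w < \<infinity> \<longleftrightarrow> weighted_norm (p + 1) \<gamma> w < \<infinity> \<and> Lq_norm 2 (weak_gradient w) < \<infinity>"
    unfolding H_norm_def infinity_ennreal_def ennreal_add_less_top ..
  ultimately show ?thesis
    using weighted_norm_powr_eq_weighted_integral(2)[of "p + 1" w w' \<gamma>] Lq_norm_2_powr_eq(2)[of "weak_gradient w" g'] assms
    by auto
qed

text \<open>Turns a competitor of the original problem into a pair to which minimality among Borel
  pairs applies.\<close>

lemma admissible_ex_wgrad:
  fixes v :: "'a::euclidean_space \<Rightarrow> real"
  assumes v: "v \<in> admissible p \<gamma> M" and p: "p > 1"
  obtains w :: "'a \<Rightarrow> real" and g where "wgrad w g" "weighted_integral (2 * p) \<gamma> w = ennreal M" "energy p \<gamma> v = gradient_energy p \<gamma> w g"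
proof -
  have "has_weak_gradient v (weak_gradient v)"
    using v unfolding admissible_def H_space_def weak_gradient_def by (auto intro: someI[of "has_weak_gradient v"])
  then obtain w g where w: "wgrad w g" "AE x in lborel. v x = w x" "AE x in lborel. weak_gradient v x = g x"
    by (rule has_weak_gradient_ex_wgrad)
  have "weighted_integral (2 * p) \<gamma> w = ennreal M"
    using v weighted_norm_powr_eq_weighted_integral(1)[OF _ w(2), of "2 * p" \<gamma>] p by (simp add: admissible_def)
  from that[OF w(1) this energy_eq_gradient_energy[OF p w(2,3)]] show thesis .
qed

text \<open>The converse passage, for the minimizer. The gradient selected by
  \<open>weak_gradient\<close> may differ from \<open>g\<close>, but a Borel representative of it
  agrees with \<open>g\<close> almost everywhere by uniqueness.\<close>

lemma wgrad_admissible: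
  fixes w :: "'a::euclidean_space \<Rightarrow> real"
  assumes wg: "wgrad w g" and M: "weighted_integral (2 * p) \<gamma> w = ennreal M" and fin: "gradient_energy p \<gamma> w g < \<infinity>" and p: "p > 1"
  shows "w \<in> admissible p \<gamma> M" "energy p \<gamma> w = gradient_energy p \<gamma> w g"
proof -
  note m = wgrad_measurable[OF wg]
  have hw: "has_weak_gradient w g" using wg m by (simp add: has_weak_gradient_iff_wgrad)
  then have "has_weak_gradient w (weak_gradient w)" unfolding weak_gradient_def by (rule someI[of "has_weak_gradient w"])
  then obtain w' g' where w': "wgrad w' g'" "AE x in lborel. w x = w' x" "AE x in lborel. weak_gradient w x = g' x"
    by (rule has_weak_gradient_ex_wgrad)
  have "AE x in lborel. g x = g' x" by (rule wgrad_unique[OF wg w'(1,2)])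
  with w'(3) have ae: "AE x in lborel. weak_gradient w x = g x" by eventually_elim simp
  have refl: "AE x in lborel. w x = w x" by simp
  show "energy p \<gamma> w = gradient_energy p \<gamma> w g" by (rule energy_eq_gradient_energy[OF p refl ae])
  have "H_norm p \<gamma> w < \<infinity>" using H_norm_finite_iff_gradient_energy[OF p refl ae] fin by simp
  moreover have "w \<in> borel_measurable lebesgue" using m(1) by (simp add: measurable_completion)
  moreover have "ennreal_powr (weighted_norm (2 * p) \<gamma> w) (2 * p) = ennreal M"
    using weighted_norm_powr_eq_weighted_integral(1)[OF _ refl, of "2 * p" \<gamma>] p M by simp
  ultimately show "w \<in> admissible p \<gamma> M"
    using hw by (auto simp: admissible_def H_space_def)
qed

theorem proposition2p5:
  fixes p \<gamma> M :: real
  assumes "CARD('d::finite) \<ge> 3"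
    and "0 < \<gamma>" and "\<gamma> < 2"
    and "1 < p" and "p < (real CARD('d) - \<gamma>) / (real CARD('d) - 2)"
    and "M > 0"
  shows "\<exists>w :: real ^ 'd \<Rightarrow> real. w \<in> admissible p \<gamma> M \<and>
           energy p \<gamma> w = (INF v \<in> (admissible p \<gamma> M :: (real ^ 'd \<Rightarrow> real) set). energy p \<gamma> v)"
proof -
  have dim: "DIM(real ^ 'd) = CARD('d)" by simp
  have d: "DIM(real ^ 'd) \<ge> 3" "\<gamma> < DIM(real ^ 'd)" "p < (real DIM(real ^ 'd) - \<gamma>) / (real DIM(real ^ 'd) - 2)"
    unfolding dim using assms by linarith+
  obtain v0 :: "real ^ 'd \<Rightarrow> real" and f0 where v0: "wgrad v0 f0" "weighted_integral (2 * p) \<gamma> v0 = ennreal M" "gradient_energy p \<gamma> v0 f0 < \<infinity>"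
    by (rule ex_admissible_wgrad[OF assms(2) d(2) assms(4,6)])
  obtain w :: "real ^ 'd \<Rightarrow> real" and g where w: "wgrad w g" "weighted_integral (2 * p) \<gamma> w = ennreal M"
    and min: "\<And>(v :: real ^ 'd \<Rightarrow> real) f. wgrad v f \<Longrightarrow> weighted_integral (2 * p) \<gamma> v = ennreal M \<Longrightarrow> gradient_energy p \<gamma> w g \<le> gradient_energy p \<gamma> v f"
    by (rule ex_minimizer_wgrad[OF d(1) assms(2) d(2) assms(4) d(3) assms(6) v0]) (rule that)
  \<comment> \<open>Comparison with \<open>v0\<close> shows that the minimizer has finite energy and
    so belongs to the function space.\<close>
  have "gradient_energy p \<gamma> w g < \<infinity>" using min[OF v0(1,2)] v0(3) by (rule le_less_trans)
  note adm = wgrad_admissible[OF w this assms(4)]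
  have "energy p \<gamma> w \<le> energy p \<gamma> v" if v: "v \<in> admissible p \<gamma> M" for v :: "real ^ 'd \<Rightarrow> real"
  proof -
    obtain v' :: "real ^ 'd \<Rightarrow> real" and f where "wgrad v' f" "weighted_integral (2 * p) \<gamma> v' = ennreal M" "energy p \<gamma> v = gradient_energy p \<gamma> v' f"
      by (rule admissible_ex_wgrad[OF v assms(4)])
    then show ?thesis using min adm(2) by simp
  qed
  then have "energy p \<gamma> w = (INF v \<in> (admissible p \<gamma> M :: (real ^ 'd \<Rightarrow> real) set). energy p \<gamma> v)"
    using adm(1) by (intro antisym INF_greatest INF_lower)
  with adm(1) show ?thesis by blast
qed

end
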